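(* For every $(\alpha,\beta)\in[0,1]^2$, $$\widetilde A_n^{\mathrm{rd}}(\alpha,\beta)=\Phi_n(\alpha,\beta).$$ Equivalently, for every $1\le u,v\le\infty$, $$A_n^{\mathrm{rd}}(u,v)=\max\left\{\frac{2n-1}{v},\ 1-\frac1u,\ \frac{2n}{v}-\frac1u,\ 1+\frac{2n}{v}-\frac{2n+1}{u}\right\}.$$ More precisely, for every fixed $(\alpha,\beta)\in[0,1]^2\setminus\{(1/r,1/r)\}$ one has, for every odd prime power $q$ and every $F:\mathbb{H}_n(\mathbb{F}_q)\to\mathbb{C}$, $$\|\mathcal{M}^{\mathrm{rd}}F\|_{\ell^{1/\beta}(\mathcal{D}_n)}\lesssim_{n,\alpha,\beta}q^{\Phi_n(\alpha,\beta)}\|F\|_{\ell^{1/\alpha}(\mathbb{H}_n(\mathbb{F}_q))},$$ and at the critical diagonal $$\|\mathcal{M}^{\mathrm{rd}}F\|_{\ell^r(\mathcal{D}_n)}\lesssim_n q^{(r-1)/r}(1+\log q)^{1/r}\|F\|_{\ell^r(\mathbb{H}_n(\mathbb{F}_q))}.$$ (Implied constants depend only on the indicated parameters, not on $q$ or $F$.) No estimate with a smaller power of $q$ can hold uniformly in $q$: for every $(\alpha,\beta)\in[0,1]^2$ and every $a<\Phi_n(\alpha,\beta)$ there is no constant $C$ with $\|\mathcal{M}^{\mathrm{rd}}F\|_{\ell^{1/\beta}(\mathcal{D}_n)}\le Cq^a\|F\|_{\ell^{1/\alpha}(\mathbb{H}_n(\mathbb{F}_q))}$ for all odd prime powers $q$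 and all $F$. Consequently, the infimum defining $A_n^{\mathrm{rd}}(u,v)$ is attained for every $(u,v)\ne(r,r)$.
   Context: $n\ge 2$ is a fixed integer, $r:=2n$, $q$ is an odd prime power, and $V:=\mathbb{F}_q^n\times\mathbb{F}_q^n=\mathbb{F}_q^r$ carries the alternating form $\sigma((x,y),(x',y'))=x\cdot y'-y\cdot x'$. The finite Heisenberg group is $\mathbb{H}_n(\mathbb{F}_q)=V\times\mathbb{F}_q$ with $(z,t)\cdot(z',t')=(z+z',t+t'+\sigma(z,z'))$. For $p=(z_0,t_0)\in\mathbb{H}_n(\mathbb{F}_q)$ and $w\in V\setminus\{0\}$, the horizontal line through $p$ with spatial direction $[w]$ is $L_{p,w}=\{(z_0+sw,\,t_0+s\sigma(z_0,w)):s\in\mathbb{F}_q\}$; its refined direction is the projective point $\mathrm{Dir}(L_{p,w})=[w:\sigma(z_0,w)]\in\mathbb{P}^r(\mathbb{F}_q)$ (independent of the choices of base point and representative). The set of refined directions is $\mathcal{D}_n=\{[w:c]\in\mathbb{P}^r(\mathbb{F}_q):w\in V\setminus\{0\},\,c\in\mathbb{F}_q\}$. For $F:\mathbb{H}_n(\mathbb{F}_q)\to\mathbb{C}$ and $\vartheta\in\mathcal{D}_n$, $\mathcal{M}^{\mathrm{rd}}F(\vartheta)=\max\sum_{p\in L}|F(p)|$, the maximum being over all horizontal lines $L$ with $\mathrm{Dir}(L)=\vartheta$. All $\ell^p$-norms are with respect to counting measure. For $1\le u,v\le\infty$, $A_n^{\mathrm{rd}}(u,v)$ is the infimum of all $a\ge0$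 for which there is a constant $C=C(n,u,v,a)$ such that $\|\mathcal{M}^{\mathrm{rd}}F\|_{\ell^v(\mathcal{D}_n)}\le Cq^a\|F\|_{\ell^u(\mathbb{H}_n(\mathbb{F}_q))}$ for every odd prime power $q$ and every $F:\mathbb{H}_n(\mathbb{F}_q)\to\mathbb{C}$. With the conventions $1/\infty=0$ and $1/0=\infty$, $\widetilde A_n^{\mathrm{rd}}(\alpha,\beta):=A_n^{\mathrm{rd}}(1/\alpha,1/\beta)$ for $(\alpha,\beta)\in[0,1]^2$. Finally $\Phi_n:=\max\{\phi_1,\phi_2,\phi_3,\phi_4\}$, where $\phi_1(\alpha,\beta)=(r-1)\beta$, $\phi_2(\alpha,\beta)=1-\alpha$, $\phi_3(\alpha,\beta)=r\beta-\alpha$, $\phi_4(\alpha,\beta)=1+r\beta-(r+1)\alpha$. *)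

theory Defs
  imports
    Complex_Main
    "HOL-Library.Extended_Nonnegative_Real"
    "HOL-Library.FuncSet"
    "HOL-Number_Theory.Prime_Powers"
    "HOL-Algebra.Ring"
begin

section \<open>The symplectic space and the Heisenberg group over a finite field\<close>

text \<open>Vectors of length \<open>n\<close> over \<open>R\<close> are functions on \<open>{..<n}\<close>, extended by \<open>undefined\<close>;
  the space \<open>V\<close> consists of pairs of such vectors.\<close>

type_synonym 'a hvec = "(nat \<Rightarrow> 'a) \<times> (nat \<Rightarrow> 'a)"

type_synonym 'a heis = "'a hvec \<times> 'a"

definition V_space :: "('a, 'm) ring_scheme \<Rightarrow> nat \<Rightarrow> 'a hvec set"
  where "V_space R n = ({..<n} \<rightarrow>\<^sub>E carrier R) \<times> ({..<n} \<rightarrow>\<^sub>E carrier R)"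

definition vzero :: "('a, 'm) ring_scheme \<Rightarrow> nat \<Rightarrow> 'a hvec"
  where "vzero R n = ((\<lambda>i\<in>{..<n}. \<zero>\<^bsub>R\<^esub>), (\<lambda>i\<in>{..<n}. \<zero>\<^bsub>R\<^esub>))"

definition vadd :: "('a, 'm) ring_scheme \<Rightarrow> nat \<Rightarrow> 'a hvec \<Rightarrow> 'a hvec \<Rightarrow> 'a hvec"
  where "vadd R n z z' =
    ((\<lambda>i\<in>{..<n}. fst z i \<oplus>\<^bsub>R\<^esub> fst z' i), (\<lambda>i\<in>{..<n}. snd z i \<oplus>\<^bsub>R\<^esub> snd z' i))"

definition vscale :: "('a, 'm) ring_scheme \<Rightarrow> nat \<Rightarrow> 'a \<Rightarrow> 'a hvec \<Rightarrow> 'a hvec"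
  where "vscale R n s z =
    ((\<lambda>i\<in>{..<n}. s \<otimes>\<^bsub>R\<^esub> fst z i), (\<lambda>i\<in>{..<n}. s \<otimes>\<^bsub>R\<^esub> snd z i))"

definition dotp :: "('a, 'm) ring_scheme \<Rightarrow> nat \<Rightarrow> (nat \<Rightarrow> 'a) \<Rightarrow> (nat \<Rightarrow> 'a) \<Rightarrow> 'a"
  where "dotp R n x y = (\<Oplus>\<^bsub>R\<^esub>i\<in>{..<n}. x i \<otimes>\<^bsub>R\<^esub> y i)"

definition sympl :: "('a, 'm) ring_scheme \<Rightarrow> nat \<Rightarrow> 'a hvec \<Rightarrow> 'a hvec \<Rightarrow> 'a"
  where "sympl R n z z' = dotp R n (fst z) (snd z') \<ominus>\<^bsub>R\<^esub> dotp R n (snd z) (fst z')"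

definition Heis :: "('a, 'm) ring_scheme \<Rightarrow> nat \<Rightarrow> 'a heis monoid"
  where "Heis R n =
    \<lparr>carrier = V_space R n \<times> carrier R,
     monoid.mult = (\<lambda>p p'. (vadd R n (fst p) (fst p'),
                     snd p \<oplus>\<^bsub>R\<^esub> snd p' \<oplus>\<^bsub>R\<^esub> sympl R n (fst p) (fst p'))),
     one = (vzero R n, \<zero>\<^bsub>R\<^esub>)\<rparr>"


section \<open>Horizontal lines and refined directions\<close>

definition hline :: "('a, 'm) ring_scheme \<Rightarrow> nat \<Rightarrow> 'a heis \<Rightarrow> 'a hvec \<Rightarrow> 'a heis set"
  where "hline R n p w =
    (\<lambda>s. (vadd R n (fst p) (vscale R n s w), snd p \<oplus>\<^bsub>R\<^esub> s \<otimes>\<^bsub>R\<^esub> sympl R n (fst p) w)) ` carrier R"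

definition hlines :: "('a, 'm) ring_scheme \<Rightarrow> nat \<Rightarrow> 'a heis set set"
  where "hlines R n = {hline R n p w | p w. p \<in> carrier (Heis R n) \<and> w \<in> V_space R n - {vzero R n}}"

text \<open>The projective point \<open>[w:c]\<close> is the class of all nonzero scalar multiples of \<open>(w, c)\<close>,
  where \<open>V \<times> F\<close> plays the role of the \<open>(2n+1)\<close>-dimensional coordinate space.\<close>

definition proj_pt :: "('a, 'm) ring_scheme \<Rightarrow> nat \<Rightarrow> 'a hvec \<Rightarrow> 'a \<Rightarrow> ('a hvec \<times> 'a) set"
  where "proj_pt R n w c = (\<lambda>l. (vscale R n l w, l \<otimes>\<^bsub>R\<^esub> c)) ` (carrier R - {\<zero>\<^bsub>R\<^esub>})"

definition refined_dirs :: "('a, 'm) ring_scheme \<Rightarrow> nat \<Rightarrow> ('a hvec \<times> 'a) set set"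
  where "refined_dirs R n = {proj_pt R n w c | w c. w \<in> V_space R n - {vzero R n} \<and> c \<in> carrier R}"

definition Dir :: "('a, 'm) ring_scheme \<Rightarrow> nat \<Rightarrow> 'a heis set \<Rightarrow> ('a hvec \<times> 'a) set"
  where "Dir R n L = (THE \<theta>. \<exists>p w. p \<in> carrier (Heis R n) \<and> w \<in> V_space R n - {vzero R n} \<and>
    L = hline R n p w \<and> \<theta> = proj_pt R n w (sympl R n (fst p) w))"

definition Mrd :: "('a, 'm) ring_scheme \<Rightarrow> nat \<Rightarrow> ('a heis \<Rightarrow> complex) \<Rightarrow> ('a hvec \<times> 'a) set \<Rightarrow> real"
  where "Mrd R n F \<theta> = Max ((\<lambda>L. \<Sum>p\<in>L. norm (F p)) ` {L \<in> hlines R n. Dir R n L = \<theta>})"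


section \<open>Norms, uniform estimates and the optimal exponent\<close>

text \<open>The \<open>\<ell>\<^sup>p\<close>-norm over a finite nonempty set, for counting measure and \<open>1 \<le> p \<le> \<infinity>\<close>.\<close>

definition lp_norm :: "ennreal \<Rightarrow> 'b set \<Rightarrow> ('b \<Rightarrow> 'c::real_normed_vector) \<Rightarrow> real"
  where "lp_norm p A f =
    (if p = \<infinity> then Max ((\<lambda>x. norm (f x)) ` A)
     else (\<Sum>x\<in>A. norm (f x) powr enn2real p) powr (1 / enn2real p))"

text \<open>The field with \<open>q\<close> elements is unique up to isomorphism, so ``for every odd prime power
  \<open>q\<close>'' is rendered by ranging over all fields with \<open>q\<close> elements. In order to quantify over
  them inside a formula (uniformly in \<open>q\<close>) their underlying sets are taken to consist of
  integers; as the type is infinite, every finite field has such a copy. The factor in the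
  estimate is a function \<open>K\<close> of \<open>q\<close> alone.\<close>

definition rd_estimate :: "nat \<Rightarrow> ennreal \<Rightarrow> ennreal \<Rightarrow> (nat \<Rightarrow> real) \<Rightarrow> bool"
  where "rd_estimate n u v K \<longleftrightarrow>
    (\<forall>q. odd q \<and> primepow q \<longrightarrow>
      (\<forall>R :: int ring. field R \<and> finite (carrier R) \<and> card (carrier R) = q \<longrightarrow>
        (\<forall>F :: int heis \<Rightarrow> complex.
          lp_norm v (refined_dirs R n) (Mrd R n F) \<le> K q * lp_norm u (carrier (Heis R n)) F)))"

definition admissible_exps :: "nat \<Rightarrow> ennreal \<Rightarrow> ennreal \<Rightarrow> real set"
  where "admissible_exps n u v =
    {a. a \<ge> 0 \<and> (\<exists>C. rd_estimate n u v (\<lambda>q. C * real q powr a))}"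

definition A_rd :: "nat \<Rightarrow> ennreal \<Rightarrow> ennreal \<Rightarrow> real"
  where "A_rd n u v = Inf (admissible_exps n u v)"

text \<open>In \<^typ>\<open>ennreal\<close> one has \<open>1 / 0 = \<infinity>\<close> and \<open>1 / \<infinity> = 0\<close>.\<close>

definition A_rd_tilde :: "nat \<Rightarrow> real \<Rightarrow> real \<Rightarrow> real"
  where "A_rd_tilde n \<alpha> \<beta> = A_rd n (1 / ennreal \<alpha>) (1 / ennreal \<beta>)"

definition Phi :: "nat \<Rightarrow> real \<Rightarrow> real \<Rightarrow> real"
  where "Phi n \<alpha> \<beta> = (let r = 2 * real n in
    Max {(r - 1) * \<beta>, 1 - \<alpha>, r * \<beta> - \<alpha>, 1 + r * \<beta> - (r + 1) * \<alpha>})"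


section \<open>Well-definedness of the refined direction and of the maximum\<close>

lemma V_space_coord:
  assumes "z \<in> V_space R n" "i < n"
  shows "fst z i \<in> carrier R" "snd z i \<in> carrier R"
  using assms unfolding V_space_def mem_Times_iff by (blast intro: PiE_mem)+

lemma V_space_eqI:
  assumes "z \<in> V_space R n" "z' \<in> V_space R n"
    and "\<And>i. i < n \<Longrightarrow> fst z i = fst z' i \<and> snd z i = snd z' i"
  shows "z = z'"
proof (rule prod_eqI)
  show "fst z = fst z'"
    using assms unfolding V_space_def mem_Times_iff
    by (intro PiE_ext[of "fst z" "{..<n}" "\<lambda>_. carrier R" "fst z'"]) simp_all
  show "snd z = snd z'"
    using assms unfolding V_space_def mem_Times_iff
    by (intro PiE_ext[of "snd z" "{..<n}" "\<lambda>_. carrier R" "snd z'"]) simp_all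
qed

lemma vscale_closed:
  fixes R (structure)
  assumes "field R" "s \<in> carrier R" "w \<in> V_space R n"
  shows "vscale R n s w \<in> V_space R n"
proof -
  interpret field R by fact
  show ?thesis
    using V_space_coord[OF assms(3)] assms(2) by (simp add: V_space_def vscale_def)
qed

lemma sympl_closed:
  fixes R (structure)
  assumes "field R" "z \<in> V_space R n" "w \<in> V_space R n"
  shows "sympl R n z w \<in> carrier R"
proof -
  interpret field R by fact
  have "dotp R n x y \<in> carrier R"
    if "x \<in> {..<n} \<rightarrow>\<^sub>E carrier R" "y \<in> {..<n} \<rightarrow>\<^sub>E carrier R" for x y
    unfolding dotp_def using that by (intro finsum_closed) (auto simp: PiE_iff)
  thus ?thesis using assms(2,3) by (auto simp: V_space_def sympl_def)
qed

lemma proj_pt_rescale: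
  fixes R (structure)
  assumes R: "field R" and l: "l \<in> carrier R" "l \<noteq> \<zero>\<^bsub>R\<^esub>" and w: "w \<in> V_space R n"
    and c: "c \<in> carrier R"
  shows "proj_pt R n (vscale R n l w) (l \<otimes>\<^bsub>R\<^esub> c) = proj_pt R n w c"
proof -
  interpret field R by fact
  have wi: "fst w i \<in> carrier R" "snd w i \<in> carrier R" if "i < n" for i
    using V_space_coord[of w R n i] w that by blast+
  have sc: "vscale R n k (vscale R n l w) = vscale R n (k \<otimes> l) w" if "k \<in> carrier R" for k
    unfolding vscale_def using that l wi by (simp add: m_assoc cong: restrict_cong)
  have im: "(\<lambda>k. k \<otimes> l) ` (carrier R - {\<zero>}) = carrier R - {\<zero>}"
  proof (intro equalityI subsetI)
    fix x assume "x \<in> (\<lambda>k. k \<otimes> l) ` (carrier R - {\<zero>})"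
    thus "x \<in> carrier R - {\<zero>}" using l integral by auto
  next
    fix x assume x: "x \<in> carrier R - {\<zero>}"
    have u: "l \<in> Units R" using l field_Units by auto
    have "x \<otimes> inv l \<otimes> l = x" using u x by (simp add: m_assoc Units_l_inv Units_closed)
    moreover have "x \<otimes> inv l \<in> carrier R - {\<zero>}"
      using u x calculation l by auto
    ultimately show "x \<in> (\<lambda>k. k \<otimes> l) ` (carrier R - {\<zero>})" by (metis imageI)
  qed
  have "proj_pt R n (vscale R n l w) (l \<otimes> c)
      = (\<lambda>k. (vscale R n (k \<otimes> l) w, (k \<otimes> l) \<otimes> c)) ` (carrier R - {\<zero>})"
    unfolding proj_pt_def using l c by (intro image_cong) (auto simp: sc m_assoc)
  also have "\<dots> = (\<lambda>k. (vscale R n k w, k \<otimes> c)) ` ((\<lambda>k. k \<otimes> l) ` (carrier R - {\<zero>}))"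
    by (simp add: image_image)
  finally show ?thesis by (simp add: im proj_pt_def)
qed

lemma Dir_hline:
  fixes R (structure)
  assumes R: "field R" and p: "p \<in> carrier (Heis R n)" and w: "w \<in> V_space R n - {vzero R n}"
  shows "Dir R n (hline R n p w) = proj_pt R n w (sympl R n (fst p) w)"
proof -
  interpret field R by fact
  have "proj_pt R n w' (sympl R n (fst p') w') = proj_pt R n w (sympl R n (fst p) w)"
    if p': "p' \<in> carrier (Heis R n)" and w': "w' \<in> V_space R n - {vzero R n}"
      and eq: "hline R n p w = hline R n p' w'" for p' w'
  proof -
    define c c' where "c = sympl R n (fst p) w" and "c' = sympl R n (fst p') w'"
    have c: "c \<in> carrier R" and c': "c' \<in> carrier R"
      using R p w p' w' by (auto simp: c_def c'_def Heis_def intro!: sympl_closed)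
    have t: "snd p \<in> carrier R" "snd p' \<in> carrier R"
      using p p' by (auto simp: Heis_def)
    have coords: "fst (fst p) i \<in> carrier R" "snd (fst p) i \<in> carrier R"
        "fst (fst p') i \<in> carrier R" "snd (fst p') i \<in> carrier R"
        "fst w i \<in> carrier R" "snd w i \<in> carrier R"
        "fst w' i \<in> carrier R" "snd w' i \<in> carrier R" if "i < n" for i
      using that p p' w w' V_space_coord[of _ R n i]
      unfolding Heis_def by (simp_all add: mem_Times_iff)
    have mem: "(vadd R n (fst p') (vscale R n s w'), snd p' \<oplus> s \<otimes> c') \<in> hline R n p w"
      if "s \<in> carrier R" for s
      using that unfolding eq by (auto simp: hline_def c'_def)
    obtain a where a: "a \<in> carrier R"
      and a1: "vadd R n (fst p') (vscale R n \<zero> w') = vadd R n (fst p) (vscale R n a w)"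
      and a2: "snd p' \<oplus> \<zero> \<otimes> c' = snd p \<oplus> a \<otimes> c"
      using mem[of \<zero>] by (auto simp: hline_def c_def)
    obtain b where b: "b \<in> carrier R"
      and b1: "vadd R n (fst p') (vscale R n \<one> w') = vadd R n (fst p) (vscale R n b w)"
      and b2: "snd p' \<oplus> \<one> \<otimes> c' = snd p \<oplus> b \<otimes> c"
      using mem[of \<one>] by (auto simp: hline_def c_def)
    define l where "l = b \<ominus> a"
    have l: "l \<in> carrier R" using a b by (simp add: l_def)
    have diff: "y = l \<otimes> v"
      if "x \<in> carrier R" "y \<in> carrier R" "z \<in> carrier R" "v \<in> carrier R"
        "x = z \<oplus> a \<otimes> v" "x \<oplus> y = z \<oplus> b \<otimes> v" for x y z v
    proof -
      have "z \<oplus> (a \<otimes> v \<oplus> y) = z \<oplus> b \<otimes> v"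
        using that a by (simp add: a_assoc)
      hence "a \<otimes> v \<oplus> y = b \<otimes> v" using that a b by simp
      hence "y = b \<otimes> v \<ominus> a \<otimes> v"
        using that a b by (metis a_comm add.inv_solve_right m_closed minus_eq)
      thus ?thesis using that a b by (simp add: l_def l_distr minus_eq l_minus)
    qed
    have w'_i: "fst w' i = l \<otimes> fst w i \<and> snd w' i = l \<otimes> snd w i" if i: "i < n" for i
    proof -
      have "fst (fst p') i = fst (fst p) i \<oplus> a \<otimes> fst w i"
        using a1 i coords[OF i] by (auto simp: vadd_def vscale_def dest!: fun_cong[of _ _ i])
      moreover have "fst (fst p') i \<oplus> fst w' i = fst (fst p) i \<oplus> b \<otimes> fst w i"
        using b1 i coords[OF i] by (auto simp: vadd_def vscale_def dest!: fun_cong[of _ _ i])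
      moreover have "snd (fst p') i = snd (fst p) i \<oplus> a \<otimes> snd w i"
        using a1 i coords[OF i] by (auto simp: vadd_def vscale_def dest!: fun_cong[of _ _ i])
      moreover have "snd (fst p') i \<oplus> snd w' i = snd (fst p) i \<oplus> b \<otimes> snd w i"
        using b1 i coords[OF i] by (auto simp: vadd_def vscale_def dest!: fun_cong[of _ _ i])
      ultimately show ?thesis using coords[OF i] diff by blast
    qed
    have w'_eq: "w' = vscale R n l w"
      using w w' w'_i vscale_closed[OF R l]
      by (intro V_space_eqI[of _ R n]) (simp_all add: vscale_def)
    have c'_eq: "c' = l \<otimes> c"
      using a2 b2 c c' t by (intro diff[of "snd p'" c' "snd p" c]) auto
    have "l \<noteq> \<zero>"
    proof
      assume "l = \<zero>"
      hence "w' = vzero R n"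
        using coords unfolding w'_eq vscale_def vzero_def by (auto intro!: restrict_ext)
      thus False using w' by simp
    qed
    thus ?thesis
      using proj_pt_rescale[OF R l _ _ c, of w n] w by (simp flip: c_def c'_def w'_eq c'_eq)
  qed
  thus ?thesis unfolding Dir_def using p w by (intro the_equality) blast+
qed

lemma sympl_surj:
  fixes R (structure)
  assumes R: "field R" and w: "w \<in> V_space R n - {vzero R n}" and c: "c \<in> carrier R"
  shows "\<exists>z \<in> V_space R n. sympl R n z w = c"
proof -
  interpret field R by fact
  define e :: "nat \<Rightarrow> 'a \<Rightarrow> nat \<Rightarrow> 'a" where "e j b = (\<lambda>i\<in>{..<n}. if i = j then b else \<zero>)" for j b
  define o' :: "nat \<Rightarrow> 'a" where "o' = (\<lambda>i\<in>{..<n}. \<zero>)"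
  have wi: "fst w i \<in> carrier R" "snd w i \<in> carrier R" if "i < n" for i
    using V_space_coord[of w R n i] w that by blast+
  have e_in: "e j b \<in> {..<n} \<rightarrow>\<^sub>E carrier R" if "b \<in> carrier R" for j b
    using that by (auto simp: e_def)
  have o_in: "o' \<in> {..<n} \<rightarrow>\<^sub>E carrier R" by (auto simp: o'_def)
  have dot_e: "dotp R n (e j b) y = b \<otimes> y j"
    if "j < n" "b \<in> carrier R" "\<And>i. i < n \<Longrightarrow> y i \<in> carrier R" for j b y
  proof -
    have "dotp R n (e j b) y = (\<Oplus>i\<in>{..<n}. if j = i then b \<otimes> y i else \<zero>)"
      unfolding dotp_def using that by (intro finsum_cong') (auto simp: e_def)
    also have "\<dots> = b \<otimes> y j"
      using that by (subst finsum_singleton) auto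
    finally show ?thesis .
  qed
  have dot_o: "dotp R n o' y = \<zero>" if "\<And>i. i < n \<Longrightarrow> y i \<in> carrier R" for y
  proof -
    have "dotp R n o' y = (\<Oplus>i\<in>{..<n}. \<zero>)"
      unfolding dotp_def using that by (intro finsum_cong') (auto simp: o'_def)
    thus ?thesis by simp
  qed
  have "\<exists>j<n. fst w j \<noteq> \<zero> \<or> snd w j \<noteq> \<zero>"
  proof (rule ccontr)
    assume "\<not> ?thesis"
    hence "w = vzero R n"
      using w by (intro V_space_eqI[of _ R n]) (simp_all add: vzero_def V_space_def)
    thus False using w by simp
  qed
  then obtain j where j: "j < n" "fst w j \<noteq> \<zero> \<or> snd w j \<noteq> \<zero>" by blast
  show ?thesis
  proof (cases "snd w j = \<zero>")
    case False
    have u: "snd w j \<in> Units R" using False j wi field_Units by auto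
    let ?b = "c \<otimes> inv (snd w j)"
    have b: "?b \<in> carrier R" using u c by auto
    have "sympl R n (e j ?b, o') w = c"
      using j b wi c u by (simp add: sympl_def dot_e dot_o m_assoc Units_l_inv minus_eq)
    moreover have "(e j ?b, o') \<in> V_space R n" using e_in[OF b] o_in by (simp add: V_space_def)
    ultimately show ?thesis by blast
  next
    case True
    hence u: "fst w j \<in> Units R" using j wi field_Units by auto
    let ?b = "\<ominus> (c \<otimes> inv (fst w j))"
    have b: "?b \<in> carrier R" using u c by auto
    have "sympl R n (o', e j ?b) w = c"
      using j b wi c u by (simp add: sympl_def dot_e dot_o m_assoc Units_l_inv minus_eq l_minus)
    moreover have "(o', e j ?b) \<in> V_space R n" using e_in[OF b] o_in by (simp add: V_space_def)
    ultimately show ?thesis by blast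
  qed
qed

lemma hlines_with_Dir_nonempty:
  fixes R (structure)
  assumes R: "field R" and \<theta>: "\<theta> \<in> refined_dirs R n"
  shows "{L \<in> hlines R n. Dir R n L = \<theta>} \<noteq> {}"
proof -
  interpret field R by fact
  obtain w c where w: "w \<in> V_space R n - {vzero R n}" and c: "c \<in> carrier R"
    and \<theta>_eq: "\<theta> = proj_pt R n w c"
    using \<theta> by (auto simp: refined_dirs_def)
  obtain z where z: "z \<in> V_space R n" "sympl R n z w = c"
    using sympl_surj[OF R w c] by blast
  have p: "(z, \<zero>) \<in> carrier (Heis R n)" using z by (simp add: Heis_def)
  have "hline R n (z, \<zero>) w \<in> hlines R n" using p w unfolding hlines_def by blast
  moreover have "Dir R n (hline R n (z, \<zero>) w) = \<theta>"
    using Dir_hline[OF R p w] z \<theta>_eq by simp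
  ultimately show ?thesis by blast
qed

lemma finite_hlines:
  assumes "finite (carrier R)"
  shows "finite (hlines R n)"
proof -
  have V: "finite (V_space R n)"
    using assms by (auto simp: V_space_def intro!: finite_PiE)
  hence "finite ((\<lambda>(p, w). hline R n p w) ` (carrier (Heis R n) \<times> V_space R n))"
    using assms by (auto simp: Heis_def)
  thus ?thesis by (rule rev_finite_subset) (auto simp: hlines_def)
qed

end

theory Submission
  imports Defs "HOL-Algebra.UnivPoly" "HOL-Number_Theory.Residues"
begin

text \<open>Everything rests on the weak type bound
  \<open>|{\<M>\<^sup>r\<^sup>dF \<ge> \<lambda>}| \<lambda>\<^sup>r \<lesssim> q\<^sup>r\<^sup>-\<^sup>1 \<parallel>F\<parallel>\<^sub>r\<^sup>r\<close>, proved by the polynomial method. After scaling by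
  \<open>q / \<lambda>\<close> and rounding, \<open>F\<close> becomes a multiplicity function \<open>f\<close> whose sum over each of the given
  lines exceeds \<open>(r + 1) q\<close>. The \<open>q |\<Theta>|\<close> homogeneous polynomials of degrees
  \<open>r (q - 1) + k\<close>, \<open>1 \<le> k \<le> q\<close>, that isolate one direction \<open>\<theta> \<in> \<Theta>\<close> each have a nontrivial
  linear combination that vanishes to order \<open>f x\<close> at every point \<open>x\<close>, as soon as
  \<open>q |\<Theta>| > \<Sum> f x\<^sup>r\<close>. The exponent is \<open>r\<close> and not \<open>r + 1 = dim \<H>\<close>, because all horizontal lines
  through \<open>x\<close> lie in a hyperplane and vanishing is only needed along it. On a horizontal line
  whose direction occurs in the top degree part, this combination has more zeros than its degree
  allows.

  The strong type bounds follow by interpolating the weak type bound with the trivial bounds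
  \<open>\<ell>\<^sup>1 \<rightarrow> \<ell>\<^sup>1\<close>, \<open>\<ell>\<^sup>1 \<rightarrow> \<ell>\<^sup>\<infinity>\<close> and \<open>\<ell>\<^sup>\<infinity> \<rightarrow> \<ell>\<^sup>\<infinity>\<close>. Sharpness is tested on the indicators of
  a point, a line, a set \<open>{(s e\<^sub>0, 0)}\<close> meeting lines in a positive proportion of all directions,
  and the whole group.\<close>

section \<open>Products of linear polynomials and multiplicities of zeros\<close>

text \<open>The combination is not homogeneous. In the largest degree that survives in it, pick a
  direction \<theta> that occurs: of the polynomials of that degree only the one isolating \<theta>
  is nonzero at \<theta>. So the top degree part is nonzero exactly where a rich line is available,
  and no space of all polynomials has to be studied. Using q degrees instead of one gains the factor
  q that leads from q^r to q^(r-1), while every degree stays at most (r + 1) q, whence the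
  threshold.

  Each isolating polynomial is a product of linear forms, so on a line it is a product of linear
  polynomials in one variable, and its Taylor coefficient of order i at x is a form of degree i in
  the direction. Vanishing is expressed by these coefficients and not by derivatives, which lose
  information in positive characteristic.

  The obstacle to strong type is the point (1/r, 1/r): about log q dyadic levels may contribute
  equally, hence the logarithm. On the rest of the lines \<alpha> = 1/r and \<beta> = 1/r,
  interpolating in the target exponent with a fixed source exponent avoids this loss.\<close>

lemma (in abelian_group) minus_eq_zero_iff:
  assumes "x \<in> carrier G" "y \<in> carrier G"
  shows "x \<ominus> y = \<zero> \<longleftrightarrow> x = y"
  using assms minus_equality[of x "\<ominus> y"] by (auto simp: minus_eq r_neg)

text \<open>\<open>Y\<close> and \<open>Y \<oplus> u\<close> are coprime because they differ by a
  unit. After cancelling the power already split off, \<open>u \<otimes> H\<close> is a multiple of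
  \<open>Y\<close>, hence so is \<open>H\<close>; this replaces any gcd theory.\<close>

lemma (in domain) pow_divides_of_shifted:
  assumes Y: "Y \<in> carrier R" "Y \<noteq> \<zero>" and u: "u \<in> Units R"
    and G: "G \<in> carrier R" and Q: "Q \<in> carrier R"
    and eq: "Y [^] (k::nat) \<otimes> Q = (Y \<oplus> u) \<otimes> G"
  shows "\<exists>H\<in>carrier R. G = Y [^] k \<otimes> H"
  using Q eq
proof (induction k arbitrary: Q)
  case 0
  then show ?case using G by (intro bexI[of _ G]) auto
next
  case (Suc k)
  have uc: "u \<in> carrier R" using u by blast
  have "Y [^] k \<otimes> (Y \<otimes> Q) = (Y \<oplus> u) \<otimes> G"
    using Suc.prems Y by (simp add: m_assoc)
  then obtain H where H: "H \<in> carrier R" "G = Y [^] k \<otimes> H"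
    using Suc.IH[of "Y \<otimes> Q"] Suc.prems Y by auto
  have "Y [^] k \<otimes> (Y \<otimes> Q) = Y [^] k \<otimes> ((Y \<oplus> u) \<otimes> H)"
    using \<open>Y [^] k \<otimes> (Y \<otimes> Q) = (Y \<oplus> u) \<otimes> G\<close> H Y uc by (simp add: m_lcomm)
  moreover have "Y [^] k \<noteq> \<zero>" using Y
    by (induction k) (auto simp: integral_iff)
  ultimately have e: "Y \<otimes> Q = (Y \<oplus> u) \<otimes> H"
    using m_lcancel[of "Y [^] k" "Y \<otimes> Q" "(Y \<oplus> u) \<otimes> H"] Y uc H Suc.prems by auto
  have "u \<otimes> H = Y \<otimes> (Q \<ominus> H)"
  proof -
    have "Y \<otimes> Q = u \<otimes> H \<oplus> Y \<otimes> H"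
      unfolding e using Y uc H by (simp add: l_distr a_comm)
    hence "Y \<otimes> Q \<ominus> Y \<otimes> H = u \<otimes> H"
      using Y uc H by (simp add: a_minus_def a_assoc r_neg)
    thus ?thesis using Y H Suc.prems by (simp add: a_minus_def r_distr r_minus)
  qed
  hence "inv u \<otimes> (u \<otimes> H) = inv u \<otimes> (Y \<otimes> (Q \<ominus> H))" by simp
  moreover have "inv u \<otimes> (u \<otimes> H) = H"
    using u uc H by (simp flip: m_assoc)
  ultimately have "H = Y \<otimes> (inv u \<otimes> (Q \<ominus> H))"
    using u Y H Suc.prems by (simp add: m_lcomm)
  thus ?case using H Y u Suc.prems
    by (intro bexI[of _ "inv u \<otimes> (Q \<ominus> H)"]) (auto simp: m_assoc)
qed


text \<open>Pairwise coprime powers that divide \<open>G\<close> are counted by splitting off one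
  factor \<open>Y s\<close> at a time: the cofactor keeps the other powers by
  \<open>pow_divides_of_shifted\<close>. The function \<open>d\<close> stands for the degree, of
  which only additivity and the value 1 on the factors are used.\<close>

lemma (in domain) prod_pow_le_degree:
  fixes d :: "'a \<Rightarrow> nat"
  assumes d_mult: "\<And>p q. p \<in> carrier R - {\<zero>} \<Longrightarrow> q \<in> carrier R - {\<zero>} \<Longrightarrow> d (p \<otimes> q) = d p + d q"
    and S: "finite S"
    and Y: "\<And>s. s \<in> S \<Longrightarrow> Y s \<in> carrier R - {\<zero>} \<and> d (Y s) = 1"
    and unit: "\<And>s t. s \<in> S \<Longrightarrow> t \<in> S \<Longrightarrow> s \<noteq> t \<Longrightarrow> \<exists>u\<in>Units R. Y s = Y t \<oplus> u"
    and G: "G \<in> carrier R - {\<zero>}"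
    and div: "\<And>s. s \<in> S \<Longrightarrow> \<exists>Q\<in>carrier R. G = Y s [^] (f s :: nat) \<otimes> Q"
  shows "sum f S \<le> d G"
  using G div
proof (induction "sum f S" arbitrary: f G)
  case 0
  then show ?case by simp
next
  case (Suc m)
  obtain s where s: "s \<in> S" "f s \<noteq> 0"
    using Suc.hyps(2) by (metis sum.neutral old.nat.distinct(2))
  then obtain k where k: "f s = Suc k" using not0_implies_Suc by blast
  obtain Q where Q: "Q \<in> carrier R" "G = Y s [^] Suc k \<otimes> Q"
    using Suc.prems(2)[OF s(1)] k by auto
  have Ys: "Y s \<in> carrier R" "Y s \<noteq> \<zero>" "d (Y s) = 1" using Y s by auto
  define G' where "G' = Y s [^] k \<otimes> Q"
  have G': "G' \<in> carrier R" using Q Ys by (simp add: G'_def)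
  have G_eq: "G = Y s \<otimes> G'"
    using Q Ys by (simp add: G'_def m_assoc m_comm m_lcomm)
  have G'0: "G' \<noteq> \<zero>" using Suc.prems(1) G_eq Ys by auto
  define f' where "f' = f(s := k)"
  have "sum f S = f s + sum f (S - {s})" using S s by (simp add: sum.remove)
  moreover have "sum f' S = k + sum f (S - {s})"
    using S s by (simp add: sum.remove f'_def)
  ultimately have sum': "m = sum f' S" using Suc.hyps(2) k by simp
  have "\<exists>Q\<in>carrier R. G' = Y t [^] f' t \<otimes> Q" if t: "t \<in> S" for t
  proof (cases "t = s")
    case True
    then show ?thesis using Q by (auto simp: f'_def G'_def)
  next
    case False
    obtain u where u: "u \<in> Units R" "Y s = Y t \<oplus> u" using unit[OF s(1) t] False by blast
    obtain Qt where "Qt \<in> carrier R" "G = Y t [^] f t \<otimes> Qt" using Suc.prems(2)[OF t] by blast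
    then show ?thesis
      using pow_divides_of_shifted[of "Y t" u G' Qt "f t"] Y[OF t] u G' G_eq False
      by (auto simp: f'_def)
  qed
  from Suc.hyps(1)[OF sum' _ this] have "sum f' S \<le> d G'" using G' G'0 by blast
  moreover have "d G = d (Y s) + d G'"
    unfolding G_eq using d_mult[of "Y s" G'] Ys G' G'0 by auto
  ultimately show ?case using Suc.hyps(2) sum' Ys by simp
qed

text \<open>The coefficient of \<open>Y\<^sup>i\<close> in the product of the linear polynomials \<open>a + b Y\<close>, \<open>(a, b)\<close>
  ranging over a list.\<close>

fun lin_coeff :: "('a, 'm) ring_scheme \<Rightarrow> ('a \<times> 'a) list \<Rightarrow> nat \<Rightarrow> 'a" where
  "lin_coeff R [] i = (if i = 0 then \<one>\<^bsub>R\<^esub> else \<zero>\<^bsub>R\<^esub>)"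
| "lin_coeff R (ab # xs) i =
    fst ab \<otimes>\<^bsub>R\<^esub> lin_coeff R xs i \<oplus>\<^bsub>R\<^esub> (case i of 0 \<Rightarrow> \<zero>\<^bsub>R\<^esub> | Suc j \<Rightarrow> snd ab \<otimes>\<^bsub>R\<^esub> lin_coeff R xs j)"

text \<open>Comes from a + bY = (a + sb) + b(Y - s): the coefficients \<open>lin_coeff\<close> of
  the shifted list are the Taylor coefficients at s of the original product.\<close>

definition lin_shift :: "('a, 'm) ring_scheme \<Rightarrow> 'a \<Rightarrow> ('a \<times> 'a) list \<Rightarrow> ('a \<times> 'a) list" where
  "lin_shift R s = map (\<lambda>ab. (fst ab \<oplus>\<^bsub>R\<^esub> s \<otimes>\<^bsub>R\<^esub> snd ab, snd ab))"

lemma (in ring) lin_coeff_closed: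
  "set xs \<subseteq> carrier R \<times> carrier R \<Longrightarrow> lin_coeff R xs i \<in> carrier R"
  by (induction xs arbitrary: i) (auto split: nat.splits)

lemma (in ring) lin_coeff_above:
  "set xs \<subseteq> carrier R \<times> carrier R \<Longrightarrow> length xs < i \<Longrightarrow> lin_coeff R xs i = \<zero>"
  by (induction xs arbitrary: i) (auto split: nat.splits)

text \<open>The argument \<open>Y\<close> is an arbitrary polynomial, so that the same expansion
  applies to the variable and to the variable minus s.\<close>

definition lin_prod :: "('a, 'm) ring_scheme \<Rightarrow> (nat \<Rightarrow> 'a) \<Rightarrow> ('a \<times> 'a) list \<Rightarrow> nat \<Rightarrow> 'a" where
  "lin_prod R Y xs = foldr (\<lambda>ab p. (monom (UP R) (fst ab) 0 \<oplus>\<^bsub>UP R\<^esub>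
      monom (UP R) (snd ab) 0 \<otimes>\<^bsub>UP R\<^esub> Y) \<otimes>\<^bsub>UP R\<^esub> p) xs \<one>\<^bsub>UP R\<^esub>"

context UP_domain begin

lemma lin_prod_closed:
  assumes "Y \<in> carrier P" "set xs \<subseteq> carrier R \<times> carrier R"
  shows "lin_prod R Y xs \<in> carrier P"
  using assms(2) by (induction xs) (auto simp: lin_prod_def assms(1) P_def[symmetric])

text \<open>The bound \<open>D\<close> may exceed the length, so that lists of different lengths
  share one range of summation; linear combinations of products of different degrees need
  this.\<close>

lemma lin_prod_expand:
  assumes Y: "Y \<in> carrier P" and "set xs \<subseteq> carrier R \<times> carrier R" "length xs \<le> D"
  shows "lin_prod R Y xs = (\<Oplus>\<^bsub>P\<^esub>i\<in>{..D}. monom P (lin_coeff R xs i) 0 \<otimes>\<^bsub>P\<^esub> Y [^]\<^bsub>P\<^esub> i)"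
  using assms(2,3)
proof (induction xs arbitrary: D)
  case Nil
  have "(\<Oplus>\<^bsub>P\<^esub>i\<in>{..D}. monom P (lin_coeff R [] i) 0 \<otimes>\<^bsub>P\<^esub> Y [^]\<^bsub>P\<^esub> i)
      = (\<Oplus>\<^bsub>P\<^esub>i\<in>{..D}. if 0 = i then \<one>\<^bsub>P\<^esub> else \<zero>\<^bsub>P\<^esub>)"
    using Y by (intro P.finsum_cong') (auto simp: P_def[symmetric])
  also have "\<dots> = \<one>\<^bsub>P\<^esub>" by (subst P.finsum_singleton) auto
  finally show ?case by (simp add: lin_prod_def P_def)
next
  case (Cons ab xs)
  obtain D' where D: "D = Suc D'" using Cons.prems by (cases D) auto
  have ab: "fst ab \<in> carrier R" "snd ab \<in> carrier R" and xs: "set xs \<subseteq> carrier R \<times> carrier R"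
    using Cons.prems by auto
  let ?c = "lin_coeff R xs" and ?C = "\<lambda>a. monom P a 0"
  have c: "?c i \<in> carrier R" for i using R.lin_coeff_closed[OF xs] .
  have C: "?C (a \<otimes> b) = ?C a \<otimes>\<^bsub>P\<^esub> ?C b" if "a \<in> carrier R" "b \<in> carrier R" for a b
    using that monom_mult[of a b 0 0] by simp
  have "lin_prod R Y (ab # xs) = (?C (fst ab) \<oplus>\<^bsub>P\<^esub> ?C (snd ab) \<otimes>\<^bsub>P\<^esub> Y) \<otimes>\<^bsub>P\<^esub> lin_prod R Y xs"
    by (simp add: lin_prod_def P_def)
  also have "\<dots> = ?C (fst ab) \<otimes>\<^bsub>P\<^esub> lin_prod R Y xs \<oplus>\<^bsub>P\<^esub> (?C (snd ab) \<otimes>\<^bsub>P\<^esub> Y) \<otimes>\<^bsub>P\<^esub> lin_prod R Y xs"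
    using ab Y lin_prod_closed[OF Y xs] by (simp add: P.l_distr)
  also have "?C (fst ab) \<otimes>\<^bsub>P\<^esub> lin_prod R Y xs =
      (\<Oplus>\<^bsub>P\<^esub>i\<in>{..D}. ?C (fst ab \<otimes> ?c i) \<otimes>\<^bsub>P\<^esub> Y [^]\<^bsub>P\<^esub> i)"
    using ab c Y Cons.prems xs
    by (subst Cons.IH[of D]) (auto simp: P.finsum_rdistr C P.m_assoc intro!: P.finsum_cong')
  also have "(?C (snd ab) \<otimes>\<^bsub>P\<^esub> Y) \<otimes>\<^bsub>P\<^esub> lin_prod R Y xs =
      (\<Oplus>\<^bsub>P\<^esub>i\<in>{..D'}. ?C (snd ab \<otimes> ?c i) \<otimes>\<^bsub>P\<^esub> Y [^]\<^bsub>P\<^esub> Suc i)"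
    using ab c Y Cons.prems xs D
    by (subst Cons.IH[of D']) (auto simp: P.finsum_rdistr C P.m_assoc P.m_lcomm P.m_comm intro!:
        P.finsum_cong')
  also have "\<dots> = (\<Oplus>\<^bsub>P\<^esub>i\<in>{..D}. ?C (case i of 0 \<Rightarrow> \<zero> | Suc j \<Rightarrow> snd ab \<otimes> ?c j) \<otimes>\<^bsub>P\<^esub> Y [^]\<^bsub>P\<^esub> i)"
    unfolding D using ab c Y
    by (subst P.finsum_Suc2) (auto split: nat.splits)
  finally show ?case
    using ab c Y
    by (subst (asm) P.finsum_addf[symmetric])
       (auto split: nat.splits simp: P.l_distr[symmetric] intro!: P.finsum_cong')
qed

lemma coeff_lin_prod:
  assumes "set xs \<subseteq> carrier R \<times> carrier R"
  shows "coeff P (lin_prod R (monom P \<one> 1) xs) i = lin_coeff R xs i"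
proof -
  let ?D = "max i (length xs)"
  have c: "lin_coeff R xs i \<in> carrier R" for i using R.lin_coeff_closed[OF assms] .
  have "monom P (lin_coeff R xs j) 0 \<otimes>\<^bsub>P\<^esub> monom P \<one> 1 [^]\<^bsub>P\<^esub> j
      = monom P (lin_coeff R xs j) j" for j
    using c[of j] monom_mult[of "lin_coeff R xs j" \<one> 0 j] monom_pow[of \<one> 1 j]
    by (simp only: R.nat_pow_one R.one_closed R.r_one add_0 mult_1)
  hence "lin_prod R (monom P \<one> 1) xs =
      (\<Oplus>\<^bsub>P\<^esub>j\<in>{..?D}. monom P (lin_coeff R xs j) j)"
    using assms by (subst lin_prod_expand[of _ _ ?D]) auto
  hence "coeff P (lin_prod R (monom P \<one> 1) xs) i =
      (\<Oplus>j\<in>{..?D}. coeff P (monom P (lin_coeff R xs j) j) i)"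
    using c by (simp only:, intro coeff_finsum) auto
  also have "\<dots> = (\<Oplus>j\<in>{..?D}. if i = j then lin_coeff R xs j else \<zero>)"
    using c by (intro R.finsum_cong') auto
  finally show ?thesis using c by (simp add: R.finsum_singleton)
qed

lemma lin_prod_shift:
  assumes "set xs \<subseteq> carrier R \<times> carrier R" "s \<in> carrier R" "Y \<in> carrier P"
  shows "lin_prod R Y xs = lin_prod R (Y \<ominus>\<^bsub>P\<^esub> monom P s 0) (lin_shift R s xs)"
  using assms(1)
proof (induction xs)
  case (Cons ab xs)
  let ?C = "\<lambda>a. monom P a 0"
  have ab: "fst ab \<in> carrier R" "snd ab \<in> carrier R" using Cons.prems by auto
  have C: "?C (s \<otimes> snd ab) = ?C (snd ab) \<otimes>\<^bsub>P\<^esub> ?C s"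
    using assms(2) ab monom_mult[of "snd ab" s 0 0] by (simp add: R.m_comm)
  have "?C (fst ab) \<oplus>\<^bsub>P\<^esub> ?C (snd ab) \<otimes>\<^bsub>P\<^esub> Y =
     ?C (fst ab \<oplus> s \<otimes> snd ab) \<oplus>\<^bsub>P\<^esub> ?C (snd ab) \<otimes>\<^bsub>P\<^esub> (Y \<ominus>\<^bsub>P\<^esub> ?C s)"
    using ab assms
    by (simp add: C P.r_distr P.r_minus P.minus_eq P.a_assoc)
       (metis (no_types, lifting) P.a_comm P.a_lcomm P.add.inv_closed P.m_closed P.r_neg2
           monom_closed)
  with Cons show ?case by (simp add: lin_prod_def lin_shift_def P_def[symmetric])
qed (simp add: lin_prod_def lin_shift_def)

lemma lin_comb_expand:
  assumes Y: "Y \<in> carrier P" and "finite I"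
    and xs: "\<And>t. t \<in> I \<Longrightarrow> set (xs t) \<subseteq> carrier R \<times> carrier R \<and> length (xs t) \<le> D"
    and a: "a \<in> I \<rightarrow> carrier R"
  shows "(\<Oplus>\<^bsub>P\<^esub>t\<in>I. monom P (a t) 0 \<otimes>\<^bsub>P\<^esub> lin_prod R Y (xs t)) =
     (\<Oplus>\<^bsub>P\<^esub>i\<in>{..D}. monom P (\<Oplus>t\<in>I. a t \<otimes> lin_coeff R (xs t) i) 0 \<otimes>\<^bsub>P\<^esub> Y [^]\<^bsub>P\<^esub> i)"
  using assms(2,3,4)
proof (induction I)
  case empty
  have "(\<Oplus>\<^bsub>P\<^esub>i\<in>{..D}. monom P \<zero> 0 \<otimes>\<^bsub>P\<^esub> Y [^]\<^bsub>P\<^esub> i) = (\<Oplus>\<^bsub>P\<^esub>i\<in>{..D}. \<zero>\<^bsub>P\<^esub>)"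
    using Y by (intro P.finsum_cong') auto
  then show ?case by simp
next
  case (insert t I)
  let ?C = "\<lambda>a. monom P a 0"
  have xt: "set (xs t) \<subseteq> carrier R \<times> carrier R" "length (xs t) \<le> D"
    and at: "a t \<in> carrier R" and aI: "a \<in> I \<rightarrow> carrier R" using insert by auto
  have c: "lin_coeff R (xs j) i \<in> carrier R" if "j \<in> insert t I" for i j
    using insert.prems(1)[OF that] R.lin_coeff_closed by blast
  have s: "(\<Oplus>t\<in>I. a t \<otimes> lin_coeff R (xs t) i) \<in> carrier R" for i
    using c aI by (intro R.finsum_closed) auto
  have C: "?C (a \<otimes> b) = ?C a \<otimes>\<^bsub>P\<^esub> ?C b" if "a \<in> carrier R" "b \<in> carrier R" for a b
    using that monom_mult[of a b 0 0] by simp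
  have "?C (a t) \<otimes>\<^bsub>P\<^esub> lin_prod R Y (xs t) =
      (\<Oplus>\<^bsub>P\<^esub>i\<in>{..D}. ?C (a t \<otimes> lin_coeff R (xs t) i) \<otimes>\<^bsub>P\<^esub> Y [^]\<^bsub>P\<^esub> i)"
    using at c Y xt
    by (subst lin_prod_expand[of _ _ D]) (auto simp: P.finsum_rdistr C P.m_assoc intro!:
        P.finsum_cong')
  moreover have "(\<Oplus>\<^bsub>P\<^esub>t\<in>insert t I. ?C (a t) \<otimes>\<^bsub>P\<^esub> lin_prod R Y (xs t)) =
      ?C (a t) \<otimes>\<^bsub>P\<^esub> lin_prod R Y (xs t) \<oplus>\<^bsub>P\<^esub> (\<Oplus>\<^bsub>P\<^esub>t\<in>I. ?C (a t) \<otimes>\<^bsub>P\<^esub> lin_prod R Y (xs t))"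
    using insert Y by (intro P.finsum_insert) (auto intro!: P.m_closed monom_closed lin_prod_closed)
  moreover have "(\<Oplus>t\<in>insert t I. a t \<otimes> lin_coeff R (xs t) i) =
      a t \<otimes> lin_coeff R (xs t) i \<oplus> (\<Oplus>t\<in>I. a t \<otimes> lin_coeff R (xs t) i)" for i
    using insert c by (intro R.finsum_insert) auto
  ultimately show ?case
    using insert.IH insert.prems at c s Y aI
    by (auto simp: P.finsum_addf[symmetric] P.l_distr[symmetric] intro!: P.finsum_cong')
qed


text \<open>Vanishing of the first \<open>f s\<close> shifted coefficients makes the combination
  divisible by (X - s)^(f s). These powers are pairwise coprime, so a degree at most
  \<open>D\<close> leaves only the zero polynomial. The sum is formed in \<open>P\<close> and not as
  a function on the field, since its values at q points would not determine it.\<close>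

lemma lin_comb_eq_zero:
  assumes R: "field R" and fin: "finite (carrier R)" and I: "finite I"
    and xs: "\<And>t. t \<in> I \<Longrightarrow> set (xs t) \<subseteq> carrier R \<times> carrier R \<and> length (xs t) \<le> D"
    and a: "a \<in> I \<rightarrow> carrier R"
    and vanish: "\<And>s i. s \<in> carrier R \<Longrightarrow> i < f s \<Longrightarrow>
        (\<Oplus>t\<in>I. a t \<otimes> lin_coeff R (lin_shift R s (xs t)) i) = \<zero>"
    and D: "D < sum f (carrier R)"
  shows "(\<Oplus>t\<in>I. a t \<otimes> lin_coeff R (xs t) i) = \<zero>"
proof -
  interpret F: field R by fact
  let ?C = "\<lambda>a. monom P a 0" and ?X = "monom P \<one> 1"
  define Y where "Y s = ?X \<ominus>\<^bsub>P\<^esub> ?C s" for s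
  define G where "G = (\<Oplus>\<^bsub>P\<^esub>t\<in>I. ?C (a t) \<otimes>\<^bsub>P\<^esub> lin_prod R ?X (xs t))"
  have X: "?X \<in> carrier P" by simp
  have nontriv: "carrier R \<noteq> {\<zero>}" using R.one_not_zero R.one_closed by blast
  have Y_cl: "Y s \<in> carrier P" if "s \<in> carrier R" for s using that by (simp add: Y_def)
  have lp_cl: "lin_prod R ?X (xs t) \<in> carrier P" if "t \<in> I" for t
    using lin_prod_closed[OF X] xs[OF that] by blast
  have at: "a t \<in> carrier R" if "t \<in> I" for t using a that by blast
  have G_cl: "G \<in> carrier P"
    unfolding G_def using lp_cl at by (intro P.finsum_closed) auto
  have coeff_G: "coeff P G j = (\<Oplus>t\<in>I. a t \<otimes> lin_coeff R (xs t) j)" for j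
  proof -
    have "coeff P G j = (\<Oplus>t\<in>I. coeff P (?C (a t) \<otimes>\<^bsub>P\<^esub> lin_prod R ?X (xs t)) j)"
      unfolding G_def using lp_cl at I by (intro coeff_finsum) auto
    also have "\<dots> = (\<Oplus>t\<in>I. a t \<otimes> lin_coeff R (xs t) j)"
    proof (intro R.finsum_cong' refl)
      fix t assume t: "t \<in> I"
      show "coeff P (?C (a t) \<otimes>\<^bsub>P\<^esub> lin_prod R ?X (xs t)) j = a t \<otimes> lin_coeff R (xs t) j"
        using t at lp_cl xs[OF t] coeff_lin_prod[of "xs t" j]
        by (simp only: monom_mult_is_smult coeff_smult)
    qed (use at xs R.lin_coeff_closed in auto)
    finally show ?thesis .
  qed
  have "G = \<zero>\<^bsub>P\<^esub>"
  proof (rule ccontr)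
    assume G0: "G \<noteq> \<zero>\<^bsub>P\<^esub>"
    have degY: "deg R (Y s) = 1" if "s \<in> carrier R" for s
      using deg_monom_minus[OF that nontriv] by (simp add: Y_def)
    have "sum f (carrier R) \<le> deg R G"
    proof (rule domain.prod_pow_le_degree[OF UP_domain, of "deg R" "carrier R" Y])
      fix s assume s: "s \<in> carrier R"
      show "Y s \<in> carrier P - {\<zero>\<^bsub>P\<^esub>} \<and> deg R (Y s) = 1"
        using degY[OF s] Y_cl[OF s] deg_zero by auto
      have sh: "set (lin_shift R s (xs t)) \<subseteq> carrier R \<times> carrier R \<and>
          length (lin_shift R s (xs t)) \<le> max D (f s)" if "t \<in> I" for t
        using xs[OF that] s unfolding lin_shift_def by fastforce
      define e where "e j = (\<Oplus>t\<in>I. a t \<otimes> lin_coeff R (lin_shift R s (xs t)) j)" for j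
      have e_cl: "e j \<in> carrier R" for j
        unfolding e_def using at sh R.lin_coeff_closed by (intro R.finsum_closed) blast
      have "G = (\<Oplus>\<^bsub>P\<^esub>t\<in>I. ?C (a t) \<otimes>\<^bsub>P\<^esub> lin_prod R (Y s) (lin_shift R s (xs t)))"
        unfolding G_def Y_def using xs s at lp_cl X
        by (intro P.finsum_cong' refl arg_cong[of _ _ "\<lambda>p. _ \<otimes>\<^bsub>P\<^esub> p"] lin_prod_shift)
           (auto simp: lin_prod_shift[symmetric])
      also have "\<dots> = (\<Oplus>\<^bsub>P\<^esub>j\<in>{..max D (f s)}. ?C (e j) \<otimes>\<^bsub>P\<^esub> Y s [^]\<^bsub>P\<^esub> j)"
        unfolding e_def by (rule lin_comb_expand[OF Y_cl[OF s] I sh a])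
      \<comment> \<open>In the expansion around s all terms of index below \<open>f s\<close> are
        zero, and \<open>Y s\<close> to the power \<open>f s\<close> comes out of the
        others.\<close>
      also have "\<dots> = (\<Oplus>\<^bsub>P\<^esub>j\<in>{..max D (f s)}. Y s [^]\<^bsub>P\<^esub> f s \<otimes>\<^bsub>P\<^esub>
            (if j < f s then \<zero>\<^bsub>P\<^esub> else ?C (e j) \<otimes>\<^bsub>P\<^esub> Y s [^]\<^bsub>P\<^esub> (j - f s)))"
      proof (intro P.finsum_cong' refl)
        fix j
        show "?C (e j) \<otimes>\<^bsub>P\<^esub> Y s [^]\<^bsub>P\<^esub> j = Y s [^]\<^bsub>P\<^esub> f s \<otimes>\<^bsub>P\<^esub>
            (if j < f s then \<zero>\<^bsub>P\<^esub> else ?C (e j) \<otimes>\<^bsub>P\<^esub> Y s [^]\<^bsub>P\<^esub> (j - f s))"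
        proof (cases "j < f s")
          case True
          then have "e j = \<zero>" using vanish[OF s] by (simp add: e_def)
          then show ?thesis using True Y_cl[OF s] by simp
        next
          case False
          then have "Y s [^]\<^bsub>P\<^esub> j = Y s [^]\<^bsub>P\<^esub> f s \<otimes>\<^bsub>P\<^esub> Y s [^]\<^bsub>P\<^esub> (j - f s)"
            using Y_cl[OF s] by (simp add: P.nat_pow_mult)
          then show ?thesis using False Y_cl[OF s] e_cl by (simp add: P.m_lcomm)
        qed
      qed (use Y_cl[OF s] e_cl in auto)
      also have "\<dots> = Y s [^]\<^bsub>P\<^esub> f s \<otimes>\<^bsub>P\<^esub> (\<Oplus>\<^bsub>P\<^esub>j\<in>{..max D (f s)}.
            (if j < f s then \<zero>\<^bsub>P\<^esub> else ?C (e j) \<otimes>\<^bsub>P\<^esub> Y s [^]\<^bsub>P\<^esub> (j - f s)))"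
        using Y_cl[OF s] e_cl by (intro P.finsum_rdistr[symmetric]) auto
      finally show "\<exists>Q\<in>carrier P. G = Y s [^]\<^bsub>P\<^esub> f s \<otimes>\<^bsub>P\<^esub> Q"
        using Y_cl[OF s] e_cl by (auto intro!: bexI P.finsum_closed)
    next
      fix s t assume st: "s \<in> carrier R" "t \<in> carrier R" "s \<noteq> t"
      define u where "u = t \<ominus> s"
      have u: "u \<in> carrier R" "u \<noteq> \<zero>" using st by (auto simp: u_def R.minus_eq_zero_iff)
      have iu: "inv u \<in> carrier R" "u \<otimes> inv u = \<one>" "inv u \<otimes> u = \<one>"
        using u F.field_Units by auto
      have "?C u \<in> Units P"
        using u iu monom_mult[of u "inv u" 0 0] monom_mult[of "inv u" u 0 0]
        by (auto simp: Units_def intro!: bexI[of _ "?C (inv u)"])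
      moreover have "Y s = Y t \<oplus>\<^bsub>P\<^esub> ?C u"
        unfolding Y_def u_def using st
        by (simp add: R.minus_eq P.minus_eq P.a_assoc P.l_neg P.r_neg1)
      ultimately show "\<exists>u\<in>Units P. Y s = Y t \<oplus>\<^bsub>P\<^esub> u" by blast
    qed (use G_cl G0 fin deg_mult in auto)
    moreover have "deg R G \<le> D"
    proof (rule deg_aboveI[OF _ G_cl])
      fix m assume "D < m"
      hence "lin_coeff R (xs t) m = \<zero>" if "t \<in> I" for t
        using xs[OF that] R.lin_coeff_above[of "xs t" m] by simp
      hence "(\<Oplus>t\<in>I. a t \<otimes> lin_coeff R (xs t) m) = (\<Oplus>t\<in>I. \<zero>)"
        using at by (intro R.finsum_cong') auto
      thus "coeff P G m = \<zero>" by (simp add: coeff_G)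
    qed
    ultimately show False using D by simp
  qed
  thus ?thesis using coeff_G[of i] by simp
qed

end

section \<open>Forms with prescribed vanishing\<close>

definition multidegs :: "nat \<Rightarrow> nat \<Rightarrow> (nat \<Rightarrow> nat) set" where
  "multidegs r i = {\<gamma> \<in> {..<r} \<rightarrow>\<^sub>E UNIV. sum \<gamma> {..<r} = i}"

lemma multidegs_subset: "i < f \<Longrightarrow> multidegs r i \<subseteq> {..<r} \<rightarrow>\<^sub>E {..<f}"
proof
  fix \<gamma> assume g: "i < f" "\<gamma> \<in> multidegs r i"
  have "\<gamma> j < f" if "j < r" for j
    using member_le_sum[of j "{..<r}" \<gamma>] g that by (auto simp: multidegs_def)
  then show "\<gamma> \<in> {..<r} \<rightarrow>\<^sub>E {..<f}" using g by (auto simp: multidegs_def PiE_iff)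
qed

lemma finite_multidegs: "finite (multidegs r i)"
  using multidegs_subset[of i "Suc i" r] by (rule finite_subset[OF _ finite_PiE]) auto

text \<open>Multidegrees of total degree below f have all entries below f. The crude count of the
  box instead of a binomial coefficient costs only a constant factor and gives a clean power
  f^r.\<close>

lemma sum_card_multidegs_le: "(\<Sum>i<f. card (multidegs r i)) \<le> f ^ r"
proof -
  have "(\<Sum>i<f. card (multidegs r i)) = card (\<Union>i\<in>{..<f}. multidegs r i)"
    using finite_multidegs by (intro card_UN_disjoint[symmetric]) (auto simp: multidegs_def)
  also have "\<dots> \<le> card ({..<r} \<rightarrow>\<^sub>E {..<f})"
    using multidegs_subset[of _ f r] by (intro card_mono finite_PiE UN_least) blast+
  also have "\<dots> = f ^ r" by (simp add: card_PiE)
  finally show ?thesis .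
qed

definition monomial :: "('a, 'm) ring_scheme \<Rightarrow> nat \<Rightarrow> (nat \<Rightarrow> 'v \<Rightarrow> 'a) \<Rightarrow> (nat \<Rightarrow> nat) \<Rightarrow> 'v \<Rightarrow> 'a" where
  "monomial R r X \<gamma> w = (\<Otimes>\<^bsub>R\<^esub>j\<in>{..<r}. X j w [^]\<^bsub>R\<^esub> \<gamma> j)"

text \<open>A form is kept as a function on \<open>V\<close> that has some representation by
  coefficients. Over a finite field the representation need not be unique, which is harmless: only
  an upper bound for the number of forms is wanted.\<close>

definition homog :: "('a, 'm) ring_scheme \<Rightarrow> nat \<Rightarrow> (nat \<Rightarrow> 'v \<Rightarrow> 'a) \<Rightarrow> 'v set \<Rightarrow> nat \<Rightarrow> ('v \<Rightarrow> 'a) \<Rightarrow>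
    bool" where
  "homog R r X V i g \<longleftrightarrow> (\<exists>c \<in> multidegs r i \<rightarrow> carrier R.
     \<forall>w\<in>V. g w = (\<Oplus>\<^bsub>R\<^esub>\<gamma>\<in>multidegs r i. c \<gamma> \<otimes>\<^bsub>R\<^esub> monomial R r X \<gamma> w))"

locale coordinates = field R for R (structure) +
  fixes r :: nat and X :: "nat \<Rightarrow> 'v \<Rightarrow> 'a" and V :: "'v set"
  assumes X_closed: "\<And>j w. j < r \<Longrightarrow> w \<in> V \<Longrightarrow> X j w \<in> carrier R"
begin

abbreviation "hg \<equiv> homog R r X V"

lemma monomial_closed: "w \<in> V \<Longrightarrow> monomial R r X \<gamma> w \<in> carrier R"
  unfolding monomial_def using X_closed by (intro finprod_closed) auto

lemma homogE:
  assumes "hg i g"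
  obtains c where "c \<in> multidegs r i \<rightarrow> carrier R"
    "\<forall>w\<in>V. g w = (\<Oplus>\<gamma>\<in>multidegs r i. c \<gamma> \<otimes> monomial R r X \<gamma> w)"
  using assms unfolding homog_def by (rule bexE)

lemma homog_closed: "hg i g \<Longrightarrow> w \<in> V \<Longrightarrow> g w \<in> carrier R"
  unfolding homog_def using monomial_closed
  by (auto intro!: finsum_closed simp: Pi_iff)

lemma homog_cong: "hg i g \<Longrightarrow> (\<And>w. w \<in> V \<Longrightarrow> g w = h w) \<Longrightarrow> hg i h"
  unfolding homog_def by metis

lemma homog_zero: "hg i (\<lambda>w. \<zero>)"
proof -
  have "(\<Oplus>\<gamma>\<in>multidegs r i. \<zero> \<otimes> monomial R r X \<gamma> w) = \<zero>" if "w \<in> V" for w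
  proof -
    have "(\<Oplus>\<gamma>\<in>multidegs r i. \<zero> \<otimes> monomial R r X \<gamma> w) = (\<Oplus>\<gamma>\<in>multidegs r i. \<zero>)"
      using monomial_closed[OF that] by (intro finsum_cong' l_null) auto
    then show ?thesis by (simp only: finsum_zero)
  qed
  from this[symmetric] show ?thesis
    unfolding homog_def
    by (intro bexI[of _ "\<lambda>_. \<zero>"] ballI) (assumption | rule Pi_I zero_closed)+
qed

lemma homog_add:
  assumes "hg i g" "hg i h"
  shows "hg i (\<lambda>w. g w \<oplus> h w)"
proof -
  obtain c where c: "c \<in> multidegs r i \<rightarrow> carrier R"
      "\<forall>w\<in>V. g w = (\<Oplus>\<gamma>\<in>multidegs r i. c \<gamma> \<otimes> monomial R r X \<gamma> w)"
    by (rule homogE[OF assms(1)])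
  note cm = funcset_mem[OF c(1)]
  obtain d where d: "d \<in> multidegs r i \<rightarrow> carrier R"
      "\<forall>w\<in>V. h w = (\<Oplus>\<gamma>\<in>multidegs r i. d \<gamma> \<otimes> monomial R r X \<gamma> w)"
    by (rule homogE[OF assms(2)])
  note dm = funcset_mem[OF d(1)]
  have "g w \<oplus> h w = (\<Oplus>\<gamma>\<in>multidegs r i. (c \<gamma> \<oplus> d \<gamma>) \<otimes> monomial R r X \<gamma> w)" if w: "w \<in> V" for w
  proof -
    have "(\<Oplus>\<gamma>\<in>multidegs r i. (c \<gamma> \<oplus> d \<gamma>) \<otimes> monomial R r X \<gamma> w) =
      (\<Oplus>\<gamma>\<in>multidegs r i. c \<gamma> \<otimes> monomial R r X \<gamma> w \<oplus> d \<gamma> \<otimes> monomial R r X \<gamma> w)"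
      using cm dm monomial_closed[OF w] by (intro finsum_cong') (auto intro!: l_distr)
    also have "\<dots> = g w \<oplus> h w"
      unfolding c(2)[rule_format, OF w] d(2)[rule_format, OF w]
      using cm dm monomial_closed[OF w] by (intro finsum_addf) auto
    finally show ?thesis by simp
  qed
  then show ?thesis unfolding homog_def using cm dm
    by (intro bexI[of _ "\<lambda>\<gamma>. c \<gamma> \<oplus> d \<gamma>"]) auto
qed

lemma homog_smult:
  assumes "a \<in> carrier R" "hg i g"
  shows "hg i (\<lambda>w. a \<otimes> g w)"
proof -
  obtain c where c: "c \<in> multidegs r i \<rightarrow> carrier R"
      "\<forall>w\<in>V. g w = (\<Oplus>\<gamma>\<in>multidegs r i. c \<gamma> \<otimes> monomial R r X \<gamma> w)"
    by (rule homogE[OF assms(2)])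
  note cm = funcset_mem[OF c(1)]
  have "a \<otimes> g w = (\<Oplus>\<gamma>\<in>multidegs r i. (a \<otimes> c \<gamma>) \<otimes> monomial R r X \<gamma> w)" if w: "w \<in> V" for w
  proof -
    have "a \<otimes> g w = (\<Oplus>\<gamma>\<in>multidegs r i. a \<otimes> (c \<gamma> \<otimes> monomial R r X \<gamma> w))"
      unfolding c(2)[rule_format, OF w] using cm assms monomial_closed[OF w] finite_multidegs
      by (intro finsum_rdistr) auto
    also have "\<dots> = (\<Oplus>\<gamma>\<in>multidegs r i. (a \<otimes> c \<gamma>) \<otimes> monomial R r X \<gamma> w)"
      using cm assms monomial_closed[OF w] by (intro finsum_cong') (auto intro!: m_assoc[symmetric])
    finally show ?thesis .
  qed
  then show ?thesis unfolding homog_def using cm assms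
    by (intro bexI[of _ "\<lambda>\<gamma>. a \<otimes> c \<gamma>"]) auto
qed

lemma homog_finsum:
  assumes "finite I" "\<And>t. t \<in> I \<Longrightarrow> hg i (g t)"
  shows "hg i (\<lambda>w. \<Oplus>t\<in>I. g t w)"
  using assms
proof (induction I)
  case empty
  then show ?case using homog_zero by simp
next
  case (insert t I)
  have "hg i (\<lambda>w. g t w \<oplus> (\<Oplus>t\<in>I. g t w))"
    using insert by (intro homog_add) auto
  moreover have "g t w \<oplus> (\<Oplus>t\<in>I. g t w) = (\<Oplus>t\<in>insert t I. g t w)" if "w \<in> V" for w
    using insert homog_closed that by (intro finsum_insert[symmetric]) auto
  ultimately show ?case by (rule homog_cong)
qed

lemma homog_one: "hg 0 (\<lambda>w. \<one>)"
proof -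
  let ?z = "\<lambda>j\<in>{..<r}. 0 :: nat"
  have m: "multidegs r 0 = {?z}"
    by (auto simp: multidegs_def PiE_iff extensional_def fun_eq_iff)
  have "monomial R r X ?z w = \<one>" for w
  proof -
    have "monomial R r X ?z w = (\<Otimes>j\<in>{..<r}. \<one>)"
      unfolding monomial_def by (intro finprod_cong') auto
    then show ?thesis by simp
  qed
  then show ?thesis unfolding homog_def m by (intro bexI[of _ "\<lambda>_. \<one>"]) auto
qed

text \<open>Multiplying by a coordinate shifts multidegrees along the injection \<open>up\<close>.
  The new coefficients \<open>c'\<close> are the old ones on its image and zero where \<gamma> j =
  0.\<close>

lemma homog_mult_coord:
  assumes "hg i g" and j: "j < r"
  shows "hg (Suc i) (\<lambda>w. X j w \<otimes> g w)"
proof -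
  obtain c where c: "c \<in> multidegs r i \<rightarrow> carrier R"
      "\<forall>w\<in>V. g w = (\<Oplus>\<gamma>\<in>multidegs r i. c \<gamma> \<otimes> monomial R r X \<gamma> w)"
    by (rule homogE[OF assms(1)])
  note cm = funcset_mem[OF c(1)]
  define up where "up \<gamma> = \<gamma>(j := Suc (\<gamma> j))" for \<gamma> :: "nat \<Rightarrow> nat"
  define c' where "c' \<gamma> = (if \<gamma> j = 0 then \<zero> else c (\<gamma>(j := \<gamma> j - 1)))" for \<gamma>
  have up_mem: "up \<gamma> \<in> multidegs r (Suc i)" if "\<gamma> \<in> multidegs r i" for \<gamma>
  proof -
    have "sum (up \<gamma>) {..<r} = Suc (\<gamma> j) + sum (up \<gamma>) ({..<r} - {j})"
      using j by (simp add: sum.remove up_def)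
    also have "sum (up \<gamma>) ({..<r} - {j}) = sum \<gamma> ({..<r} - {j})"
      by (intro sum.cong) (auto simp: up_def)
    also have "Suc (\<gamma> j) + \<dots> = Suc (sum \<gamma> {..<r})"
      using j by (simp add: sum.remove[of "{..<r}" j \<gamma>])
    finally show ?thesis using that j by (auto simp: multidegs_def up_def PiE_iff extensional_def)
  qed
  have down_mem: "\<gamma> \<in> up ` multidegs r i" if g: "\<gamma> \<in> multidegs r (Suc i)" "\<gamma> j \<noteq> 0" for \<gamma>
  proof -
    let ?d = "\<gamma>(j := \<gamma> j - 1)"
    have "sum ?d {..<r} = (\<gamma> j - 1) + sum ?d ({..<r} - {j})"
      using j by (simp add: sum.remove)
    also have "sum ?d ({..<r} - {j}) = sum \<gamma> ({..<r} - {j})"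
      by (intro sum.cong) auto
    also have "(\<gamma> j - 1) + \<dots> = sum \<gamma> {..<r} - 1"
      using j g by (simp add: sum.remove[of "{..<r}" j \<gamma>])
    finally have "?d \<in> multidegs r i" using g j
        by (auto simp: multidegs_def PiE_iff extensional_def)
    moreover have "\<gamma> = up ?d" using g by (simp add: up_def)
    ultimately show ?thesis by blast
  qed
  have inj: "inj_on up (multidegs r i)"
  proof
    fix \<gamma> \<delta> assume "up \<gamma> = up \<delta>"
    then have eq: "up \<gamma> l = up \<delta> l" for l by simp
    have "\<gamma> l = \<delta> l" for l using eq[of l] by (cases "l = j") (auto simp: up_def)
    then show "\<gamma> = \<delta>" by blast
  qed
  have c'_cl: "c' \<gamma> \<in> carrier R" if "\<gamma> \<in> multidegs r (Suc i)" for \<gamma>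
    using down_mem[OF that] cm by (auto simp: c'_def up_def)
  have c'_up: "c' (up \<gamma>) = c \<gamma>" for \<gamma> by (simp add: c'_def up_def)
  have mono_up: "monomial R r X (up \<gamma>) w = X j w \<otimes> monomial R r X \<gamma> w" if w: "w \<in> V" for \<gamma> w
  proof -
    have sp: "monomial R r X \<delta> w = X j w [^] \<delta> j \<otimes> (\<Otimes>l\<in>{..<r} - {j}. X l w [^] \<delta> l)"
        for \<delta> :: "nat \<Rightarrow> nat"
    proof -
      have "monomial R r X \<delta> w = (\<Otimes>l\<in>insert j ({..<r} - {j}). X l w [^] \<delta> l)"
        using j by (simp add: monomial_def insert_absorb)
      also have "\<dots> = X j w [^] \<delta> j \<otimes> (\<Otimes>l\<in>{..<r} - {j}. X l w [^] \<delta> l)"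
        using j X_closed w by (intro finprod_insert) auto
      finally show ?thesis .
    qed
    have "(\<Otimes>l\<in>{..<r} - {j}. X l w [^] up \<gamma> l) = (\<Otimes>l\<in>{..<r} - {j}. X l w [^] \<gamma> l)"
      using X_closed w by (intro finprod_cong') (auto simp: up_def)
    moreover have "(\<Otimes>l\<in>{..<r} - {j}. X l w [^] \<gamma> l) \<in> carrier R"
      using X_closed w by (intro finprod_closed) auto
    moreover have "X j w [^] up \<gamma> j = X j w \<otimes> X j w [^] \<gamma> j"
      using X_closed[OF j w] by (simp add: up_def m_comm)
    ultimately show ?thesis using X_closed[OF j w] by (simp add: sp m_assoc)
  qed
  have "X j w \<otimes> g w = (\<Oplus>\<gamma>\<in>multidegs r (Suc i). c' \<gamma> \<otimes> monomial R r X \<gamma> w)" if w: "w \<in> V" for w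
  proof -
    note mc = monomial_closed[OF w]
    have "X j w \<otimes> g w = (\<Oplus>\<gamma>\<in>multidegs r i. X j w \<otimes> (c \<gamma> \<otimes> monomial R r X \<gamma> w))"
      unfolding c(2)[rule_format, OF w] using cm X_closed[OF j w] mc finite_multidegs
      by (intro finsum_rdistr) auto
    also have "\<dots> = (\<Oplus>\<gamma>\<in>multidegs r i. c' (up \<gamma>) \<otimes> monomial R r X (up \<gamma>) w)"
      using cm X_closed[OF j w] mc w by (intro finsum_cong') (auto simp: c'_up mono_up intro!:
          m_lcomm)
    also have "\<dots> = (\<Oplus>\<gamma>\<in>up ` multidegs r i. c' \<gamma> \<otimes> monomial R r X \<gamma> w)"
      using cm mc inj c'_cl up_mem by (intro finsum_reindex[symmetric]) auto
    also have "\<dots> = (\<Oplus>\<gamma>\<in>multidegs r (Suc i). c' \<gamma> \<otimes> monomial R r X \<gamma> w)"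
      using mc up_mem down_mem c'_cl finite_multidegs
      by (intro add.finprod_mono_neutral_cong_left) (auto simp: c'_def)
    finally show ?thesis .
  qed
  then show ?thesis unfolding homog_def using c'_cl by (intro bexI[of _ c']) auto
qed

lemma homog_mult_linear:
  assumes g: "hg i g" and m: "\<And>j. j < r \<Longrightarrow> m j \<in> carrier R"
  shows "hg (Suc i) (\<lambda>w. (\<Oplus>j\<in>{..<r}. m j \<otimes> X j w) \<otimes> g w)"
proof -
  have "hg (Suc i) (\<lambda>w. \<Oplus>j\<in>{..<r}. m j \<otimes> (X j w \<otimes> g w))"
    using m g by (intro homog_finsum homog_smult homog_mult_coord) auto
  moreover have "(\<Oplus>j\<in>{..<r}. m j \<otimes> (X j w \<otimes> g w)) = (\<Oplus>j\<in>{..<r}. m j \<otimes> X j w) \<otimes> g w" if "w \<in> V" for w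
  proof -
    have "(\<Oplus>j\<in>{..<r}. m j \<otimes> X j w) \<otimes> g w = (\<Oplus>j\<in>{..<r}. m j \<otimes> X j w \<otimes> g w)"
      using m X_closed that homog_closed[OF g that] by (intro finsum_ldistr) auto
    also have "\<dots> = (\<Oplus>j\<in>{..<r}. m j \<otimes> (X j w \<otimes> g w))"
      using m X_closed that homog_closed[OF g that] by (intro finsum_cong') (auto intro!: m_assoc)
    finally show ?thesis by simp
  qed
  ultimately show ?thesis by (rule homog_cong)
qed

definition linear_on :: "('v \<Rightarrow> 'a) \<Rightarrow> bool" where
  "linear_on l \<longleftrightarrow> (\<exists>m. (\<forall>j<r. m j \<in> carrier R) \<and> (\<forall>w\<in>V. l w = (\<Oplus>j\<in>{..<r}. m j \<otimes> X j w)))"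

lemma linear_on_closed: "linear_on l \<Longrightarrow> w \<in> V \<Longrightarrow> l w \<in> carrier R"
  unfolding linear_on_def using X_closed by (auto intro!: finsum_closed)

text \<open>The coefficient of Y^i in a product of factors A + l(w) Y is a sum of terms each
  containing exactly i of the slopes l(w), which are linear in w. With A the value at a point x, it
  is the Taylor coefficient of order i at x in the direction w.\<close>

lemma homog_lin_coeff:
  assumes "\<And>A l. (A, l) \<in> set ls \<Longrightarrow> A \<in> carrier R \<and> linear_on l"
  shows "hg i (\<lambda>w. lin_coeff R (map (\<lambda>(A, l). (A, l w)) ls) i)"
  using assms
proof (induction ls arbitrary: i)
  case Nil
  then show ?case using homog_one homog_zero by (cases "i = 0") auto
next
  case (Cons al ls)
  obtain A l where al: "al = (A, l)" by fastforce
  have A: "A \<in> carrier R" and l: "linear_on l" using Cons.prems[of A l] al by auto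
  obtain m where m: "\<And>j. j < r \<Longrightarrow> m j \<in> carrier R" "\<And>w. w \<in> V \<Longrightarrow> l w = (\<Oplus>j\<in>{..<r}. m j \<otimes> X j w)"
    using l unfolding linear_on_def by metis
  let ?g = "\<lambda>i w. lin_coeff R (map (\<lambda>(A, l). (A, l w)) ls) i"
  have IH: "hg i (?g i)" for i using Cons by auto
  have "hg i (\<lambda>w. case i of 0 \<Rightarrow> \<zero> | Suc j \<Rightarrow> l w \<otimes> ?g j w)"
  proof (cases i)
    case 0 then show ?thesis using homog_zero by simp
  next
    case (Suc k)
    show ?thesis unfolding Suc
      using homog_cong[OF homog_mult_linear[OF IH[of k], of m] ] m by simp
  qed
  then show ?case using homog_add[OF homog_smult[OF A IH[of i]]]
      by (simp add: al cong: nat.case_cong)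
qed

end

text \<open>Siegel's lemma by the pigeonhole principle: a homogeneous form of degree \<open>i\<close> carries at most
  \<open>card (multidegs r i)\<close> linear conditions.\<close>

lemma (in coordinates) nontrivial_vanishing_comb:
  assumes fin: "finite (carrier R)" and S: "finite S" and I: "finite I"
    and g: "\<And>t x i. t \<in> I \<Longrightarrow> x \<in> S \<Longrightarrow> hg i (g t x i)"
    and less: "(\<Sum>x\<in>S. f x ^ r) < card I"
  obtains a where "a \<in> I \<rightarrow> carrier R" "\<exists>t\<in>I. a t \<noteq> \<zero>"
    "\<forall>x\<in>S. \<forall>i<f x. \<forall>w\<in>V. (\<Oplus>t\<in>I. a t \<otimes> g t x i w) = \<zero>"
proof -
  let ?q = "card (carrier R)"
  have q: "?q > 1"
  proof -
    have "card {\<zero>, \<one>} \<le> ?q" using fin by (intro card_mono) auto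
    then show ?thesis by simp
  qed
  \<comment> \<open>Restriction to \<open>V\<close> turns the forms of degree i into a finite set,
    whose size is bounded by the number of coefficient vectors.\<close>
  define HS where "HS i = (\<lambda>g. restrict g V) ` {g. hg i g}" for i
  have HS_sub: "HS i \<subseteq> (\<lambda>c. \<lambda>w\<in>V. \<Oplus>\<gamma>\<in>multidegs r i. c \<gamma> \<otimes> monomial R r X \<gamma> w) `
      (multidegs r i \<rightarrow>\<^sub>E carrier R)" for i
  proof
    fix h assume "h \<in> HS i"
    then obtain g where g: "hg i g" "h = restrict g V" by (auto simp: HS_def)
    obtain c where c: "c \<in> multidegs r i \<rightarrow> carrier R"
      "\<forall>w\<in>V. g w = (\<Oplus>\<gamma>\<in>multidegs r i. c \<gamma> \<otimes> monomial R r X \<gamma> w)"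
    by (rule homogE[OF g(1)])
    have "h = (\<lambda>w\<in>V. \<Oplus>\<gamma>\<in>multidegs r i. restrict c (multidegs r i) \<gamma> \<otimes> monomial R r X \<gamma> w)"
      unfolding g(2) using c monomial_closed
      by (intro restrict_ext) (auto intro!: finsum_cong' simp: Pi_iff)
    then show "h \<in> (\<lambda>c. \<lambda>w\<in>V. \<Oplus>\<gamma>\<in>multidegs r i. c \<gamma> \<otimes> monomial R r X \<gamma> w) `
      (multidegs r i \<rightarrow>\<^sub>E carrier R)" using c(1) by (intro image_eqI[of _ _ "restrict c (multidegs
          r i)"]) auto
  qed
  have fin_c: "finite (multidegs r i \<rightarrow>\<^sub>E carrier R)" for i
    using fin finite_multidegs by (intro finite_PiE) auto
  have finHS: "finite (HS i)" for i
    using HS_sub fin_c by (meson finite_imageI finite_subset)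
  have cardHS: "card (HS i) \<le> ?q ^ card (multidegs r i)" for i
  proof -
    have "card (HS i) \<le> card (multidegs r i \<rightarrow>\<^sub>E carrier R)"
      using HS_sub fin_c by (meson card_image_le card_mono finite_imageI order_trans)
    then show ?thesis by (simp add: card_PiE finite_multidegs)
  qed
  \<comment> \<open>\<open>\<Psi>\<close> maps a coefficient vector to the family of all forms that
    have to vanish. Two vectors with the same image exist by counting, and their difference is the
    desired combination.\<close>
  define \<Psi> where "\<Psi> a = (\<lambda>x\<in>S. \<lambda>i\<in>{..<f x}. \<lambda>w\<in>V. \<Oplus>t\<in>I. a t \<otimes> g t x i w)" for a
  let ?C = "PiE S (\<lambda>x. PiE {..<f x} HS)"
  have "\<Psi> a \<in> ?C" if "a \<in> I \<rightarrow>\<^sub>E carrier R" for a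
  proof -
    have "hg i (\<lambda>w. \<Oplus>t\<in>I. a t \<otimes> g t x i w)" if "x \<in> S" for x i
      using \<open>a \<in> _\<close> that I by (intro homog_finsum homog_smult g) auto
    then show ?thesis unfolding \<Psi>_def HS_def by auto
  qed
  then have sub: "\<Psi> ` (I \<rightarrow>\<^sub>E carrier R) \<subseteq> ?C" by blast
  have "card ?C = (\<Prod>x\<in>S. \<Prod>i<f x. card (HS i))"
    using S by (simp add: card_PiE)
  also have "\<dots> \<le> (\<Prod>x\<in>S. \<Prod>i<f x. ?q ^ card (multidegs r i))"
    using cardHS by (intro prod_mono conjI) auto
  also have "\<dots> = ?q ^ (\<Sum>x\<in>S. \<Sum>i<f x. card (multidegs r i))"
    by (simp add: power_sum)
  also have "\<dots> \<le> ?q ^ (\<Sum>x\<in>S. f x ^ r)"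
    using q by (intro power_increasing sum_mono sum_card_multidegs_le) auto
  also have "\<dots> < ?q ^ card I" using q less by simp
  also have "\<dots> = card (I \<rightarrow>\<^sub>E carrier R)" using I by (simp add: card_PiE)
  finally have "card ?C < card (I \<rightarrow>\<^sub>E carrier R)" .
  moreover have "finite ?C" using S finHS by (intro finite_PiE) auto
  ultimately have "\<not> inj_on \<Psi> (I \<rightarrow>\<^sub>E carrier R)"
    using sub card_inj_on_le by (metis not_le)
  then obtain a b where a: "a \<in> I \<rightarrow>\<^sub>E carrier R" and b: "b \<in> I \<rightarrow>\<^sub>E carrier R"
    and ab: "\<Psi> a = \<Psi> b" "a \<noteq> b" by (auto simp: inj_on_def)
  have cl: "a t \<in> carrier R" "b t \<in> carrier R" if "t \<in> I" for t using a b that by auto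
  show thesis
  proof (rule that[of "\<lambda>t. a t \<ominus> b t"]; (intro ballI allI impI)?)
    show "(\<lambda>t. a t \<ominus> b t) \<in> I \<rightarrow> carrier R" using cl by auto
    show "\<exists>t\<in>I. a t \<ominus> b t \<noteq> \<zero>"
    proof (rule ccontr)
      assume "\<not> ?thesis"
      then have "\<And>t. t \<in> I \<Longrightarrow> a t = b t" using cl minus_eq_zero_iff by blast
      then show False using ab(2) PiE_ext[OF a b] by blast
    qed
    fix x i w assume xiw: "x \<in> S" "i < f x" "w \<in> V"
    have gc: "g t x i w \<in> carrier R" if "t \<in> I" for t
      using homog_closed[OF g[OF that xiw(1)] xiw(3)] .
    have eq: "(\<Oplus>t\<in>I. a t \<otimes> g t x i w) = (\<Oplus>t\<in>I. b t \<otimes> g t x i w)"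
      using fun_cong[OF fun_cong[OF fun_cong[OF ab(1), of x], of i], of w] xiw by (simp add: \<Psi>_def)
    have "(\<Oplus>t\<in>I. (a t \<ominus> b t) \<otimes> g t x i w) \<oplus> (\<Oplus>t\<in>I. b t \<otimes> g t x i w) =
        (\<Oplus>t\<in>I. (a t \<ominus> b t) \<otimes> g t x i w \<oplus> b t \<otimes> g t x i w)"
      using cl gc by (intro finsum_addf[symmetric]) auto
    also have "\<dots> = (\<Oplus>t\<in>I. a t \<otimes> g t x i w)"
      using cl gc by (intro finsum_cong') (auto simp: l_distr[symmetric] minus_eq a_assoc l_neg)
    finally have "(\<Oplus>t\<in>I. (a t \<ominus> b t) \<otimes> g t x i w) \<oplus> (\<Oplus>t\<in>I. b t \<otimes> g t x i w)
        = \<zero> \<oplus> (\<Oplus>t\<in>I. b t \<otimes> g t x i w)" using cl gc by (simp add: eq)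
    then show "(\<Oplus>t\<in>I. (a t \<ominus> b t) \<otimes> g t x i w) = \<zero>"
      using cl gc by (subst (asm) add.right_cancel) (auto intro!: finsum_closed)
  qed
qed

section \<open>The multiplicity bound for horizontal lines\<close>

text \<open>The coefficient at the full length is the product of the slopes \<open>snd ab\<close>,
  and a domain has no zero divisors.\<close>

lemma (in ring) lin_coeff_top_eq_zero_iff:
  assumes "domain R" "set xs \<subseteq> carrier R \<times> carrier R"
  shows "lin_coeff R xs (length xs) = \<zero> \<longleftrightarrow> (\<exists>ab\<in>set xs. snd ab = \<zero>)"
proof -
  interpret domain R by fact
  show ?thesis using assms(2)
  proof (induction xs)
    case (Cons ab xs)
    then have xs: "set xs \<subseteq> carrier R \<times> carrier R" and ab: "fst ab \<in> carrier R" "snd ab \<in> carrier R"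
      by auto
    show ?case using Cons.IH[OF xs] ab lin_coeff_above[OF xs, of
        "Suc (length xs)"] lin_coeff_closed[OF xs]
      by (simp add: integral_iff)
  qed simp
qed

definition vcoord :: "nat \<Rightarrow> nat \<Rightarrow> 'a hvec \<Rightarrow> 'a" where
  "vcoord n j w = (if j < n then fst w j else snd w (j - n))"

text \<open>Index 2n stands for the central coordinate, so that V \<times> F has the coordinates 0,
  ..., 2n.\<close>

definition hcoord :: "nat \<Rightarrow> nat \<Rightarrow> 'a heis \<Rightarrow> 'a" where
  "hcoord n j x = (if j < 2 * n then vcoord n j (fst x) else snd x)"

text \<open>The direction \<open>v\<close> is any vector of V \<times> F. The line is horizontal at
  \<open>p\<close> when the central part of \<open>v\<close> is \<sigma>(z, w), with z and w the
  spatial parts of \<open>p\<close> and \<open>v\<close>.\<close>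

definition line_pt :: "('a, 'm) ring_scheme \<Rightarrow> nat \<Rightarrow> 'a heis \<Rightarrow> 'a heis \<Rightarrow> 'a \<Rightarrow> 'a heis" where
  "line_pt R n p v s = (vadd R n (fst p) (vscale R n s (fst v)), snd p \<oplus>\<^bsub>R\<^esub> s \<otimes>\<^bsub>R\<^esub> snd v)"

locale heis_field = field R for R (structure) +
  fixes n :: nat
  assumes fin: "finite (carrier R)"
begin

abbreviation "V \<equiv> V_space R n"
abbreviation "V0 \<equiv> V - {vzero R n}"
abbreviation "H \<equiv> carrier (Heis R n)"
abbreviation "dir p w \<equiv> proj_pt R n w (sympl R n (fst p) w)"
abbreviation "q \<equiv> card (carrier R)"

lemma H_eq: "H = V \<times> carrier R" by (simp add: Heis_def)

lemma vcoord_closed: "j < 2 * n \<Longrightarrow> w \<in> V \<Longrightarrow> vcoord n j w \<in> carrier R"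
  using V_space_coord[of w R n] by (auto simp: vcoord_def)

sublocale coordinates R "2 * n" "vcoord n" V
  by unfold_locales (rule vcoord_closed)

lemma V_eqI:
  assumes "z \<in> V" "z' \<in> V" "\<And>j. j < 2 * n \<Longrightarrow> vcoord n j z = vcoord n j z'"
  shows "z = z'"
proof (rule V_space_eqI[OF assms(1,2)])
  fix i assume i: "i < n"
  show "fst z i = fst z' i \<and> snd z i = snd z' i"
    using assms(3)[of i] assms(3)[of "i + n"] i by (auto simp: vcoord_def)
qed

lemma vadd_closed: "z \<in> V \<Longrightarrow> w \<in> V \<Longrightarrow> vadd R n z w \<in> V"
  using V_space_coord[of z R n] V_space_coord[of w R n] by (auto simp: V_space_def vadd_def)

lemma vscale_closed': "s \<in> carrier R \<Longrightarrow> w \<in> V \<Longrightarrow> vscale R n s w \<in> V"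
  by (rule vscale_closed[OF field_axioms])

lemma sympl_closed': "z \<in> V \<Longrightarrow> w \<in> V \<Longrightarrow> sympl R n z w \<in> carrier R"
  by (rule sympl_closed[OF field_axioms])

lemma vcoord_vadd: "j < 2 * n \<Longrightarrow> vcoord n j (vadd R n z w) = vcoord n j z \<oplus> vcoord n j w"
  by (auto simp: vcoord_def vadd_def)

lemma vcoord_vscale: "j < 2 * n \<Longrightarrow> vcoord n j (vscale R n s w) = s \<otimes> vcoord n j w"
  by (auto simp: vcoord_def vscale_def)

lemma vzero_mem: "vzero R n \<in> V" by (auto simp: V_space_def vzero_def)

lemma vcoord_vzero: "j < 2 * n \<Longrightarrow> vcoord n j (vzero R n) = \<zero>"
  by (auto simp: vcoord_def vzero_def)

lemma nonzero_coord:
  assumes "w \<in> V0"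
  obtains i where "i < 2 * n" "vcoord n i w \<noteq> \<zero>"
  using V_eqI[of w "vzero R n"] assms vzero_mem vcoord_vzero by fastforce

lemma line_pt_closed: "p \<in> H \<Longrightarrow> v \<in> H \<Longrightarrow> s \<in> carrier R \<Longrightarrow> line_pt R n p v s \<in> H"
  by (auto simp: H_eq line_pt_def vadd_closed vscale_closed')

lemma hline_eq: "hline R n p w = line_pt R n p (w, sympl R n (fst p) w) ` carrier R"
  by (simp add: hline_def line_pt_def)

lemma hcoord_closed: "x \<in> H \<Longrightarrow> hcoord n j x \<in> carrier R"
  using vcoord_closed by (auto simp: hcoord_def H_eq)

lemma hcoord_line_pt: "hcoord n j (line_pt R n p v s) = hcoord n j p \<oplus> s \<otimes> hcoord n j v"
  by (simp add: hcoord_def line_pt_def vcoord_vadd vcoord_vscale)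

lemma inj_line_pt:
  assumes "p \<in> H" "v \<in> H" "fst v \<noteq> vzero R n"
  shows "inj_on (line_pt R n p v) (carrier R)"
proof
  fix s t assume st: "s \<in> carrier R" "t \<in> carrier R" "line_pt R n p v s = line_pt R n p v t"
  have "fst v \<in> V0" using assms by (auto simp: H_eq)
  then obtain i where i: "i < 2 * n" "vcoord n i (fst v) \<noteq> \<zero>" by (rule nonzero_coord)
  have h: "hcoord n i p \<in> carrier R" "hcoord n i v \<in> carrier R" "hcoord n i v \<noteq> \<zero>"
    using hcoord_closed[OF assms(1), of i] hcoord_closed[OF assms(2), of i] i(2)
    by (simp_all add: hcoord_def i(1))
  have "hcoord n i p \<oplus> s \<otimes> hcoord n i v = hcoord n i p \<oplus> t \<otimes> hcoord n i v"
    using arg_cong[OF st(3), of "hcoord n i"] by (simp only: hcoord_line_pt)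
  then have "s \<otimes> hcoord n i v = t \<otimes> hcoord n i v"
    using h st(1,2) by simp
  then show "s = t" using h st m_rcancel by blast
qed

section \<open>The symplectic form along lines, and linear forms on the Heisenberg group\<close>

lemma dotp_closed:
  assumes "\<And>i. i < n \<Longrightarrow> x i \<in> carrier R" "\<And>i. i < n \<Longrightarrow> y i \<in> carrier R"
  shows "dotp R n x y \<in> carrier R"
  unfolding dotp_def using assms by (intro finsum_closed) auto

lemma dotp_comm:
  assumes "\<And>i. i < n \<Longrightarrow> x i \<in> carrier R" "\<And>i. i < n \<Longrightarrow> y i \<in> carrier R"
  shows "dotp R n x y = dotp R n y x"
  unfolding dotp_def using assms by (intro finsum_cong') (auto intro!: m_comm)

lemma dotp_add_scale:
  assumes "\<And>i. i < n \<Longrightarrow> x i \<in> carrier R" "\<And>i. i < n \<Longrightarrow> y i \<in> carrier R"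
    "\<And>i. i < n \<Longrightarrow> a i \<in> carrier R" "s \<in> carrier R"
    "\<And>i. i < n \<Longrightarrow> x' i = x i \<oplus> s \<otimes> a i"
  shows "dotp R n x' y = dotp R n x y \<oplus> s \<otimes> dotp R n a y"
proof -
  have "s \<otimes> dotp R n a y = (\<Oplus>i\<in>{..<n}. s \<otimes> (a i \<otimes> y i))"
    unfolding dotp_def using assms by (intro finsum_rdistr) auto
  moreover have "dotp R n x' y = (\<Oplus>i\<in>{..<n}. x i \<otimes> y i \<oplus> s \<otimes> (a i \<otimes> y i))"
    unfolding dotp_def using assms by (intro finsum_cong') (auto simp: l_distr m_assoc)
  moreover have "(\<Oplus>i\<in>{..<n}. x i \<otimes> y i \<oplus> s \<otimes> (a i \<otimes> y i)) =
      (\<Oplus>i\<in>{..<n}. x i \<otimes> y i) \<oplus> (\<Oplus>i\<in>{..<n}. s \<otimes> (a i \<otimes> y i))"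
    using assms by (intro finsum_addf) auto
  ultimately show ?thesis unfolding dotp_def by simp
qed

text \<open>This is \<sigma>(w, w) = 0: the two dot products by which numerator terms change are
  equal. Hence a horizontal line is horizontal at each of its points, with one and the same refined
  direction.\<close>

lemma sympl_shift:
  assumes "z \<in> V" "w \<in> V" "s \<in> carrier R"
  shows "sympl R n (vadd R n z (vscale R n s w)) w = sympl R n z w"
proof -
  note z = V_space_coord[OF assms(1)] and w = V_space_coord[OF assms(2)]
  let ?A = "dotp R n (fst z) (snd w)" and ?B = "dotp R n (snd z) (fst w)"
    and ?C = "s \<otimes> dotp R n (fst w) (snd w)"
  have 1: "dotp R n (fst (vadd R n z (vscale R n s w))) (snd w) = ?A \<oplus> ?C"
    by (rule dotp_add_scale) (use z w assms in \<open>auto simp: vadd_def vscale_def\<close>)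
  have "dotp R n (snd (vadd R n z (vscale R n s w))) (fst w) = ?B \<oplus> s \<otimes> dotp R n (snd w) (fst w)"
    by (rule dotp_add_scale) (use z w assms in \<open>auto simp: vadd_def vscale_def\<close>)
  then have 2: "dotp R n (snd (vadd R n z (vscale R n s w))) (fst w) = ?B \<oplus> ?C"
    using dotp_comm[of "snd w" "fst w"] w by simp
  have "?A \<in> carrier R" "?B \<in> carrier R" "?C \<in> carrier R"
    using dotp_closed z w assms by auto
  then show ?thesis unfolding sympl_def 1 2
    by (simp add: minus_eq minus_add a_assoc a_comm[of ?B ?C] r_neg2)
qed

lemma linear_on_cong: "linear_on l \<Longrightarrow> (\<And>w. w \<in> V \<Longrightarrow> l w = l' w) \<Longrightarrow> linear_on l'"
  unfolding linear_on_def by metis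

lemma linear_on_coord:
  assumes "i < 2 * n"
  shows "linear_on (vcoord n i)"
proof -
  have "vcoord n i w = (\<Oplus>j\<in>{..<2 * n}. (if i = j then \<one> else \<zero>) \<otimes> vcoord n j w)" if w: "w \<in> V" for w
  proof -
    have "(\<Oplus>j\<in>{..<2 * n}. (if i = j then \<one> else \<zero>) \<otimes> vcoord n j w) =
      (\<Oplus>j\<in>{..<2 * n}. if i = j then vcoord n j w else \<zero>)"
      using vcoord_closed w by (intro finsum_cong') auto
    also have "\<dots> = vcoord n i w" using assms w vcoord_closed by (intro finsum_singleton) auto
    finally show ?thesis by (rule sym)
  qed
  then show ?thesis unfolding linear_on_def
    by (intro exI[of _ "\<lambda>j. if i = j then \<one> else \<zero>"]) auto
qed

lemma linear_on_add_smult: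
  assumes "linear_on l" "linear_on l'" and a: "a \<in> carrier R"
  shows "linear_on (\<lambda>w. l w \<oplus> a \<otimes> l' w)"
proof -
  obtain m where m: "\<forall>j<2*n. m j \<in> carrier R" "\<forall>w\<in>V. l w = (\<Oplus>j\<in>{..<2*n}. m j \<otimes> vcoord n j w)"
    using assms(1) unfolding linear_on_def by blast
  obtain m' where m': "\<forall>j<2*n. m' j \<in> carrier R" "\<forall>w\<in>V. l' w = (\<Oplus>j\<in>{..<2*n}. m' j \<otimes> vcoord n j w)"
    using assms(2) unfolding linear_on_def by blast
  have "l w \<oplus> a \<otimes> l' w = (\<Oplus>j\<in>{..<2*n}. (m j \<oplus> a \<otimes> m' j) \<otimes> vcoord n j w)" if w: "w \<in> V" for w
  proof -
    have vc: "j < 2 * n \<Longrightarrow> vcoord n j w \<in> carrier R" for j using vcoord_closed w by blast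
    have "(\<Oplus>j\<in>{..<2*n}. (m j \<oplus> a \<otimes> m' j) \<otimes> vcoord n j w) =
       (\<Oplus>j\<in>{..<2*n}. m j \<otimes> vcoord n j w \<oplus> a \<otimes> (m' j \<otimes> vcoord n j w))"
      using m(1) m'(1) vc a by (intro finsum_cong') (auto simp: l_distr m_assoc)
    also have "\<dots> = (\<Oplus>j\<in>{..<2*n}. m j \<otimes> vcoord n j w) \<oplus> (\<Oplus>j\<in>{..<2*n}. a \<otimes> (m' j \<otimes> vcoord n j w))"
      using m(1) m'(1) vc a by (intro finsum_addf) auto
    also have "(\<Oplus>j\<in>{..<2*n}. a \<otimes> (m' j \<otimes> vcoord n j w)) = a \<otimes> (\<Oplus>j\<in>{..<2*n}. m' j \<otimes> vcoord n j w)"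
      using m(1) m'(1) vc a by (intro finsum_rdistr[symmetric]) auto
    finally show ?thesis using m(2) m'(2) w by simp
  qed
  then show ?thesis unfolding linear_on_def using m m' a
    by (intro exI[of _ "\<lambda>j. m j \<oplus> a \<otimes> m' j"]) auto
qed

lemma linear_on_zero: "linear_on (\<lambda>w. \<zero>)"
proof -
  have "(\<Oplus>j\<in>{..<2*n}. \<zero> \<otimes> vcoord n j w) = \<zero>" if "w \<in> V" for w
  proof -
    have "(\<Oplus>j\<in>{..<2*n}. \<zero> \<otimes> vcoord n j w) = (\<Oplus>j\<in>{..<2*n}. \<zero>)"
      using vcoord_closed that by (intro finsum_cong') auto
    then show ?thesis by (simp only: finsum_zero)
  qed
  from this[symmetric] show ?thesis unfolding linear_on_def
    by (intro exI[of _ "\<lambda>j. \<zero>"]) simp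
qed

lemma linear_on_finsum:
  assumes "finite I" "\<And>i. i \<in> I \<Longrightarrow> a i \<in> carrier R \<and> linear_on (l i)"
  shows "linear_on (\<lambda>w. \<Oplus>i\<in>I. a i \<otimes> l i w)"
  using assms
proof (induction I)
  case empty
  then show ?case using linear_on_zero by simp
next
  case (insert i I)
  have "linear_on (\<lambda>w. (\<Oplus>i\<in>I. a i \<otimes> l i w) \<oplus> a i \<otimes> l i w)"
    using insert by (intro linear_on_add_smult) auto
  moreover have "(\<Oplus>i\<in>I. a i \<otimes> l i w) \<oplus> a i \<otimes> l i w = (\<Oplus>i\<in>insert i I. a i \<otimes> l i w)" if "w \<in> V" for w
  proof -
    have c: "a j \<otimes> l j w \<in> carrier R" if "j \<in> insert i I" for j
      using insert.prems[OF that] linear_on_closed \<open>w \<in> V\<close> by blast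
    have "(\<Oplus>i\<in>I. a i \<otimes> l i w) \<in> carrier R" using c by (intro finsum_closed) auto
    then show ?thesis using insert(1,2) c by (subst finsum_insert) (auto simp: a_comm)
  qed
  ultimately show ?case by (rule linear_on_cong)
qed

lemma linear_on_sympl:
  assumes z: "z \<in> V"
  shows "linear_on (\<lambda>w. sympl R n z w)"
proof -
  note zc = V_space_coord[OF z]
  have 1: "linear_on (\<lambda>w. \<Oplus>i\<in>{..<n}. fst z i \<otimes> vcoord n (i + n) w)"
    using zc by (intro linear_on_finsum) (auto intro!: linear_on_coord)
  have 2: "linear_on (\<lambda>w. \<Oplus>i\<in>{..<n}. snd z i \<otimes> vcoord n i w)"
    using zc by (intro linear_on_finsum) (auto intro!: linear_on_coord)
  show ?thesis
  proof (rule linear_on_cong[OF linear_on_add_smult[OF 1 2, of "\<ominus> \<one>"]])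
    fix w assume w: "w \<in> V"
    note wc = V_space_coord[OF w]
    have a: "(\<Oplus>i\<in>{..<n}. fst z i \<otimes> vcoord n (i + n) w) = dotp R n (fst z) (snd w)"
      unfolding dotp_def using zc wc by (intro finsum_cong') (auto simp: vcoord_def)
    have b: "(\<Oplus>i\<in>{..<n}. snd z i \<otimes> vcoord n i w) = dotp R n (snd z) (fst w)"
      unfolding dotp_def using zc wc by (intro finsum_cong') (auto simp: vcoord_def)
    show "(\<Oplus>i\<in>{..<n}. fst z i \<otimes> vcoord n (i + n) w) \<oplus> \<ominus> \<one> \<otimes> (\<Oplus>i\<in>{..<n}. snd z i \<otimes> vcoord n i w)
        = sympl R n z w"
      unfolding a b sympl_def using zc wc dotp_closed by (simp add: l_minus minus_eq)
  qed simp
qed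

text \<open>A linear form on V \<times> F, given by the facts needed about it: it is affine along
  every line with its own value as slope, and on the horizontal hyperplane of z it is linear in w.
  The last clause is the place where the number of variables drops from 2n + 1 to 2n.\<close>

definition hform :: "('a heis \<Rightarrow> 'a) \<Rightarrow> bool" where
  "hform l \<longleftrightarrow> (\<forall>x\<in>H. l x \<in> carrier R) \<and>
     (\<forall>p\<in>H. \<forall>v\<in>H. \<forall>s\<in>carrier R. l (line_pt R n p v s) = l p \<oplus> s \<otimes> l v) \<and>
     (\<forall>z\<in>V. linear_on (\<lambda>w. l (w, sympl R n z w)))"

lemma hform_coord: "hform (hcoord n j)"
proof -
  have "linear_on (\<lambda>w. hcoord n j (w, sympl R n z w))" if "z \<in> V" for z
    using linear_on_coord[of j] linear_on_sympl[OF that]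
        by (cases "j < 2 * n") (simp_all add: hcoord_def)
  then show ?thesis unfolding hform_def using hcoord_closed hcoord_line_pt by blast
qed

lemma hform_minus_smult:
  assumes l: "hform l" and l': "hform l'" and b: "b \<in> carrier R"
  shows "hform (\<lambda>x. l x \<ominus> b \<otimes> l' x)"
proof -
  have cl: "l x \<in> carrier R" "l' x \<in> carrier R" if "x \<in> H" for x
    using l l' that unfolding hform_def by blast+
  have "l (line_pt R n p v s) \<ominus> b \<otimes> l' (line_pt R n p v s) =
      l p \<ominus> b \<otimes> l' p \<oplus> s \<otimes> (l v \<ominus> b \<otimes> l' v)" if pv: "p \<in> H" "v \<in> H" "s \<in> carrier R" for p v s
  proof -
    have e: "l (line_pt R n p v s) = l p \<oplus> s \<otimes> l v" "l' (line_pt R n p v s) = l' p \<oplus> s \<otimes> l' v"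
      using l l' that unfolding hform_def by blast+
    show ?thesis unfolding e using cl[OF pv(1)] cl[OF pv(2)] pv(3) b
      by (simp add: minus_eq r_distr r_minus minus_add a_ac m_ac)
  qed
  moreover have "linear_on (\<lambda>w. l (w, sympl R n z w) \<ominus> b \<otimes> l' (w, sympl R n z w))" if z: "z \<in> V"
      for z
  proof (rule linear_on_cong)
    show "linear_on (\<lambda>w. l (w, sympl R n z w) \<oplus> (\<ominus> b) \<otimes> l' (w, sympl R n z w))"
      using l l' b z unfolding hform_def by (intro linear_on_add_smult) blast+
    fix w assume "w \<in> V"
    then show "l (w, sympl R n z w) \<oplus> (\<ominus> b) \<otimes> l' (w, sympl R n z w) =
       l (w, sympl R n z w) \<ominus> b \<otimes> l' (w, sympl R n z w)"
      using cl[of "(w, sympl R n z w)"] sympl_closed'[OF z] b by (simp add: H_eq minus_eq l_minus)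
  qed
  ultimately show ?thesis unfolding hform_def using cl b by (intro conjI ballI) blast+
qed

text \<open>The product of the linear forms below is a homogeneous polynomial on \<open>V \<times> F\<close> that
  vanishes at all refined directions except \<open>[w:c]\<close>.\<close>

lemma indicator_forms:
  assumes w: "w \<in> V0" and c: "c \<in> carrier R" and k: "k \<noteq> 0"
  shows "\<exists>ls. length ls = 2 * n * (q - 1) + k \<and> (\<forall>l\<in>set ls. hform l \<and> l (w, c) \<noteq> \<zero>) \<and>
    (\<forall>v\<in>H. (\<forall>l\<in>set ls. l v \<noteq> \<zero>) \<longrightarrow> (\<exists>s\<in>carrier R - {\<zero>}. v = (vscale R n s w, s \<otimes> c)))"
proof -
  obtain i where i: "i < 2 * n" "vcoord n i w \<noteq> \<zero>" using nonzero_coord[OF w] by blast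
  have v: "(w, c) \<in> H" using w c by (auto simp: H_eq)
  define h where "h j = hcoord n j (w, c)" for j
  have h: "h j \<in> carrier R" for j using hcoord_closed[OF v] by (simp add: h_def)
  have hi: "h i \<noteq> \<zero>" using i by (simp add: h_def hcoord_def)
  have iu: "inv h i \<in> carrier R" "h i \<otimes> inv h i = \<one>" "inv h i \<otimes> h i = \<one>"
    using h hi field_Units by auto
  define u where "u j = h j \<otimes> inv h i" for j
  have u: "u j \<in> carrier R" "u j \<otimes> h i = h j" for j
    using h iu by (auto simp: u_def m_assoc)
  \<comment> \<open>The ratios u j = h j / h i are affine coordinates of the direction. A vector
    with nonzero coordinate i whose ratios avoid every b \<noteq> u j has exactly the ratios u j, so
    it is a multiple of (w, c). There are 2n indices j and q - 1 values b for each.\<close>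
  define S where "S = (SIGMA j:{..2 * n} - {i}. carrier R - {u j})"
  have "finite S" using fin by (auto simp: S_def)
  then obtain xs where xs: "set xs = S" "distinct xs" using finite_distinct_list by blast
  have "card S = (\<Sum>j\<in>{..2 * n} - {i}. card (carrier R - {u j}))"
    unfolding S_def using fin by (intro card_SigmaI) auto
  also have "\<dots> = 2 * n * (q - 1)" using i u by (simp add: card_Diff_singleton)
  finally have len: "length xs = 2 * n * (q - 1)" using xs distinct_card by metis
  define F where "F jb x = hcoord n (fst jb) x \<ominus> snd jb \<otimes> hcoord n i x" for jb :: "nat \<times> 'a" and x
  \<comment> \<open>The coordinate i itself occurs k times. This excludes vectors with zero
    coordinate i, as k \<noteq> 0, and adjusts the number of factors.\<close>
  define ls where "ls = replicate k (hcoord n i) @ map F xs"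
  have set_ls: "set ls = insert (hcoord n i) (F ` S)" using k xs by (auto simp: ls_def)
  have "hform (F jb)" if "jb \<in> S" for jb
    unfolding F_def using that by (intro hform_minus_smult hform_coord) (auto simp: S_def)
  moreover have "F (j, b) (w, c) \<noteq> \<zero>" if "(j, b) \<in> S" for j b
  proof
    assume "F (j, b) (w, c) = \<zero>"
    then have "h j = b \<otimes> h i" using h that
        by (auto simp: F_def h_def[symmetric] minus_eq_zero_iff S_def)
    then have "u j \<otimes> h i = b \<otimes> h i" using u by simp
    then have "u j = b" using m_rcancel[of "h i" "u j" b] hi h u that by (auto simp: S_def)
    then show False using that by (auto simp: S_def)
  qed
  moreover have "\<exists>s\<in>carrier R - {\<zero>}. v = (vscale R n s w, s \<otimes> c)"
    if v: "v \<in> H" and nz: "\<And>l. l \<in> set ls \<Longrightarrow> l v \<noteq> \<zero>" for v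
  proof -
    have vh: "hcoord n j v \<in> carrier R" for j using hcoord_closed[OF v] .
    define s where "s = hcoord n i v \<otimes> inv h i"
    have s: "s \<in> carrier R" using vh iu by (simp add: s_def)
    have nzi: "hcoord n i v \<noteq> \<zero>" using nz by (simp add: set_ls)
    have shi: "s \<otimes> h i = hcoord n i v" using vh iu h by (simp add: s_def m_assoc)
    have s0: "s \<noteq> \<zero>" using shi nzi h by auto
    have sh: "hcoord n j v = s \<otimes> h j" if j: "j \<le> 2 * n" for j
    proof (cases "j = i")
      case True then show ?thesis using shi by simp
    next
      case False
      define b where "b = hcoord n j v \<otimes> inv hcoord n i v"
      have iv: "inv hcoord n i v \<in> carrier R" "hcoord n i v \<otimes> inv hcoord n i v = \<one>"
         "inv hcoord n i v \<otimes> hcoord n i v = \<one>"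
        using vh nzi field_Units by auto
      have b: "b \<in> carrier R" "b \<otimes> hcoord n i v = hcoord n j v" using vh iv
          by (auto simp: b_def m_assoc)
      have "F (j, b) v = \<zero>" using b vh by (simp add: F_def minus_eq_zero_iff)
      then have "(j, b) \<notin> S" using nz[of "F (j, b)"] by (auto simp: set_ls)
      then have "b = u j" using b j False by (auto simp: S_def)
      then have "hcoord n j v = u j \<otimes> (s \<otimes> h i)" using b shi by simp
      also have "\<dots> = s \<otimes> (u j \<otimes> h i)" using u(1) s h by (simp add: m_lcomm)
      finally show ?thesis using u(2) by simp
    qed
    have "fst v = vscale R n s w"
    proof (rule V_eqI)
      fix j assume "j < 2 * n"
      then show "vcoord n j (fst v) = vcoord n j (vscale R n s w)"
        using sh[of j] by (simp add: h_def hcoord_def vcoord_vscale)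
    qed (use v w s vscale_closed' in \<open>auto simp: H_eq\<close>)
    moreover have "snd v = s \<otimes> c" using sh[of "2 * n"] by (simp add: h_def hcoord_def)
    ultimately show ?thesis using s s0 by (intro bexI[of _ s]) (auto simp: prod_eq_iff)
  qed
  ultimately show ?thesis
    unfolding xs(1)[symmetric]
    using hform_coord hi len
    by (intro exI[of _ ls]) (auto simp: ls_def h_def)
qed


text \<open>If the conditions were fewer than the pairs (\<theta>, k), a nontrivial combination
  would satisfy them all; it is refuted on the line of one suitable \<theta>. The factor q on the
  left counts the degrees k, and the hypothesis \<open>big\<close> asks for more zeros than the
  largest of these degrees.\<close>

theorem kakeya_multiplicity_bound:
  assumes \<Theta>: "finite \<Theta>"
    and p: "\<And>\<theta>. \<theta> \<in> \<Theta> \<Longrightarrow> p \<theta> \<in> H"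
    and w: "\<And>\<theta>. \<theta> \<in> \<Theta> \<Longrightarrow> w \<theta> \<in> V0"
    and dirs: "\<And>\<theta>. \<theta> \<in> \<Theta> \<Longrightarrow> \<theta> = dir (p \<theta>) (w \<theta>)"
    and big: "\<And>\<theta>. \<theta> \<in> \<Theta> \<Longrightarrow> (2 * n + 1) * q < sum f (hline R n (p \<theta>) (w \<theta>))"
  shows "card \<Theta> * q \<le> (\<Sum>x\<in>H. f x ^ (2 * n))"
proof (rule ccontr)
  assume "\<not> ?thesis"
  then have less: "(\<Sum>x\<in>H. f x ^ (2 * n)) < card \<Theta> * q" by simp
  define c where "c \<theta> = sympl R n (fst (p \<theta>)) (w \<theta>)" for \<theta>
  have c: "c \<theta> \<in> carrier R" if "\<theta> \<in> \<Theta>" for \<theta>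
    unfolding c_def using p[OF that] w[OF that] by (intro sympl_closed') (auto simp: H_eq)
  have vH: "(w \<theta>, c \<theta>) \<in> H" if "\<theta> \<in> \<Theta>" for \<theta> using w[OF that] c[OF that] by (simp add: H_eq)
  have finH: "finite H" using fin by (auto simp: H_eq V_space_def intro!: finite_PiE)
  define I where "I = \<Theta> \<times> {1..q}"
  have I: "finite I" "card I = card \<Theta> * q" using \<Theta> by (auto simp: I_def card_cartesian_product)
  have "\<forall>t\<in>I. \<exists>ls. length ls = 2 * n * (q - 1) + snd t \<and>
      (\<forall>l\<in>set ls. hform l \<and> l (w (fst t), c (fst t)) \<noteq> \<zero>) \<and>
      (\<forall>v\<in>H. (\<forall>l\<in>set ls. l v \<noteq> \<zero>) \<longrightarrow>
         (\<exists>s\<in>carrier R - {\<zero>}. v = (vscale R n s (w (fst t)), s \<otimes> c (fst t))))"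
    using w c by (intro ballI indicator_forms) (auto simp: I_def)
  then obtain Ls where Ls: "\<forall>t\<in>I. length (Ls t) = 2 * n * (q - 1) + snd t \<and>
      (\<forall>l\<in>set (Ls t). hform l \<and> l (w (fst t), c (fst t)) \<noteq> \<zero>) \<and>
      (\<forall>v\<in>H. (\<forall>l\<in>set (Ls t). l v \<noteq> \<zero>) \<longrightarrow>
         (\<exists>s\<in>carrier R - {\<zero>}. v = (vscale R n s (w (fst t)), s \<otimes> c (fst t))))"
    by (rule bchoice[THEN exE])
  have len: "length (Ls t) = 2 * n * (q - 1) + snd t"
    and hf: "\<And>l. l \<in> set (Ls t) \<Longrightarrow> hform l"
    and nz: "\<And>l. l \<in> set (Ls t) \<Longrightarrow> l (w (fst t), c (fst t)) \<noteq> \<zero>"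
    and sep: "\<And>v. v \<in> H \<Longrightarrow> (\<And>l. l \<in> set (Ls t) \<Longrightarrow> l v \<noteq> \<zero>) \<Longrightarrow>
         \<exists>s\<in>carrier R - {\<zero>}. v = (vscale R n s (w (fst t)), s \<otimes> c (fst t))" if "t \<in> I" for t
    using bspec[OF Ls that] by blast+
  have hform_cl: "l x \<in> carrier R" if "hform l" "x \<in> H" for l x
    using that unfolding hform_def by blast
  \<comment> \<open>\<open>g t x i y\<close> is the Taylor coefficient of order i at x of the
    product belonging to t, in the horizontal direction with spatial part y.\<close>
  define g where "g t x i y = lin_coeff R (map (\<lambda>(A, l). (A, l y))
      (map (\<lambda>l. (l x, \<lambda>y. l (y, sympl R n (fst x) y))) (Ls t))) i" for t x i y
  have hg_g: "hg i (g t x i)" if "t \<in> I" "x \<in> H" for t x i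
    unfolding g_def
  proof (rule homog_lin_coeff)
    fix A l assume "(A, l) \<in> set (map (\<lambda>l. (l x, \<lambda>y. l (y, sympl R n (fst x) y))) (Ls t))"
    then obtain l' where l': "l' \<in> set (Ls t)" "A = l' x" "l = (\<lambda>y. l' (y, sympl R n (fst x) y))"
      by auto
    have "hform l'" using hf[OF that(1) l'(1)] .
    then show "A \<in> carrier R \<and> linear_on l"
      using that(2) unfolding l' hform_def by (auto simp: H_eq)
  qed
  have less': "(\<Sum>x\<in>H. f x ^ (2 * n)) < card I" using less I by simp
  obtain a where a: "a \<in> I \<rightarrow> carrier R" "\<exists>t\<in>I. a t \<noteq> \<zero>"
    "\<forall>x\<in>H. \<forall>i<f x. \<forall>y\<in>V. (\<Oplus>t\<in>I. a t \<otimes> g t x i y) = \<zero>"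
    by (rule nontrivial_vanishing_comb[OF fin finH I(1) hg_g less'])
  \<comment> \<open>\<open>M\<close> holds the values of k that occur with a nonzero coefficient.
    Its maximum makes \<open>?D\<close> the largest degree in play, and some \<theta> occurs in that
    degree.\<close>
  define M where "M = {k. \<exists>\<theta>. (\<theta>, k) \<in> I \<and> a (\<theta>, k) \<noteq> \<zero>}"
  have M: "finite M" "M \<noteq> {}" using a(2)
      by (auto simp: M_def I_def intro: rev_finite_subset[of "{1..q}"])
  define k where "k = Max M"
  obtain \<theta> where \<theta>: "(\<theta>, k) \<in> I" "a (\<theta>, k) \<noteq> \<zero>" using Max_in[OF M] by (auto simp: k_def M_def)
  have \<theta>T: "\<theta> \<in> \<Theta>" and kq: "k \<le> q" using \<theta> by (auto simp: I_def)
  have max: "a t = \<zero>" if "t \<in> I" "snd t > k" for t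
  proof (rule ccontr)
    assume "a t \<noteq> \<zero>"
    then have "snd t \<in> M" using that by (auto simp: M_def intro!: exI[of _ "fst t"])
    then show False using Max_ge[OF M(1), of "snd t"] that by (simp add: k_def)
  qed
  define J where "J = {t \<in> I. snd t \<le> k}"
  define v where "v = (w \<theta>, c \<theta>)"
  have v: "v \<in> H" using vH[OF \<theta>T] by (simp add: v_def)
  have pH: "p \<theta> \<in> H" using p[OF \<theta>T] .
  define xs where "xs t = map (\<lambda>l. (l (p \<theta>), l v)) (Ls t)" for t
  let ?D = "2 * n * (q - 1) + k"
  have xs: "set (xs t) \<subseteq> carrier R \<times> carrier R" "length (xs t) = 2 * n * (q - 1) + snd t"
      if "t \<in> I" for t
    using hf[OF that] len[OF that] hform_cl[OF _ v] hform_cl[OF _ pH] by (auto simp: xs_def)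
  have J: "finite J" "J \<subseteq> I" using I by (auto simp: J_def)
  have zero: "(\<Oplus>t\<in>J. a t \<otimes> lin_coeff R (xs t) ?D) = \<zero>"
  proof (rule UP_domain.lin_comb_eq_zero[OF _ field_axioms fin J(1)])
    show "UP_domain R" by (simp add: UP_domain_def UP_cring_def domain_axioms is_cring)
    show "set (xs t) \<subseteq> carrier R \<times> carrier R \<and> length (xs t) \<le> ?D" if "t \<in> J" for t
      using xs that by (auto simp: J_def)
    show "a \<in> J \<rightarrow> carrier R" using a J by blast
    let ?f = "\<lambda>s. f (line_pt R n (p \<theta>) v s)"
    show "(\<Oplus>t\<in>J. a t \<otimes> lin_coeff R (lin_shift R s (xs t)) i) = \<zero>"
      if s: "s \<in> carrier R" and i: "i < ?f s" for s i
    proof -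
      let ?x = "line_pt R n (p \<theta>) v s"
      have x: "?x \<in> H" using line_pt_closed[OF pH v s] .
      have wV: "w \<theta> \<in> V" using w[OF \<theta>T] by simp
      \<comment> \<open>The conditions at a point concern horizontal directions only. They apply to
        \<open>v\<close> at every point of the line because \<open>v\<close> stays horizontal along
        it.\<close>
      have "sympl R n (fst ?x) (w \<theta>) = c \<theta>"
        using sympl_shift[of "fst (p \<theta>)" "w \<theta>" s] pH wV s
            by (auto simp: line_pt_def v_def c_def H_eq)
      then have "lin_shift R s (xs t) = map (\<lambda>(A, l). (A, l (w \<theta>)))
          (map (\<lambda>l. (l ?x, \<lambda>y. l (y, sympl R n (fst ?x) y))) (Ls t))" if "t \<in> I" for t
        using hf[OF that] pH v s unfolding hform_def lin_shift_def xs_def by (auto simp: v_def)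
      then have "lin_coeff R (lin_shift R s (xs t)) i = g t ?x i (w \<theta>)" if "t \<in> I" for t
        unfolding g_def using that by simp
      moreover have gc: "g t ?x i (w \<theta>) \<in> carrier R" if "t \<in> I" for t
        using homog_closed[OF hg_g[OF that x] wV] .
      moreover have ac: "a t \<in> carrier R" if "t \<in> I" for t using a that by blast
      ultimately have "(\<Oplus>t\<in>J. a t \<otimes> lin_coeff R (lin_shift R s (xs t)) i)
          = (\<Oplus>t\<in>I. a t \<otimes> g t ?x i (w \<theta>))"
        using I J max by (intro add.finprod_mono_neutral_cong_left) (auto simp: J_def)
      then show ?thesis using a(3) x i wV by simp
    qed
    have "q > 0" using fin by (metis card_gt_0_iff empty_iff zero_closed)
    \<comment> \<open>Since k \<le> q, the degree 2n(q - 1) + k is at most (2n + 1) q: the constant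
      in \<open>big\<close>.\<close>
    then have "?D \<le> (2 * n + 1) * q" using kq by (cases q) auto
    also have "\<dots> < sum f (hline R n (p \<theta>) (w \<theta>))" by (rule big[OF \<theta>T])
    also have "\<dots> = sum ?f (carrier R)"
      unfolding hline_eq using inj_line_pt[OF pH v] w[OF \<theta>T]
      by (subst sum.reindex) (auto simp: v_def c_def)
    finally show "?D < sum ?f (carrier R)" .
  qed
  \<comment> \<open>Shorter products have no coefficient in degree \<open>?D\<close>. A product of
    full length for another direction has a factor vanishing at \<open>v\<close>: otherwise
    \<open>v\<close> would be a multiple of that direction vector and the two refined directions
    would agree.\<close>
  have "a t \<otimes> lin_coeff R (xs t) ?D = \<zero>" if t: "t \<in> J" "t \<noteq> (\<theta>, k)" for t
  proof -
    have tI: "t \<in> I" and at: "a t \<in> carrier R" using t J a by auto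
    have "lin_coeff R (xs t) ?D = \<zero>"
    proof (cases "snd t = k")
      case False
      then have "length (xs t) < ?D" using xs(2)[OF tI] t by (auto simp: J_def)
      then show ?thesis using lin_coeff_above xs(1)[OF tI] by blast
    next
      case True
      have ne: "fst t \<noteq> \<theta>" "fst t \<in> \<Theta>" using t True tI by (auto simp: I_def prod_eq_iff)
      have "\<exists>l\<in>set (Ls t). l v = \<zero>"
      proof (rule ccontr)
        assume "\<not> ?thesis"
        then obtain s where s: "s \<in> carrier R" "s \<noteq> \<zero>"
            "v = (vscale R n s (w (fst t)), s \<otimes> c (fst t))"
          using sep[OF tI v] by blast
        have "\<theta> = proj_pt R n (fst v) (snd v)" using dirs[OF \<theta>T] by (simp add: v_def c_def)
        also have "\<dots> = proj_pt R n (w (fst t)) (c (fst t))"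
          unfolding s(3) using proj_pt_rescale[OF field_axioms s(1,2)] w[OF ne(2)] c[OF ne(2)]
              by simp
        also have "\<dots> = fst t" using dirs[OF ne(2)] by (simp add: c_def)
        finally show False using ne by simp
      qed
      then show ?thesis
        using lin_coeff_top_eq_zero_iff[OF domain_axioms xs(1)[OF tI]] xs(2)[OF tI] True
        by (auto simp: xs_def)
    qed
    then show ?thesis using at by simp
  qed
  moreover have aL: "a (\<theta>, k) \<in> carrier R" "lin_coeff R (xs (\<theta>, k)) ?D \<in> carrier R"
    using a \<theta>(1) lin_coeff_closed[OF xs(1)[OF \<theta>(1)]] by auto
  moreover have \<theta>J: "(\<theta>, k) \<in> J" using \<theta> by (simp add: J_def)
  moreover have "a t \<otimes> lin_coeff R (xs t) ?D \<in> carrier R" if "t \<in> J" for t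
    using a(1) J(2) lin_coeff_closed[OF xs(1), of t] that by blast
  ultimately have "(\<Oplus>t\<in>J. a t \<otimes> lin_coeff R (xs t) ?D) = (\<Oplus>t\<in>{(\<theta>, k)}. a t \<otimes> lin_coeff R (xs t) ?D)"
    using J by (intro add.finprod_mono_neutral_cong_right) auto
  also have "\<dots> = a (\<theta>, k) \<otimes> lin_coeff R (xs (\<theta>, k)) ?D" using aL by simp
  finally have "lin_coeff R (xs (\<theta>, k)) ?D = \<zero>" using zero aL \<theta>(2) integral by metis
  then have "\<exists>ab\<in>set (xs (\<theta>, k)). snd ab = \<zero>"
    using lin_coeff_top_eq_zero_iff[OF domain_axioms xs(1)[OF \<theta>(1)]] xs(2)[OF \<theta>(1)] by simp
  then obtain l where "l \<in> set (Ls (\<theta>, k))" "l v = \<zero>" by (auto simp: xs_def)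
  then show False using nz[OF \<theta>(1)] by (simp add: v_def)
qed

end

section \<open>Level sets and norms of finite families\<close>

abbreviation pow2 :: "int \<Rightarrow> real" where "pow2 k \<equiv> 2 powr real_of_int k"

lemma weighted_count_le:
  fixes c :: real
  assumes "finite A" "\<And>x. x \<in> A \<Longrightarrow> 0 \<le> g x"
  shows "real (card {x \<in> A. c \<le> g x}) * c \<le> sum g A"
proof -
  have "real (card {x \<in> A. c \<le> g x}) * c = (\<Sum>x\<in>{x \<in> A. c \<le> g x}. c)" by simp
  also have "\<dots> \<le> (\<Sum>x\<in>{x \<in> A. c \<le> g x}. g x)" by (intro sum_mono) auto
  also have "\<dots> \<le> sum g A" using assms by (intro sum_mono2) auto
  finally show ?thesis .
qed

text \<open>The sum of the geometric series with ratio 2^(-\<delta>).\<close>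

definition geo :: "real \<Rightarrow> real" where "geo \<delta> = 1 / (1 - 2 powr (- \<delta>))"

lemma geo_pos: "0 < \<delta> \<Longrightarrow> 0 < geo \<delta>"
  using powr_less_mono[of "-\<delta>" 0 "2::real"] by (simp add: geo_def)

text \<open>With the term of the largest exponent taken out, distinct integers give distinct powers
  of 2^(-\<delta>); so the last term controls the sum up to a full geometric series.\<close>

lemma dyadic_sum_le_upper:
  fixes b \<delta> :: real and Z :: "int set"
  assumes \<delta>: "0 < \<delta>" and Z: "finite Z" "\<And>k. k \<in> Z \<Longrightarrow> pow2 k \<le> b"
  shows "(\<Sum>k\<in>Z. 2 powr (real_of_int k * \<delta>)) \<le> geo \<delta> * b powr \<delta>"
proof (cases "Z = {}")
  case False
  define m where "m = Max Z"
  define y where "y = 2 powr (- \<delta>)"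
  have y: "0 < y" "y < 1" using \<delta> powr_less_mono[of "-\<delta>" 0 "2::real"] by (auto simp: y_def)
  have m: "m \<in> Z" "\<And>k. k \<in> Z \<Longrightarrow> k \<le> m" using Z False by (auto simp: m_def)
  have "(\<Sum>k\<in>Z. 2 powr (real_of_int k * \<delta>)) = (\<Sum>k\<in>Z. 2 powr (m * \<delta>) * y ^ nat (m - k))"
  proof (intro sum.cong refl)
    fix k assume "k \<in> Z"
    then have "real (nat (m - k)) = real_of_int m - real_of_int k" using m by simp
    then have "y ^ nat (m - k) = 2 powr (- \<delta> * (real_of_int m - real_of_int k))"
      using y by (simp add: powr_realpow[symmetric] y_def powr_powr)
    then show "2 powr (real_of_int k * \<delta>) = 2 powr (m * \<delta>) * y ^ nat (m - k)"
      by (simp add: powr_add[symmetric] algebra_simps)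
  qed
  also have "\<dots> = 2 powr (m * \<delta>) * (\<Sum>j\<in>(\<lambda>k. nat (m - k)) ` Z. y ^ j)"
  proof (subst sum.reindex)
    show "inj_on (\<lambda>k. nat (m - k)) Z"
    proof
      fix k l assume "k \<in> Z" "l \<in> Z" "nat (m - k) = nat (m - l)"
      then show "k = l" using m(2)[of k] m(2)[of l] by linarith
    qed
  qed (simp add: sum_distrib_left)
  also have "(\<Sum>j\<in>(\<lambda>k. nat (m - k)) ` Z. y ^ j) \<le> (\<Sum>j. y ^ j)"
    using y Z by (intro sum_le_suminf summable_geometric) auto
  also have "(\<Sum>j. y ^ j) = geo \<delta>" using y by (simp add: suminf_geometric geo_def y_def)
  also have "2 powr (m * \<delta>) * geo \<delta> \<le> b powr \<delta> * geo \<delta>"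
    using powr_mono2[of \<delta> "pow2 m" b] Z(2)[OF m(1)] \<delta> geo_pos[OF \<delta>]
    by (intro mult_right_mono) (auto simp: powr_powr)
  finally show ?thesis by (simp add: mult.commute)
qed (use geo_pos[OF \<delta>] in auto)

lemma dyadic_sum_le_lower:
  fixes b \<delta> :: real and Z :: "int set"
  assumes \<delta>: "0 < \<delta>" and Z: "finite Z" "\<And>k. k \<in> Z \<Longrightarrow> b \<le> pow2 k" and b: "0 < b"
  shows "(\<Sum>k\<in>Z. 2 powr (real_of_int k * (- \<delta>))) \<le> geo \<delta> * b powr (- \<delta>)"
proof -
  have "(\<Sum>k\<in>Z. 2 powr (real_of_int k * (- \<delta>))) = (\<Sum>k\<in>uminus ` Z. 2 powr (real_of_int k * \<delta>))"
    by (subst sum.reindex) auto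
  also have "\<dots> \<le> geo \<delta> * (1 / b) powr \<delta>"
  proof (rule dyadic_sum_le_upper[OF \<delta>])
    fix k assume "k \<in> uminus ` Z"
    then have "b \<le> 2 powr (- real_of_int k)" using Z(2)[of "-k"] by auto
    then show "pow2 k \<le> 1 / b" using b by (simp add: powr_minus field_simps)
  qed (use Z in auto)
  also have "(1 / b) powr \<delta> = b powr (- \<delta>)"
    using b by (simp add: powr_minus_divide powr_divide)
  finally show ?thesis .
qed

text \<open>A positive value lies between 2^e and 2^(e + 1) for e the floor of its logarithm, and Z
  collects these e. Adding all other levels of Z below the value only enlarges the sum and produces
  counting functions. That each level in Z is reached limits the number of levels in the critical
  estimate.\<close>

lemma dyadic_decomposition:
  fixes g :: "'d \<Rightarrow> real"
  assumes D: "finite D" and g: "\<And>\<theta>. \<theta> \<in> D \<Longrightarrow> 0 \<le> g \<theta>" and v: "0 < v"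
  obtains Z :: "int set" where "finite Z" "\<forall>k\<in>Z. \<exists>\<theta>\<in>D. pow2 k \<le> g \<theta>"
    "(\<Sum>\<theta>\<in>D. g \<theta> powr v) \<le>
       2 powr v * (\<Sum>k\<in>Z. 2 powr (real_of_int k * v) * card {\<theta> \<in> D. pow2 k \<le> g \<theta>})"
proof
  define P where "P = {\<theta> \<in> D. 0 < g \<theta>}"
  define e where "e \<theta> = \<lfloor>log 2 (g \<theta>)\<rfloor>" for \<theta>
  have P: "finite P" using D by (simp add: P_def)
  have e: "pow2 (e \<theta>) \<le> g \<theta>" "g \<theta> \<le> 2 * pow2 (e \<theta>)" if "\<theta> \<in> P" for \<theta>
  proof -
    have gp: "0 < g \<theta>" using that by (simp add: P_def)
    have "pow2 (e \<theta>) \<le> 2 powr (log 2 (g \<theta>))" unfolding e_def by (intro powr_mono) auto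
    then show "pow2 (e \<theta>) \<le> g \<theta>" using gp by simp
    have "2 powr (log 2 (g \<theta>)) \<le> 2 powr (1 + real_of_int (e \<theta>))" unfolding e_def
        by (intro powr_mono) linarith+
    then show "g \<theta> \<le> 2 * pow2 (e \<theta>)" using gp by (simp add: powr_add)
  qed
  let ?Z = "e ` P"
  show "finite ?Z" using P by simp
  show "\<forall>k\<in>?Z. \<exists>\<theta>\<in>D. pow2 k \<le> g \<theta>"
    using e by (auto simp: P_def)
  have "(\<Sum>\<theta>\<in>D. g \<theta> powr v) = (\<Sum>\<theta>\<in>P. g \<theta> powr v)"
    using D g by (intro sum.mono_neutral_right) (force simp: P_def)+
  also have "\<dots> \<le> (\<Sum>\<theta>\<in>P. 2 powr v * (\<Sum>k\<in>?Z. if pow2 k \<le> g \<theta> then 2 powr (real_of_int k * v) else 0))"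
  proof (intro sum_mono)
    fix \<theta> assume \<theta>: "\<theta> \<in> P"
    have "g \<theta> powr v \<le> (2 * pow2 (e \<theta>)) powr v"
      using e[OF \<theta>] v \<theta> by (intro powr_mono2) (auto simp: P_def)
    also have "\<dots> = 2 powr v * 2 powr (real_of_int (e \<theta>) * v)" by (simp add: powr_mult powr_powr)
    also have "2 powr (real_of_int (e \<theta>) * v) \<le> (\<Sum>k\<in>?Z. if pow2 k \<le>
        g \<theta> then 2 powr (real_of_int k * v) else 0)"
      using member_le_sum[of "e \<theta>" ?Z "\<lambda>k. if pow2 k \<le>
          g \<theta> then 2 powr (real_of_int k * v) else 0"] e[OF \<theta>] \<theta> P
      by auto
    finally show "g \<theta> powr v \<le> 2 powr v * (\<Sum>k\<in>?Z. if pow2 k \<le>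
        g \<theta> then 2 powr (real_of_int k * v) else 0)"
      by simp
  qed
  also have "\<dots> = 2 powr v * (\<Sum>k\<in>?Z. \<Sum>\<theta>\<in>P. if pow2 k \<le> g \<theta> then 2 powr (real_of_int k * v) else 0)"
    by (subst sum.swap) (simp add: sum_distrib_left)
  also have "\<dots> = 2 powr v * (\<Sum>k\<in>?Z. 2 powr (real_of_int k * v) * card {\<theta> \<in> P. pow2 k \<le> g \<theta>})"
    using P by (simp add: sum.If_cases Int_def mult.commute)
  also have "\<dots> \<le> 2 powr v * (\<Sum>k\<in>?Z. 2 powr (real_of_int k * v) * card {\<theta> \<in> D. pow2 k \<le> g \<theta>})"
    using D by (intro mult_left_mono sum_mono) (auto intro!: card_mono simp: P_def)
  finally show "(\<Sum>\<theta>\<in>D. g \<theta> powr v) \<le>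
       2 powr v * (\<Sum>k\<in>?Z. 2 powr (real_of_int k * v) * card {\<theta> \<in> D. pow2 k \<le> g \<theta>})" .
qed

text \<open>Real interpolation in one step. A contribution with decay \<rho> < v that stops at the
  level b x gives a level sum dominated by its upper end; one with decay \<rho>' > v that starts at
  b' x is dominated by its lower end. The index x may be a point of the space, or one dummy element
  when the counting bound is not split over points.\<close>

lemma layer_cake_bound:
  fixes g :: "'d \<Rightarrow> real" and h h' b b' :: "'x \<Rightarrow> real"
  assumes D: "finite D" and X: "finite X" and g: "\<And>\<theta>. \<theta> \<in> D \<Longrightarrow> 0 \<le> g \<theta>"
    and v: "0 < v" "\<rho> < v" "v < \<rho>'"
    and h: "\<And>x. x \<in> X \<Longrightarrow> 0 \<le> h x" and h': "\<And>x. x \<in> X \<Longrightarrow> 0 \<le> h' x \<and> 0 \<le> b' x \<and> (b' x = 0 \<longrightarrow> h' x = 0)"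
    and count: "\<And>l. 0 < l \<Longrightarrow> card {\<theta> \<in> D. l \<le> g \<theta>} \<le>
      (\<Sum>x\<in>X. if l \<le> b x then h x * l powr (- \<rho>) else 0) + (\<Sum>x\<in>X.
          if b' x \<le> l then h' x * l powr (- \<rho>') else 0)"
  shows "(\<Sum>\<theta>\<in>D. g \<theta> powr v) \<le>
     2 powr v * (geo (v - \<rho>) * (\<Sum>x\<in>X. h x * b x powr (v - \<rho>)) +
                 geo (\<rho>' - v) * (\<Sum>x\<in>X. h' x * b' x powr (v - \<rho>')))"
proof -
  obtain Z :: "int set" where Z: "finite Z" and "\<forall>k\<in>Z. \<exists>\<theta>\<in>D. pow2 k \<le> g \<theta>" and
    le: "(\<Sum>\<theta>\<in>D. g \<theta> powr v) \<le>
       2 powr v * (\<Sum>k\<in>Z. 2 powr (real_of_int k * v) * card {\<theta> \<in> D. pow2 k \<le> g \<theta>})"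
    by (rule dyadic_decomposition[OF D g v(1)])
  let ?l = "\<lambda>k::int. pow2 k"
  define A where "A = (\<Sum>k\<in>Z. \<Sum>x\<in>X. if ?l k \<le>
      b x then h x * 2 powr (real_of_int k * (v - \<rho>)) else 0)"
  define B where "B = (\<Sum>k\<in>Z. \<Sum>x\<in>X. if b' x \<le>
      ?l k then h' x * 2 powr (real_of_int k * (v - \<rho>')) else 0)"
  have "(\<Sum>k\<in>Z. 2 powr (real_of_int k * v) * card {\<theta> \<in> D. ?l k \<le> g \<theta>}) \<le>
     (\<Sum>k\<in>Z. 2 powr (real_of_int k * v) * ((\<Sum>x\<in>X. if ?l k \<le> b x then h x * ?l k powr (- \<rho>) else 0)
        + (\<Sum>x\<in>X. if b' x \<le> ?l k then h' x * ?l k powr (- \<rho>') else 0)))"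
    by (intro sum_mono mult_left_mono count) auto
  also have "\<dots> = A + B"
    unfolding A_def B_def by (simp add: distrib_left sum.distrib sum_distrib_left powr_powr
        mult.left_commute
        powr_add[symmetric] right_diff_distrib if_distrib[of "\<lambda>y. _ * y"] cong: if_cong)
  finally have AB: "(\<Sum>k\<in>Z. 2 powr (real_of_int k * v) * card {\<theta> \<in> D. ?l k \<le> g \<theta>}) \<le> A + B" .
  have "A = (\<Sum>x\<in>X. h x * (\<Sum>k\<in>{k\<in>Z. ?l k \<le> b x}. 2 powr (real_of_int k * (v - \<rho>))))"
    unfolding A_def using Z by (subst sum.swap) (simp add: sum.If_cases sum_distrib_left Int_def)
  also have "\<dots> \<le> (\<Sum>x\<in>X. h x * (geo (v - \<rho>) * b x powr (v - \<rho>)))"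
    using Z v h by (intro sum_mono mult_left_mono dyadic_sum_le_upper) auto
  also have "\<dots> = geo (v - \<rho>) * (\<Sum>x\<in>X. h x * b x powr (v - \<rho>))"
    by (simp add: sum_distrib_left mult.left_commute)
  finally have A: "A \<le> geo (v - \<rho>) * (\<Sum>x\<in>X. h x * b x powr (v - \<rho>))" .
  have "B = (\<Sum>x\<in>X. h' x * (\<Sum>k\<in>{k\<in>Z. b' x \<le> ?l k}. 2 powr (real_of_int k * (v - \<rho>'))))"
    unfolding B_def using Z by (subst sum.swap) (simp add: sum.If_cases sum_distrib_left Int_def)
  also have "\<dots> \<le> (\<Sum>x\<in>X. h' x * (geo (\<rho>' - v) * b' x powr (v - \<rho>')))"
  proof (intro sum_mono)
    fix x assume x: "x \<in> X"
    show "h' x * (\<Sum>k\<in>{k\<in>Z. b' x \<le> ?l k}. 2 powr (real_of_int k * (v - \<rho>')))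
      \<le> h' x * (geo (\<rho>' - v) * b' x powr (v - \<rho>'))"
    \<comment> \<open>Without a positive lower end the negative powers have no uniform bound; the
      hypotheses then give \<open>h' x = 0\<close>.\<close>
    proof (cases "b' x = 0")
      case False
      then have "0 < b' x" using h'[OF x] by simp
      then have "(\<Sum>k\<in>{k\<in>Z. b' x \<le> ?l k}. 2 powr (real_of_int k * (- (\<rho>' - v))))
          \<le> geo (\<rho>' - v) * b' x powr (- (\<rho>' - v))"
        using Z v by (intro dyadic_sum_le_lower) simp_all
      then show ?thesis
        unfolding minus_diff_eq using h'[OF x] by (intro mult_left_mono) blast+
    qed (use h'[OF x] in auto)
  qed
  also have "\<dots> = geo (\<rho>' - v) * (\<Sum>x\<in>X. h' x * b' x powr (v - \<rho>'))"
    by (simp add: sum_distrib_left mult.left_commute)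
  finally have "(\<Sum>k\<in>Z. 2 powr (real_of_int k * v) * card {\<theta> \<in> D. ?l k \<le> g \<theta>}) \<le>
      geo (v - \<rho>) * (\<Sum>x\<in>X. h x * b x powr (v - \<rho>)) + geo (\<rho>' - v) * (\<Sum>x\<in>X. h' x * b' x powr (v -
          \<rho>'))"
    using A AB by linarith
  then have "2 powr v * (\<Sum>k\<in>Z. 2 powr (real_of_int k * v) * card {\<theta> \<in> D. ?l k \<le> g \<theta>}) \<le> 2 powr v *
     (geo (v - \<rho>) * (\<Sum>x\<in>X. h x * b x powr (v - \<rho>)) + geo (\<rho>' - v) * (\<Sum>x\<in>X. h' x * b' x powr (v -
         \<rho>')))"
    by (intro mult_left_mono) auto
  with le show ?thesis by linarith
qed

lemma layer_cake_bound_upper: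
  fixes g :: "'d \<Rightarrow> real" and h b :: "'x \<Rightarrow> real"
  assumes D: "finite D" and X: "finite X" and g: "\<And>\<theta>. \<theta> \<in> D \<Longrightarrow> 0 \<le> g \<theta>"
    and v: "0 < v" "\<rho> < v" and h: "\<And>x. x \<in> X \<Longrightarrow> 0 \<le> h x"
    and count: "\<And>l. 0 < l \<Longrightarrow> card {\<theta> \<in> D. l \<le> g \<theta>} \<le> (\<Sum>x\<in>X. if l \<le>
        b x then h x * l powr (- \<rho>) else 0)"
  shows "(\<Sum>\<theta>\<in>D. g \<theta> powr v) \<le> 2 powr v * (geo (v - \<rho>) * (\<Sum>x\<in>X. h x * b x powr (v - \<rho>)))"
  using layer_cake_bound[OF D X g v, where \<rho>' = "v + 1" and h = h and b = b and h' = "\<lambda>_. 0"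
      and b' = "\<lambda>_. 0"] h count
  by simp

section \<open>Comparison of counting norms\<close>

definition lnorm :: "real \<Rightarrow> 'x set \<Rightarrow> ('x \<Rightarrow> real) \<Rightarrow> real" where
  "lnorm p A f = (\<Sum>x\<in>A. f x powr p) powr (1 / p)"

lemma lnorm_nonneg: "0 \<le> lnorm p A f" by (simp add: lnorm_def)

lemma lnorm_powr: "0 < p \<Longrightarrow> lnorm p A f powr p = (\<Sum>x\<in>A. f x powr p)"
  by (simp add: lnorm_def powr_powr sum_nonneg)

lemma lnorm_ge:
  assumes "0 < p" "finite A" "x \<in> A" "0 \<le> f x"
  shows "f x \<le> lnorm p A f"
proof -
  have "f x powr p \<le> lnorm p A f powr p"
    unfolding lnorm_powr[OF assms(1)] using assms by (intro member_le_sum) auto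
  then show ?thesis
    using powr_less_mono2[OF assms(1) lnorm_nonneg, of p A f "f x"] by force
qed

lemma lnorm_le:
  assumes p: "0 < p" and le: "(\<Sum>x\<in>A. f x powr p) \<le> C * B powr p" and C: "0 \<le> C" and B: "0 \<le> B"
  shows "lnorm p A f \<le> C powr (1 / p) * B"
proof -
  have "lnorm p A f \<le> (C * B powr p) powr (1 / p)"
    unfolding lnorm_def using p le by (intro powr_mono2) (auto intro!: sum_nonneg)
  also have "\<dots> = C powr (1 / p) * B" using p C B by (simp add: powr_mult powr_powr)
  finally show ?thesis .
qed

text \<open>No value exceeds the norm T of order p, so f^s \<le> f^p T^(s - p) pointwise.\<close>

lemma powr_sum_mono_exponent:
  assumes "0 < p" "p \<le> s" "finite A" "\<And>x. x \<in> A \<Longrightarrow> 0 \<le> f x"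
  shows "(\<Sum>x\<in>A. f x powr s) \<le> lnorm p A f powr s"
proof -
  have "(\<Sum>x\<in>A. f x powr s) \<le> (\<Sum>x\<in>A. f x powr p * lnorm p A f powr (s - p))"
  proof (intro sum_mono)
    fix x assume x: "x \<in> A"
    have "f x powr s = f x powr p * f x powr (s - p)" by (simp add: powr_add[symmetric])
    also have "\<dots> \<le> f x powr p * lnorm p A f powr (s - p)"
      using assms lnorm_ge[OF assms(1,3) x] x by (intro mult_left_mono powr_mono2) auto
    finally show "f x powr s \<le> f x powr p * lnorm p A f powr (s - p)" .
  qed
  also have "\<dots> = lnorm p A f powr p * lnorm p A f powr (s - p)"
    using assms by (simp add: lnorm_powr sum_distrib_right)
  also have "\<dots> = lnorm p A f powr s" by (simp add: powr_add[symmetric])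
  finally show ?thesis .
qed

lemma lnorm_antimono:
  assumes "0 < p" "p \<le> s" "finite A" "\<And>x. x \<in> A \<Longrightarrow> 0 \<le> f x"
  shows "lnorm s A f \<le> lnorm p A f"
  using lnorm_le[where p = s and A = A and f = f and C = 1
      and B = "lnorm p A f"] powr_sum_mono_exponent[OF assms] assms lnorm_nonneg by force

text \<open>Hoelder's inequality with an extra factor 2, obtained from a pointwise splitting.
  \<open>N\<close> is any upper bound for the number of points, which lets a bound such as 2 q^r be
  inserted directly.\<close>

lemma lnorm_powr_mean:
  assumes p: "0 < p" "p \<le> s" and A: "finite A" and N: "real (card A) \<le> N" "0 < N"
    and f: "\<And>x. x \<in> A \<Longrightarrow> 0 \<le> f x"
  shows "(\<Sum>x\<in>A. f x powr p) \<le> 2 * (N powr (1 / p - 1 / s) * lnorm s A f) powr p"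
proof -
  let ?T = "lnorm s A f"
  consider "?T = 0" | "?T > 0" using lnorm_nonneg[of s A f] by linarith
  then show ?thesis
  proof cases
    case 1
    then have "f x = 0" if "x \<in> A" for x using lnorm_ge[of s A x f] that p A f by fastforce
    then show ?thesis using 1 by simp
  next
    case 2
    \<comment> \<open>The constant function b on N points has the norm T of order s. Smaller values
      of f are bounded by b, larger ones by trading f^p for f^s b^(p - s); both parts give the same
      total, hence the factor 2.\<close>
    define b where "b = ?T * N powr (- 1 / s)"
    have b: "0 < b" using 2 N by (simp add: b_def)
    have "f x powr p \<le> b powr p + f x powr s * b powr (p - s)" if x: "x \<in> A" for x
    proof (cases "f x \<le> b")
      case True
      then have "f x powr p \<le> b powr p" using p f[OF x] by (intro powr_mono2) auto
      then show ?thesis by (smt (verit) mult_nonneg_nonneg powr_ge_zero)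
    next
      case False
      have "f x powr p = f x powr s * f x powr (p - s)" by (simp add: powr_add[symmetric])
      also have "\<dots> \<le> f x powr s * b powr (p - s)"
        using False b p by (intro mult_left_mono powr_mono2') auto
      finally show ?thesis by (smt (verit) powr_ge_zero)
    qed
    then have "(\<Sum>x\<in>A. f x powr p) \<le> (\<Sum>x\<in>A. b powr p + f x powr s * b powr (p - s))"
      by (rule sum_mono)
    also have "\<dots> = real (card A) * b powr p + ?T powr s * b powr (p - s)"
      using p by (simp add: sum.distrib lnorm_powr sum_distrib_right)
    also have "\<dots> \<le> N * b powr p + ?T powr s * b powr (p - s)"
      using N by (intro add_right_mono mult_right_mono) auto
    also have "N * b powr p = (N powr (1 / p - 1 / s) * ?T) powr p"
    proof -
      have "N * b powr p = N powr 1 * N powr (- 1 / s * p) * ?T powr p"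
        unfolding b_def using N 2 by (simp add: powr_mult powr_powr)
      also have "N powr 1 * N powr (- 1 / s * p) = N powr ((1 / p - 1 / s) * p)"
        unfolding powr_add[symmetric] using p
            by (intro arg_cong[of _ _ "(powr) N"]) (simp add: field_simps)
      finally show ?thesis using N 2 by (simp add: powr_mult powr_powr)
    qed
    also have "?T powr s * b powr (p - s) = (N powr (1 / p - 1 / s) * ?T) powr p"
    proof -
      have "?T powr s * b powr (p - s) = N powr (- 1 / s * (p - s)) * (?T powr s * ?T powr (p - s))"
        unfolding b_def using N 2 by (simp add: powr_mult powr_powr)
      also have "- 1 / s * (p - s) = (1 / p - 1 / s) * p" using p by (simp add: field_simps)
      also have "?T powr s * ?T powr (p - s) = ?T powr p" by (simp add: powr_add[symmetric])
      finally show ?thesis using N 2 by (simp add: powr_mult powr_powr)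
    qed
    finally show ?thesis by simp
  qed
qed

section \<open>Interpolation of the weak type bound\<close>

text \<open>All that interpolation needs of the operator: sublinearity, the trivial bounds and the
  weak type bound. The constants derived below depend on r, K and the exponents; q enters through
  explicit powers and, at the critical point, a logarithm.\<close>

locale weak_type_maximal =
  fixes r K q :: real and D :: "'d set" and H :: "'x set" and M :: "('x \<Rightarrow> real) \<Rightarrow> 'd \<Rightarrow> real"
  assumes r: "2 \<le> r" and K: "1 \<le> K" and q: "1 < q"
    and D: "finite D" "card D \<le> 2 * q powr r" and H: "finite H"
    and M_nonneg: "\<And>f \<theta>. (\<And>x. 0 \<le> f x) \<Longrightarrow> \<theta> \<in> D \<Longrightarrow> 0 \<le> M f \<theta>"
    and M_subadd: "\<And>f f1 f2 \<theta>. (\<And>x. 0 \<le> f x) \<Longrightarrow> (\<And>x. 0 \<le> f1 x) \<Longrightarrow> (\<And>x. 0 \<le> f2 x) \<Longrightarrow>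
       (\<And>x. f x \<le> f1 x + f2 x) \<Longrightarrow> \<theta> \<in> D \<Longrightarrow> M f \<theta> \<le> M f1 \<theta> + M f2 \<theta>"
    and M_le_sum: "\<And>f \<theta>. (\<And>x. 0 \<le> f x) \<Longrightarrow> \<theta> \<in> D \<Longrightarrow> M f \<theta> \<le> sum f H"
    and M_le_sup: "\<And>f \<theta> B. (\<And>x. 0 \<le> f x) \<Longrightarrow> (\<And>x. x \<in> H \<Longrightarrow> f x \<le> B) \<Longrightarrow> \<theta> \<in> D \<Longrightarrow> M f \<theta> \<le> q * B"
    and M_le_lnorm: "\<And>f \<theta> u. (\<And>x. 0 \<le> f x) \<Longrightarrow> 1 \<le> u \<Longrightarrow> \<theta> \<in> D \<Longrightarrow>
       M f \<theta> \<le> 2 * q powr (1 - 1 / u) * lnorm u H f"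
    and M_strong_1: "\<And>f. (\<And>x. 0 \<le> f x) \<Longrightarrow> (\<Sum>\<theta>\<in>D. M f \<theta>) \<le> 2 * q powr (r - 1) * sum f H"
    and M_weak: "\<And>f l. (\<And>x. 0 \<le> f x) \<Longrightarrow> 0 < l \<Longrightarrow>
       card {\<theta> \<in> D. l \<le> M f \<theta>} * l powr r \<le> K * q powr (r - 1) * (\<Sum>x\<in>H. f x powr r)"
begin

text \<open>Stated at l / 2 because f is always split into two parts, one of which must reach half
  of the level. The right side is a sum over points to fit the hypothesis of
  \<open>layer_cake_bound\<close>.\<close>

lemma weak_count:
  assumes f: "\<And>x. 0 \<le> f x" and l: "0 < l"
  shows "card {\<theta> \<in> D. l / 2 \<le> M f \<theta>} \<le> (\<Sum>x\<in>H. K * q powr (r - 1) * 2 powr r * f x powr r *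
      l powr (- r))"
proof -
  have "card {\<theta> \<in> D. l / 2 \<le> M f \<theta>} * (l / 2) powr r * (2 powr r * l powr (- r)) \<le>
     K * q powr (r - 1) * (\<Sum>x\<in>H. f x powr r) * (2 powr r * l powr (- r))"
    using M_weak[of f "l / 2"] f l by (intro mult_right_mono) auto
  moreover have "(l / 2) powr r * (2 powr r * l powr (- r)) = 1"
    using l by (simp add: powr_divide powr_minus field_simps)
  ultimately show ?thesis
    by (simp add: mult.assoc sum_distrib_left sum_distrib_right) (simp add: mult_ac)
qed

text \<open>Truncation from below: values \<open>f x < l / (2 q)\<close> contribute at most \<open>l / 2\<close> to a line sum.\<close>

lemma estimate_diag_high:
  assumes f: "\<And>x. 0 \<le> f x" and u: "r < u"
  shows "(\<Sum>\<theta>\<in>D. M f \<theta> powr u) \<le> 4 powr u * K * geo (u - r) * q powr (u - 1) * (\<Sum>x\<in>H. f x powr u)"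
proof -
  define h where "h x = K * q powr (r - 1) * 2 powr r * f x powr r" for x
  have "(\<Sum>\<theta>\<in>D. M f \<theta> powr u) \<le> 2 powr u * (geo (u - r) * (\<Sum>x\<in>H. h x * (2 * q * f x) powr (u - r)))"
  proof (rule layer_cake_bound_upper[OF D(1) H])
    fix l :: real assume l: "0 < l"
    define f1 where "f1 x = (if l \<le> 2 * q * f x then f x else 0)" for x
    define f2 where "f2 x = (if l \<le> 2 * q * f x then 0 else f x)" for x
    have nn: "0 \<le> f1 x" "0 \<le> f2 x" "f x \<le> f1 x + f2 x" for x using f by (auto simp: f1_def f2_def)
    have "l / 2 \<le> M f1 \<theta>" if \<theta>: "\<theta> \<in> D" "l \<le> M f \<theta>" for \<theta>
    proof -
      have "M f2 \<theta> \<le> q * (l / (2 * q))"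
        using q l nn \<theta> by (intro M_le_sup) (auto simp: f2_def field_simps)
      then show ?thesis using M_subadd[of f f1 f2, OF f nn \<theta>(1)] \<theta>(2) q by simp
    qed
    then have "real (card {\<theta> \<in> D. l \<le> M f \<theta>}) \<le> real (card {\<theta> \<in> D. l / 2 \<le> M f1 \<theta>})"
      using D by (intro of_nat_mono card_mono) auto
    also have "\<dots> \<le> (\<Sum>x\<in>H. K * q powr (r - 1) * 2 powr r * f1 x powr r * l powr (- r))"
      by (rule weak_count[OF nn(1) l])
    also have "\<dots> = (\<Sum>x\<in>H. if l \<le> 2 * q * f x then h x * l powr (- r) else 0)"
      by (intro sum.cong) (auto simp: f1_def h_def)
    finally show "real (card {\<theta> \<in> D. l \<le> M f \<theta>}) \<le> (\<Sum>x\<in>H. if l \<le>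
        2 * q * f x then h x * l powr (- r) else 0)" .
  qed (use M_nonneg f r u K in \<open>auto simp: h_def\<close>)
  also have "(\<Sum>x\<in>H. h x * (2 * q * f x) powr (u - r)) =
      (\<Sum>x\<in>H. K * 2 powr u * q powr (u - 1) * f x powr u)"
  proof (intro sum.cong refl)
    fix x
    have "h x * (2 * q * f x) powr (u - r) =
      K * (2 powr r * 2 powr (u - r)) * (q powr (r - 1) * q powr (u - r)) * (f x powr r * f x
          powr (u - r))"
      using f q by (simp add: h_def powr_mult)
    then show "h x * (2 * q * f x) powr (u - r) = K * 2 powr u * q powr (u - 1) * f x powr u"
      by (simp add: powr_add[symmetric])
  qed
  also have "2 powr u * (geo (u - r) * (\<Sum>x\<in>H. K * 2 powr u * q powr (u - 1) * f x powr u)) =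
     (2 powr u * 2 powr u) * K * geo (u - r) * q powr (u - 1) * (\<Sum>x\<in>H. f x powr u)"
    by (simp add: sum_distrib_left mult_ac)
  also have "2 powr u * 2 powr u = (4::real) powr u" by (simp add: powr_mult[symmetric])
  finally show ?thesis .
qed

text \<open>Marcinkiewicz interpolation between the strong bound on \<ell>^1, applied to the values
  of f above the level l, and the weak bound of order r, applied to those below.\<close>

lemma estimate_diag_low:
  assumes f: "\<And>x. 0 \<le> f x" and u: "1 < u" "u < r"
  shows "(\<Sum>\<theta>\<in>D. M f \<theta> powr u) \<le>
     2 powr u * (4 * geo (u - 1) + K * 2 powr r * geo (r - u)) * q powr (r - 1) * (\<Sum>x\<in>H. f x powr
         u)"
proof -
  define h where "h x = 4 * q powr (r - 1) * f x" for x
  define h' where "h' x = K * q powr (r - 1) * 2 powr r * f x powr r" for x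
  have "(\<Sum>\<theta>\<in>D. M f \<theta> powr u) \<le> 2 powr u * (geo (u - 1) * (\<Sum>x\<in>H. h x * f x powr (u - 1)) +
      geo (r - u) * (\<Sum>x\<in>H. h' x * f x powr (u - r)))"
  proof (rule layer_cake_bound[OF D(1) H])
    fix l :: real assume l: "0 < l"
    define f1 where "f1 x = (if l \<le> f x then f x else 0)" for x
    define f2 where "f2 x = (if f x \<le> l then f x else 0)" for x
    have nn: "0 \<le> f1 x" "0 \<le> f2 x" "f x \<le> f1 x + f2 x" for x using f by (auto simp: f1_def f2_def)
    have "real (card {\<theta> \<in> D. l / 2 \<le> M f1 \<theta>}) * (l / 2) \<le> (\<Sum>\<theta>\<in>D. M f1 \<theta>)"
      using M_nonneg nn D by (intro weighted_count_le) auto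
    also have "\<dots> \<le> 2 * q powr (r - 1) * sum f1 H" by (rule M_strong_1[OF nn(1)])
    finally have "real (card {\<theta> \<in> D. l / 2 \<le> M f1 \<theta>}) \<le> 4 * q powr (r - 1) * sum f1 H / l"
      using l by (simp add: field_simps)
    also have "\<dots> = (\<Sum>x\<in>H. if l \<le> f x then h x * l powr (- 1) else 0)"
      unfolding sum_distrib_left sum_divide_distrib using l
      by (intro sum.cong) (auto simp: f1_def h_def powr_minus divide_inverse)
    finally have 1: "real (card {\<theta> \<in> D. l / 2 \<le> M f1 \<theta>}) \<le> (\<Sum>x\<in>H. if l \<le>
        f x then h x * l powr (- 1) else 0)" .
    have "real (card {\<theta> \<in> D. l / 2 \<le> M f2 \<theta>}) \<le>
        (\<Sum>x\<in>H. K * q powr (r - 1) * 2 powr r * f2 x powr r * l powr (- r))"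
      by (rule weak_count[OF nn(2) l])
    also have "\<dots> = (\<Sum>x\<in>H. if f x \<le> l then h' x * l powr (- r) else 0)"
      by (intro sum.cong) (auto simp: f2_def h'_def)
    finally have 2: "real (card {\<theta> \<in> D. l / 2 \<le> M f2 \<theta>}) \<le> (\<Sum>x\<in>H. if f x \<le>
        l then h' x * l powr (- r) else 0)" .
    have "{\<theta> \<in> D. l \<le> M f \<theta>} \<subseteq> {\<theta> \<in> D. l / 2 \<le> M f1 \<theta>} \<union> {\<theta> \<in> D. l / 2 \<le> M f2 \<theta>}"
      using M_subadd[of f f1 f2, OF f nn] by force
    then have "card {\<theta> \<in> D. l \<le> M f \<theta>} \<le> card ({\<theta> \<in> D. l / 2 \<le> M f1 \<theta>} \<union> {\<theta> \<in> D. l / 2 \<le> M f2 \<theta>})"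
      using D by (intro card_mono) auto
    also have "\<dots> \<le> card {\<theta> \<in> D. l / 2 \<le> M f1 \<theta>} + card {\<theta> \<in> D. l / 2 \<le> M f2 \<theta>}"
      by (rule card_Un_le)
    finally show "real (card {\<theta> \<in> D. l \<le> M f \<theta>}) \<le>
       (\<Sum>x\<in>H. if l \<le> f x then h x * l powr (- 1) else 0) + (\<Sum>x\<in>H.
           if f x \<le> l then h' x * l powr (- r) else 0)"
      using 1 2 by linarith
  qed (use M_nonneg f u K in \<open>auto simp: h_def h'_def\<close>)
  also have "(\<Sum>x\<in>H. h x * f x powr (u - 1)) = 4 * q powr (r - 1) * (\<Sum>x\<in>H. f x powr u)"
    unfolding sum_distrib_left
  proof (intro sum.cong refl)
    fix x
    have "f x * f x powr (u - 1) = f x powr u"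
      using f[of x] powr_add[of "f x" 1 "u - 1"] by simp
    then show "h x * f x powr (u - 1) = 4 * q powr (r - 1) * f x powr u"
      by (simp add: h_def mult.assoc)
  qed
  also have "(\<Sum>x\<in>H. h' x * f x powr (u - r)) = K * q powr (r - 1) * 2 powr r * (\<Sum>x\<in>H. f x powr u)"
    unfolding sum_distrib_left
  proof (intro sum.cong refl)
    fix x
    have "f x powr r * f x powr (u - r) = f x powr u" by (simp add: powr_add[symmetric])
    then show "h' x * f x powr (u - r) = K * q powr (r - 1) * 2 powr r * f x powr u"
      by (simp add: h'_def mult.assoc)
  qed
  finally show ?thesis by (simp add: algebra_simps)
qed

text \<open>The exponents run through the segment \<alpha> = 1 - (r - 1) \<beta> from (1/r, 1/r) to
  (1, 0), between the weak type bound and the trivial bound from \<ell>^1 to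
  \<ell>^\<infinity>.\<close>

lemma estimate_edge:
  assumes f: "\<And>x. 0 \<le> f x" and v: "r < v" and u: "u = v / (v - r + 1)"
  shows "(\<Sum>\<theta>\<in>D. M f \<theta> powr v) \<le> 4 powr v * K * geo (v - r) * q powr (r - 1) * lnorm u H f powr v"
proof -
  define S where "S = (\<Sum>x\<in>H. f x powr u)"
  have vr: "0 < v - r + 1" using v by simp
  have u0: "0 < u" using u vr v r by simp
  have S0: "0 \<le> S" by (simp add: S_def sum_nonneg)
  define h where "h x = K * q powr (r - 1) * 2 powr r * f x powr r" for x
  \<comment> \<open>Where b x < l, the identity f = f^(1 - u) f^u gives f x \<le> l f(x)^u / (2 S).
    Summed over all such points this is at most l / 2, so the discarded part changes no line sum by
    more than l / 2.\<close>
  define b where "b x = 2 * S * f x powr (1 - u)" for x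
  have "(\<Sum>\<theta>\<in>D. M f \<theta> powr v) \<le> 2 powr v * (geo (v - r) * (\<Sum>x\<in>H. h x * b x powr (v - r)))"
  proof (rule layer_cake_bound_upper[OF D(1) H])
    fix l :: real assume l: "0 < l"
    define f1 where "f1 x = (if l \<le> b x then f x else 0)" for x
    define f2 where "f2 x = (if l \<le> b x then 0 else f x)" for x
    have nn: "0 \<le> f1 x" "0 \<le> f2 x" "f x \<le> f1 x + f2 x" for x using f by (auto simp: f1_def f2_def)
    have f2_le: "S * f2 x \<le> (l / 2) * f x powr u" for x
    proof (cases "l \<le> b x \<or> f x = 0")
      case False
      then have fx: "0 < f x" using f[of x] by simp
      have "2 * S * f x powr (1 - u) * f x powr u \<le> l * f x powr u"
        using False by (intro mult_right_mono) (auto simp: b_def)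
      moreover have "f x powr (1 - u) * f x powr u = f x" using fx
          by (simp add: powr_add[symmetric])
      ultimately have "2 * S * f x \<le> l * f x powr u" by (simp add: mult.assoc)
      then show ?thesis using False by (simp add: f2_def)
    qed (use l f[of x] in \<open>auto simp: f2_def\<close>)
    have f2_sum: "sum f2 H \<le> l / 2"
    proof (cases "S = 0")
      case True
      have "f x = 0" if "x \<in> H" for x
        using True that H unfolding S_def by (subst (asm) sum_nonneg_eq_0_iff) auto
      then have "sum f2 H = 0" by (intro sum.neutral) (auto simp: f2_def)
      then show ?thesis using l by simp
    next
      case False
      have "S * sum f2 H \<le> S * (l / 2)"
      proof -
        have "(\<Sum>x\<in>H. S * f2 x) \<le> (\<Sum>x\<in>H. (l / 2) * f x powr u)" by (intro sum_mono f2_le)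
        then show ?thesis unfolding sum_distrib_left[symmetric] S_def[symmetric]
            by (simp only: mult.commute)
      qed
      then show ?thesis using False S0 by simp
    qed
    have "l / 2 \<le> M f1 \<theta>" if \<theta>: "\<theta> \<in> D" "l \<le> M f \<theta>" for \<theta>
      using M_le_sum[of f2, OF nn(2) \<theta>(1)] f2_sum M_subadd[of f f1 f2, OF f nn \<theta>(1)] \<theta>(2) by simp
    then have "real (card {\<theta> \<in> D. l \<le> M f \<theta>}) \<le> real (card {\<theta> \<in> D. l / 2 \<le> M f1 \<theta>})"
      using D by (intro of_nat_mono card_mono) auto
    also have "\<dots> \<le> (\<Sum>x\<in>H. K * q powr (r - 1) * 2 powr r * f1 x powr r * l powr (- r))"
      by (rule weak_count[OF nn(1) l])
    also have "\<dots> = (\<Sum>x\<in>H. if l \<le> b x then h x * l powr (- r) else 0)"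
      by (intro sum.cong) (auto simp: f1_def h_def)
    finally show "real (card {\<theta> \<in> D. l \<le> M f \<theta>}) \<le> (\<Sum>x\<in>H. if l \<le>
        b x then h x * l powr (- r) else 0)" .
  qed (use M_nonneg f r v K in \<open>auto simp: h_def\<close>)
  also have "(\<Sum>x\<in>H. h x * b x powr (v - r)) =
      (\<Sum>x\<in>H. K * 2 powr v * q powr (r - 1) * S powr (v - r) * f x powr u)"
  proof (intro sum.cong refl)
    fix x
    have e: "r + (1 - u) * (v - r) = u" unfolding u using vr by (simp add: field_simps)
    have "h x * b x powr (v - r) = K * (2 powr r * 2 powr (v - r)) * q powr (r - 1) * S powr (v - r)
        * (f x powr r * f x powr ((1 - u) * (v - r)))"
      using f S0 by (simp add: h_def b_def powr_mult powr_powr)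
    then show "h x * b x powr (v - r) = K * 2 powr v * q powr (r - 1) * S powr (v - r) * f x powr u"
      by (simp add: powr_add[symmetric] e)
  qed
  also have "\<dots> = K * 2 powr v * q powr (r - 1) * (S powr (v - r) * S)"
    unfolding sum_distrib_left[symmetric] S_def[symmetric] by (simp only: mult.assoc)
  also have "S powr (v - r) * S = S powr (v - r + 1)"
    using S0 by (simp add: powr_add)
  also have "S powr (v - r + 1) = lnorm u H f powr v"
  proof -
    have "1 / u * v = v - r + 1" using u vr v r by simp
    then show ?thesis by (simp add: lnorm_def S_def powr_powr)
  qed
  also have "2 powr v * (geo (v - r) * (K * 2 powr v * q powr (r - 1) * lnorm u H f powr v)) =
     (2 powr v * 2 powr v) * K * geo (v - r) * q powr (r - 1) * lnorm u H f powr v"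
    by (simp add: mult_ac)
  also have "2 powr v * 2 powr v = (4::real) powr v" by (simp add: powr_mult[symmetric])
  finally show ?thesis .
qed

lemma weak_count_norm:
  assumes "\<And>x. 0 \<le> f x" "0 < l"
  shows "card {\<theta> \<in> D. l \<le> M f \<theta>} \<le> K * q powr (r - 1) * lnorm r H f powr r * l powr (- r)"
  using M_weak[OF assms] assms(2) r by (simp add: lnorm_powr powr_minus field_simps)

text \<open>Hoelder on a single line bounds M f by b, so no level above b occurs; below b the weak
  bound decays more slowly than l^(-v) and the levels sum to their upper end.\<close>

lemma estimate_r_high:
  assumes f: "\<And>x. 0 \<le> f x" and v: "r < v"
  shows "(\<Sum>\<theta>\<in>D. M f \<theta> powr v) \<le> 4 powr v * K * geo (v - r) * (q powr (1 - 1 / r) *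
      lnorm r H f) powr v"
proof -
  define T where "T = lnorm r H f"
  define b where "b = 2 * q powr (1 - 1 / r) * T"
  define h where "h = K * q powr (r - 1) * T powr r"
  have T0: "0 \<le> T" by (simp add: T_def lnorm_nonneg)
  have "(\<Sum>\<theta>\<in>D. M f \<theta> powr v) \<le> 2 powr v * (geo (v - r) * (\<Sum>x\<in>{()}. h * b powr (v - r)))"
  proof (rule layer_cake_bound_upper[OF D(1)])
    fix l :: real assume l: "0 < l"
    show "real (card {\<theta> \<in> D. l \<le> M f \<theta>}) \<le> (\<Sum>x\<in>{()}. if l \<le> b then h * l powr (- r) else 0)"
    proof (cases "l \<le> b")
      case True
      then show ?thesis using weak_count_norm[of f l] f l by (simp add: h_def T_def)
    next
      case False
      have "{\<theta> \<in> D. l \<le> M f \<theta>} = {}" using M_le_lnorm[of f r] f r False by (force simp: b_def T_def)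
      then show ?thesis using False by (simp only: card.empty) simp
    qed
  qed (use M_nonneg f r v K T0 in \<open>auto simp: h_def\<close>)
  also have "(\<Sum>x\<in>{()}. h * b powr (v - r)) =
      2 powr (v - r) * K * (q powr (r - 1) * q powr ((1 - 1 / r) * (v - r))) * (T powr r * T powr
          (v - r))"
    using q T0 by (simp add: h_def b_def powr_mult powr_powr)
  also have "q powr (r - 1) * q powr ((1 - 1 / r) * (v - r)) = q powr ((1 - 1 / r) * v)"
    unfolding powr_add[symmetric] using r
        by (intro arg_cong[of _ _ "(powr) q"]) (simp add: field_simps)
  also have "T powr r * T powr (v - r) = T powr v" by (simp add: powr_add[symmetric])
  also have "2 powr (v - r) * K * q powr ((1 - 1 / r) * v) * T powr v =
      2 powr (v - r) * (K * (q powr (1 - 1 / r) * T) powr v)"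
    using q T0 by (simp add: powr_mult powr_powr)
  also have "2 powr v * (geo (v - r) * (2 powr (v - r) * (K * (q powr (1 - 1 / r) * T) powr v))) \<le>
     2 powr v * (geo (v - r) * (2 powr v * (K * (q powr (1 - 1 / r) * T) powr v)))"
    using geo_pos[of "v - r"] v r K by (intro mult_left_mono mult_right_mono) auto
  also have "\<dots> = (2 powr v * 2 powr v) * K * geo (v - r) * (q powr (1 - 1 / r) * T) powr v"
    by (simp add: mult_ac)
  also have "2 powr v * 2 powr v = (4::real) powr v" by (simp add: powr_mult[symmetric])
  finally show ?thesis unfolding T_def .
qed

lemma norm_zero_imp:
  assumes f: "\<And>x. 0 \<le> f x" and p: "0 < p" and T: "lnorm p H f = 0" and \<theta>: "\<theta> \<in> D"
  shows "M f \<theta> = 0"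
proof -
  have "f x = 0" if "x \<in> H" for x using lnorm_ge[OF p H that, of f] f[of x] T by simp
  then have "sum f H = 0" by simp
  then show ?thesis using M_le_sum[of f \<theta>] M_nonneg[of f \<theta>] f \<theta> by force
qed

lemma estimate_r_low:
  assumes f: "\<And>x. 0 \<le> f x" and v: "0 < v" "v < r"
  shows "(\<Sum>\<theta>\<in>D. M f \<theta> powr v) \<le>
     2 powr v * (2 * geo v + K * geo (r - v)) * (q powr (r / v - 1 / r) * lnorm r H f) powr v"
proof (cases "lnorm r H f = 0")
  \<comment> \<open>The splitting level used in the other case must be positive.\<close>
  case True
  then have "M f \<theta> = 0" if "\<theta> \<in> D" for \<theta> using norm_zero_imp[of f r \<theta>] f r that by simp
  then show ?thesis using True by simp
next
  case False
  define T where "T = lnorm r H f"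
  \<comment> \<open>At this level the trivial count q^r of directions and the weak bound q^(r - 1)
    T^r l^(-r) agree up to constants. The former is used below it, the latter above.\<close>
  define b where "b = T * q powr (- 1 / r)"
  define h where "h = K * q powr (r - 1) * T powr r"
  have T0: "0 < T" using False lnorm_nonneg[of r H f] by (simp add: T_def)
  have b0: "0 < b" using T0 q by (simp add: b_def)
  have "(\<Sum>\<theta>\<in>D. M f \<theta> powr v) \<le> 2 powr v * (geo (v - 0) * (\<Sum>x\<in>{()}. (2 * q powr r) *
      b powr (v - 0)) +
      geo (r - v) * (\<Sum>x\<in>{()}. h * b powr (v - r)))"
  proof (rule layer_cake_bound[OF D(1)])
    fix l :: real assume l: "0 < l"
    have "real (card {\<theta> \<in> D. l \<le> M f \<theta>}) \<le> real (card D)"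
      using D by (intro of_nat_mono card_mono) auto
    then have "real (card {\<theta> \<in> D. l \<le> M f \<theta>}) \<le> 2 * q powr r" using D by linarith
    then show "real (card {\<theta> \<in> D. l \<le> M f \<theta>}) \<le> (\<Sum>x\<in>{()}. if l \<le>
        b then (2 * q powr r) * l powr (- 0) else 0)
      + (\<Sum>x\<in>{()}. if b \<le> l then h * l powr (- r) else 0)"
      using weak_count_norm[of f l] f l K by (auto simp: h_def T_def)
  qed (use M_nonneg f r v K b0 in \<open>auto simp: h_def\<close>)
  also have "(\<Sum>x\<in>{()}. (2 * q powr r) * b powr (v - 0)) = 2 * (q powr (r / v - 1 / r) * T) powr v"
  proof -
    have "q powr r * q powr (- 1 / r * v) = q powr ((r / v - 1 / r) * v)"
      unfolding powr_add[symmetric] using v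
          by (intro arg_cong[of _ _ "(powr) q"]) (simp add: field_simps)
    then show ?thesis using q T0 by (simp add: b_def powr_mult powr_powr mult_ac)
  qed
  also have "(\<Sum>x\<in>{()}. h * b powr (v - r)) = K * (q powr (r / v - 1 / r) * T) powr v"
  proof -
    have "q powr (r - 1) * q powr (- 1 / r * (v - r)) = q powr ((r / v - 1 / r) * v)"
      unfolding powr_add[symmetric] using v r
          by (intro arg_cong[of _ _ "(powr) q"]) (simp add: field_simps)
    moreover have "T powr r * T powr (v - r) = T powr v" by (simp add: powr_add[symmetric])
    moreover have "(\<Sum>x\<in>{()}. h * b powr (v - r)) =
        K * (q powr (r - 1) * q powr (- 1 / r * (v - r))) * (T powr r * T powr (v - r))"
      using q T0 by (simp add: h_def b_def powr_mult powr_powr)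
    ultimately show ?thesis using q T0 by (simp add: powr_mult powr_powr)
  qed
  finally show ?thesis unfolding T_def by (simp add: algebra_simps)
qed

text \<open>For v = r the weak bound gives each level the same contribution K A. Levels below b are
  still summed geometrically through the number of directions, and no level exceeds 2 q b, so only
  O(1 + log q) of them count in full.\<close>

lemma estimate_critical:
  assumes f: "\<And>x. 0 \<le> f x"
  shows "(\<Sum>\<theta>\<in>D. M f \<theta> powr r) \<le>
     2 powr r * (2 * geo r + 4 * K) * (1 + ln q) * (q powr (1 - 1 / r) * lnorm r H f) powr r"
proof (cases "lnorm r H f = 0")
  case True
  then have "M f \<theta> = 0" if "\<theta> \<in> D" for \<theta> using norm_zero_imp[of f r \<theta>] f r that by simp
  then show ?thesis using True by simp
next
  case False
  define T where "T = lnorm r H f"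
  define b where "b = T * q powr (- 1 / r)"
  define A where "A = (q powr (1 - 1 / r) * T) powr r"
  have T0: "0 < T" using False lnorm_nonneg[of r H f] by (simp add: T_def)
  have b0: "0 < b" using T0 q by (simp add: b_def)
  have A0: "0 < A" using T0 q by (simp add: A_def)
  have A1: "q powr (r - 1) * T powr r = A"
    using q T0 r by (simp add: A_def powr_mult powr_powr algebra_simps)
  have A2: "q powr r * b powr r = A"
  proof -
    have "b powr r = T powr r * q powr (- 1)" using q T0 r by (simp add: b_def powr_mult powr_powr)
    then have "q powr r * b powr r = (q powr r * q powr (- 1)) * T powr r" by (simp only: mult_ac)
    then show ?thesis unfolding powr_add[symmetric] using A1 by simp
  qed
  have lnq: "0 < ln q" using q by simp
  obtain Z :: "int set" where Z: "finite Z" "\<forall>k\<in>Z. \<exists>\<theta>\<in>D. pow2 k \<le> M f \<theta>"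
    and le: "(\<Sum>\<theta>\<in>D. M f \<theta> powr r) \<le>
       2 powr r * (\<Sum>k\<in>Z. 2 powr (real_of_int k * r) * card {\<theta> \<in> D. pow2 k \<le> M f \<theta>})"
    using r M_nonneg f by (rule_tac dyadic_decomposition[OF D(1), of "M f" r]) auto
  let ?N = "\<lambda>k::int. 2 powr (real_of_int k * r) * card {\<theta> \<in> D. pow2 k \<le> M f \<theta>}"
  define Z1 where "Z1 = {k \<in> Z. pow2 k \<le> b}"
  define Z2 where "Z2 = {k \<in> Z. \<not> pow2 k \<le> b}"
  have "sum ?N Z = sum ?N Z1 + sum ?N Z2"
    unfolding Z1_def Z2_def using Z(1)
        by (subst sum.union_disjoint[symmetric]) (auto intro!: sum.cong)
  moreover have "sum ?N Z1 \<le> 2 * geo r * A"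
  proof -
    have "sum ?N Z1 \<le> (\<Sum>k\<in>Z1. 2 powr (real_of_int k * r) * (2 * q powr r))"
    proof (intro sum_mono mult_left_mono)
      fix k
      have "real (card {\<theta> \<in> D. pow2 k \<le> M f \<theta>}) \<le> real (card D)"
        using D by (intro of_nat_mono card_mono) auto
      then show "real (card {\<theta> \<in> D. pow2 k \<le> M f \<theta>}) \<le> 2 * q powr r" using D by linarith
    qed auto
    also have "\<dots> = (\<Sum>k\<in>Z1. 2 powr (real_of_int k * r)) * (2 * q powr r)"
        by (simp add: sum_distrib_right)
    also have "\<dots> \<le> (geo r * b powr r) * (2 * q powr r)"
      using Z r by (intro mult_right_mono dyadic_sum_le_upper) (auto simp: Z1_def)
    also have "\<dots> = 2 * geo r * A" using A2 by (simp add: mult_ac)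
    finally show ?thesis .
  qed
  moreover have "sum ?N Z2 \<le> 4 * K * (1 + ln q) * A"
  proof -
    have "?N k \<le> K * A" for k
    proof -
      have "?N k \<le> 2 powr (real_of_int k * r) * (K * q powr (r - 1) * lnorm r H f powr r *
          pow2 k powr (- r))"
        using f by (intro mult_left_mono weak_count_norm) auto
      also have "\<dots> = K * A * (2 powr (real_of_int k * r) * pow2 k powr (- r))"
        using A1 by (simp add: T_def mult_ac)
      also have "2 powr (real_of_int k * r) * pow2 k powr (- r) = 1"
        by (simp add: powr_powr powr_add[symmetric])
      finally show ?thesis by simp
    qed
    then have "sum ?N Z2 \<le> card Z2 * (K * A)"
      using sum_mono[of Z2 ?N "\<lambda>_. K * A"] by simp
    also have "real (card Z2) \<le> 4 * (1 + ln q)"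
    proof -
      \<comment> \<open>Levels in \<open>Z2\<close> lie above b and are attained, hence at most 2 q
        b. With ln 2 \<ge> 1/2 the length of this range is at most 3 + 2 ln q, which 4 (1 + ln q)
        absorbs.\<close>
      have sub: "Z2 \<subseteq> {\<lfloor>log 2 b\<rfloor>..\<lfloor>log 2 (2 * q * b)\<rfloor>}"
      proof
        fix k assume k: "k \<in> Z2"
        then obtain \<theta> where \<theta>: "\<theta> \<in> D" "pow2 k \<le> M f \<theta>" using Z by (auto simp: Z2_def)
        have "pow2 k \<le> 2 * q powr (1 - 1 / r) * T"
          using \<theta> M_le_lnorm[of f r \<theta>] f r by (simp add: T_def)
        also have "\<dots> = 2 * q * b" using q
            by (simp add: b_def powr_diff powr_minus divide_inverse mult_ac)
        finally have "real_of_int k \<le> log 2 (2 * q * b)" using b0 q by (subst le_log_iff) auto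
        moreover have "log 2 b < real_of_int k" using k b0
            by (subst log_less_iff) (auto simp: Z2_def)
        ultimately show "k \<in> {\<lfloor>log 2 b\<rfloor>..\<lfloor>log 2 (2 * q * b)\<rfloor>}"
          by (auto simp: le_floor_iff) linarith
      qed
      have "log 2 (2 * q * b) = 1 + ln q / ln 2 + log 2 b"
        using b0 q by (simp add: log_mult) (simp add: log_def)
      moreover have "ln q / ln 2 \<le> 2 * ln q"
      proof -
        have "1 / 2 \<le> ln (2::real)" using ln_le_minus_one[of "1 / 2 :: real"] by (simp add: ln_div)
        then show ?thesis using lnq by (simp add: field_simps)
      qed
      ultimately have "log 2 (2 * q * b) \<le> 1 + 2 * ln q + log 2 b" by linarith
      then have "real_of_int (\<lfloor>log 2 (2 * q * b)\<rfloor> - \<lfloor>log 2 b\<rfloor> + 1) \<le> 4 * (1 + ln q)"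
        using lnq of_int_floor_le[of "log 2 (2 * q * b)"] real_of_int_floor_add_one_gt[of "log 2 b"]
        unfolding of_int_add of_int_diff of_int_1 by argo
      moreover have "real (card Z2) \<le> real (card {\<lfloor>log 2 b\<rfloor>..\<lfloor>log 2 (2 * q * b)\<rfloor>})"
        by (intro of_nat_mono card_mono sub) auto
      moreover have "real (nat y) \<le> max 0 (real_of_int y)" for y by simp
      ultimately show ?thesis using lnq by (smt (verit) card_atLeastAtMost_int)
    qed
    finally show ?thesis using K A0 by (simp add: mult_ac)
  qed
  ultimately have "sum ?N Z \<le> 2 * geo r * A + 4 * K * (1 + ln q) * A" by linarith
  also have "\<dots> \<le> 2 * geo r * (1 + ln q) * A + 4 * K * (1 + ln q) * A"
    using A0 lnq geo_pos[of r] r by (intro add_right_mono mult_right_mono) auto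
  also have "\<dots> = (2 * geo r + 4 * K) * (1 + ln q) * A" by (simp add: algebra_simps)
  finally have "2 powr r * sum ?N Z \<le> 2 powr r * ((2 * geo r + 4 * K) * (1 + ln q) * A)"
    by (intro mult_left_mono) auto
  from order_trans[OF le this] show ?thesis by (simp only: A_def T_def mult.assoc)
qed

end

section \<open>Strong type bounds that are uniform over a family of operators\<close>

locale maximal_family =
  fixes r K :: real and I :: "'i set" and q :: "'i \<Rightarrow> real" and D :: "'i \<Rightarrow> 'd set"
      and H :: "'i \<Rightarrow> 'x set"
    and M :: "'i \<Rightarrow> ('x \<Rightarrow> real) \<Rightarrow> 'd \<Rightarrow> real"
  assumes member: "\<And>i. i \<in> I \<Longrightarrow> weak_type_maximal r K (q i) (D i) (H i) (M i)"
    and r2: "2 \<le> r"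
begin

abbreviation bounded_by :: "real \<Rightarrow> real \<Rightarrow> real \<Rightarrow> real \<Rightarrow> bool" where
  "bounded_by C u v e \<equiv> \<forall>i\<in>I. \<forall>f. (\<forall>x. 0 \<le> f x) \<longrightarrow>
     lnorm v (D i) (M i f) \<le> C * (q i powr e * lnorm u (H i) f)"

text \<open>The number e is the power of q that is lost. The constant is chosen before the member of
  the family, which is the uniformity over all fields.\<close>

definition strong_type :: "real \<Rightarrow> real \<Rightarrow> real \<Rightarrow> bool" where
  "strong_type u v e \<longleftrightarrow> (\<exists>C\<ge>0. bounded_by C u v e)"

lemma strong_typeI:
  assumes "0 < v" "0 \<le> C" "\<And>i f. i \<in> I \<Longrightarrow> (\<And>x. 0 \<le> f x) \<Longrightarrow>
     (\<Sum>\<theta>\<in>D i. M i f \<theta> powr v) \<le> C * (q i powr e * lnorm u (H i) f) powr v"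
  shows "strong_type u v e"
proof -
  have "lnorm v (D i) (M i f) \<le> C powr (1 / v) * (q i powr e * lnorm u (H i) f)"
    if "i \<in> I" "\<And>x. 0 \<le> f x" for i f
    using assms that lnorm_nonneg[of u "H i" f] by (intro lnorm_le) auto
  then show ?thesis unfolding strong_type_def by (intro exI[of _ "C powr (1 / v)"]) auto
qed

lemma strong_typeE:
  assumes "strong_type u v e"
  obtains C where "0 \<le> C" "bounded_by C u v e"
  using assms unfolding strong_type_def by blast

lemma q_gt_1: "i \<in> I \<Longrightarrow> 1 < q i" using weak_type_maximal.q[OF member] .
lemma finite_D: "i \<in> I \<Longrightarrow> finite (D i)" using weak_type_maximal.D(1)[OF member] .
lemma finite_H: "i \<in> I \<Longrightarrow> finite (H i)" using weak_type_maximal.H[OF member] .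
lemma M_nonneg: "i \<in> I \<Longrightarrow> (\<And>x. 0 \<le> f x) \<Longrightarrow> \<theta> \<in> D i \<Longrightarrow> 0 \<le> M i f \<theta>"
  using weak_type_maximal.M_nonneg[OF member] .

lemma strong_type_diag_high:
  assumes u: "r < u"
  shows "strong_type u u (1 - 1 / u)"
proof (rule strong_typeI)
  fix i and f :: "'x \<Rightarrow> real" assume i: "i \<in> I" and f: "\<And>x. 0 \<le> f x"
  have "(q i powr (1 - 1 / u) * lnorm u (H i) f) powr u = q i powr (u - 1) * (\<Sum>x\<in>H i. f x powr u)"
    using u r2 q_gt_1[OF i] lnorm_nonneg[of u "H i" f]
    by (simp add: powr_mult powr_powr lnorm_powr algebra_simps)
  \<comment> \<open>The sign of K is known only through a member of the family, whereas the common
    constant has to be nonnegative beforehand; hence the maximum with 0.\<close>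
  moreover have "4 powr u * K * geo (u - r) \<le> max 0 (4 powr u * K * geo (u - r))" by simp
  ultimately show "(\<Sum>\<theta>\<in>D i. M i f \<theta> powr u) \<le>
      max 0 (4 powr u * K * geo (u - r)) * (q i powr (1 - 1 / u) * lnorm u (H i) f) powr u"
    using weak_type_maximal.estimate_diag_high[of r K "q i" "D i" "H i"
        "M i" f u, OF member[OF i] f u]
    by (smt (verit) mult.assoc mult_right_mono powr_ge_zero)
qed (use u r2 in auto)

text \<open>At u = 1 the interpolation constant \<open>geo (u - 1)\<close> breaks down and the
  strong bound on \<ell>^1 takes its place.\<close>

lemma strong_type_diag_low:
  assumes u: "1 \<le> u" "u < r"
  shows "strong_type u u ((r - 1) / u)"
proof -
  define C where "C = (if u = 1 then 2 else 2 powr u * (4 * geo (u - 1) + K * 2 powr r *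
      geo (r - u)))"
  show ?thesis
  proof (rule strong_typeI)
    fix i and f :: "'x \<Rightarrow> real" assume i: "i \<in> I" and f: "\<And>x. 0 \<le> f x"
    have "(q i powr ((r - 1) / u) * lnorm u (H i) f) powr u =
        q i powr (r - 1) * (\<Sum>x\<in>H i. f x powr u)"
      using u q_gt_1[OF i] lnorm_nonneg[of u "H i" f] by (simp add: powr_mult powr_powr lnorm_powr)
    moreover have "(\<Sum>\<theta>\<in>D i. M i f \<theta> powr u) \<le> C * (q i powr (r - 1) * (\<Sum>x\<in>H i. f x powr u))"
    proof (cases "u = 1")
      case True
      have "(\<Sum>\<theta>\<in>D i. M i f \<theta> powr 1) = (\<Sum>\<theta>\<in>D i. M i f \<theta>)"
        using M_nonneg[OF i f] by (intro sum.cong) auto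
      moreover have "(\<Sum>x\<in>H i. f x powr 1) = sum f (H i)" using f by simp
      ultimately show ?thesis
        using weak_type_maximal.M_strong_1[of r K "q i" "D i" "H i"
            "M i" f, OF member[OF i] f] True by (simp add: C_def)
    next
      case False
      then show ?thesis
        using weak_type_maximal.estimate_diag_low[of r K "q i" "D i" "H i"
            "M i" f u, OF member[OF i] f] u
        by (simp add: C_def mult.assoc)
    qed
    moreover have "C \<le> max 0 C" by simp
    ultimately show "(\<Sum>\<theta>\<in>D i. M i f \<theta> powr u) \<le>
        max 0 C * (q i powr ((r - 1) / u) * lnorm u (H i) f) powr u"
      by (smt (verit) mult_right_mono powr_ge_zero)
  qed (use u in auto)
qed

lemma strong_type_edge:
  assumes v: "r < v" and u: "u = v / (v - r + 1)"
  shows "strong_type u v ((r - 1) / v)"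
proof (rule strong_typeI)
  fix i and f :: "'x \<Rightarrow> real" assume i: "i \<in> I" and f: "\<And>x. 0 \<le> f x"
  have "(q i powr ((r - 1) / v) * lnorm u (H i) f) powr v =
      q i powr (r - 1) * lnorm u (H i) f powr v"
    using v r2 q_gt_1[OF i] lnorm_nonneg[of u "H i" f] by (simp add: powr_mult powr_powr)
  moreover have "4 powr v * K * geo (v - r) \<le> max 0 (4 powr v * K * geo (v - r))" by simp
  ultimately show "(\<Sum>\<theta>\<in>D i. M i f \<theta> powr v) \<le>
      max 0 (4 powr v * K * geo (v - r)) * (q i powr ((r - 1) / v) * lnorm u (H i) f) powr v"
    using weak_type_maximal.estimate_edge[of r K "q i" "D i" "H i"
        "M i" f v u, OF member[OF i] f v u]
    by (smt (verit) mult.assoc mult_right_mono powr_ge_zero)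
qed (use v r2 in auto)

lemma strong_type_r_high:
  assumes v: "r < v"
  shows "strong_type r v (1 - 1 / r)"
proof (rule strong_typeI)
  fix i and f :: "'x \<Rightarrow> real" assume i: "i \<in> I" and f: "\<And>x. 0 \<le> f x"
  have "4 powr v * K * geo (v - r) \<le> max 0 (4 powr v * K * geo (v - r))" by simp
  then show "(\<Sum>\<theta>\<in>D i. M i f \<theta> powr v) \<le>
      max 0 (4 powr v * K * geo (v - r)) * (q i powr (1 - 1 / r) * lnorm r (H i) f) powr v"
    using weak_type_maximal.estimate_r_high[of r K "q i" "D i" "H i" "M i" f v, OF member[OF i] f v]
    by (smt (verit) mult_right_mono powr_ge_zero)
qed (use v r2 in auto)

lemma strong_type_r_low:
  assumes v: "0 < v" "v < r"
  shows "strong_type r v (r / v - 1 / r)"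
proof (rule strong_typeI)
  let ?C = "2 powr v * (2 * geo v + K * geo (r - v))"
  fix i and f :: "'x \<Rightarrow> real" assume i: "i \<in> I" and f: "\<And>x. 0 \<le> f x"
  have "?C \<le> max 0 ?C" by simp
  then show "(\<Sum>\<theta>\<in>D i. M i f \<theta> powr v) \<le>
      max 0 ?C * (q i powr (r / v - 1 / r) * lnorm r (H i) f) powr v"
    using weak_type_maximal.estimate_r_low[of r K "q i" "D i" "H i" "M i" f v, OF member[OF i] f v]
    by (smt (verit) mult_right_mono powr_ge_zero)
qed (use v r2 in auto)

text \<open>Counting norms decrease in their exponent, so lowering u enlarges the right side:
  estimates pass to larger \<alpha> at the same power of q. By the same fact on the left side,
  \<open>strong_type_output\<close> passes to smaller \<beta>.\<close>

lemma strong_type_input: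
  assumes "strong_type u v e" "0 < u'" "u' \<le> u"
  shows "strong_type u' v e"
proof -
  obtain C where C: "0 \<le> C" "bounded_by C u v e"
    by (rule strong_typeE[OF assms(1)])
  have "lnorm v (D i) (M i f) \<le> C * (q i powr e * lnorm u' (H i) f)" if i: "i \<in> I"
      and f: "\<forall>x. 0 \<le> f x" for i f
  proof -
    have "lnorm v (D i) (M i f) \<le> C * (q i powr e * lnorm u (H i) f)" using C(2) i f by blast
    also have "\<dots> \<le> C * (q i powr e * lnorm u' (H i) f)"
      using C(1) assms f finite_H[OF i] by (intro mult_left_mono lnorm_antimono) auto
    finally show ?thesis .
  qed
  then show ?thesis unfolding strong_type_def using C(1) by blast
qed

lemma strong_type_output:
  assumes "strong_type u v e" "0 < v" "v \<le> v'"
  shows "strong_type u v' e"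
proof -
  obtain C where C: "0 \<le> C" "bounded_by C u v e"
    by (rule strong_typeE[OF assms(1)])
  have "lnorm v' (D i) (M i f) \<le> C * (q i powr e * lnorm u (H i) f)" if i: "i \<in> I"
      and f: "\<forall>x. 0 \<le> f x" for i f
  proof -
    have "lnorm v' (D i) (M i f) \<le> lnorm v (D i) (M i f)"
      using assms M_nonneg[OF i] f finite_D[OF i] by (intro lnorm_antimono) auto
    also have "\<dots> \<le> C * (q i powr e * lnorm u (H i) f)" using C(2) i f by blast
    finally show ?thesis .
  qed
  then show ?thesis unfolding strong_type_def using C(1) by blast
qed

text \<open>Hoelder on the set of at most 2 q^r directions. The price is the term r (\<beta> -
  \<alpha>) that \<open>crit\<close> shows above the diagonal.\<close>

lemma strong_type_holder:
  assumes "strong_type u s e" "0 < v" "v \<le> s"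
  shows "strong_type u v (e + r * (1 / v - 1 / s))"
proof -
  obtain C where C: "0 \<le> C" "bounded_by C u s e"
    by (rule strong_typeE[OF assms(1)])
  let ?d = "1 / v - 1 / s"
  show ?thesis
  proof (rule strong_typeI[OF assms(2), of "2 * (2 powr ?d * C) powr v"])
    fix i and f :: "'x \<Rightarrow> real" assume i: "i \<in> I" and f: "\<And>x. 0 \<le> f x"
    have q: "0 < q i" using q_gt_1[OF i] by simp
    have "(\<Sum>\<theta>\<in>D i. M i f \<theta> powr v) \<le> 2 * ((2 * q i powr r) powr ?d * lnorm s (D i) (M i f)) powr v"
      using assms M_nonneg[OF i] f weak_type_maximal.D[OF member[OF i]] q
          by (intro lnorm_powr_mean) auto
    also have "\<dots> \<le> 2 * ((2 * q i powr r) powr ?d * (C * (q i powr e * lnorm u (H i) f))) powr v"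
      using C(2) i f assms by (intro mult_left_mono powr_mono2 mult_nonneg_nonneg lnorm_nonneg) auto
    also have "(2 * q i powr r) powr ?d * (C * (q i powr e * lnorm u (H i) f)) =
        (2 powr ?d * C) * (q i powr (e + r * ?d) * lnorm u (H i) f)"
      using q by (simp add: powr_mult powr_powr powr_add mult_ac)
    also have "2 * \<dots> powr v = 2 * (2 powr ?d * C) powr v * (q i powr (e + r * ?d) *
        lnorm u (H i) f) powr v"
      using C(1) lnorm_nonneg[of u "H i" f] by (simp add: powr_mult)
    finally show "(\<Sum>\<theta>\<in>D i. M i f \<theta> powr v) \<le>
      2 * (2 powr ?d * C) powr v * (q i powr (e + r * ?d) * lnorm u (H i) f) powr v" .
  qed simp
qed

text \<open>With u fixed, g^v is bounded pointwise by g^a T^(v - a) if g \<le> T and by g^b T^(v -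
  b) otherwise, T being the norm of f. The exponent (r - 1) / v makes the power of q equal to r - 1
  in all three sums. This reaches \<beta> = 1/r without a logarithm.\<close>

lemma strong_type_between:
  assumes "strong_type u a ((r - 1) / a)" "strong_type u b ((r - 1) / b)"
      and ab: "0 < a" "a < v" "v < b"
  shows "strong_type u v ((r - 1) / v)"
proof -
  obtain C where C: "0 \<le> C" "bounded_by C u a ((r - 1) / a)"
    by (rule strong_typeE[OF assms(1)])
  obtain B where B: "0 \<le> B" "bounded_by B u b ((r - 1) / b)"
    by (rule strong_typeE[OF assms(2)])
  show ?thesis
  proof (rule strong_typeI[of v "C powr a + B powr b"])
    fix i and f :: "'x \<Rightarrow> real" assume i: "i \<in> I" and f: "\<And>x. 0 \<le> f x"
    have q: "0 < q i" using q_gt_1[OF i] by simp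
    define T where "T = lnorm u (H i) f"
    define g where "g = M i f"
    have T0: "0 \<le> T" by (simp add: T_def lnorm_nonneg)
    have g0: "0 \<le> g \<theta>" if "\<theta> \<in> D i" for \<theta> using M_nonneg[OF i f that] by (simp add: g_def)
    have bound: "(\<Sum>\<theta>\<in>D i. g \<theta> powr c) * T powr (v - c) \<le> A powr c * (q i powr (r - 1) * T powr v)"
      if c: "0 < c" and A: "0 \<le> A" "lnorm c (D i) g \<le> A * (q i powr ((r - 1) / c) * T)" for c A
    proof -
      have "(\<Sum>\<theta>\<in>D i. g \<theta> powr c) = lnorm c (D i) g powr c" using c by (simp add: lnorm_powr)
      also have "\<dots> \<le> (A * (q i powr ((r - 1) / c) * T)) powr c"
        using A c lnorm_nonneg by (intro powr_mono2) auto
      also have "\<dots> = A powr c * (q i powr (r - 1) * T powr c)"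
        using A T0 q c by (simp add: powr_mult powr_powr)
      finally have "(\<Sum>\<theta>\<in>D i. g \<theta> powr c) * T powr (v - c) \<le>
          A powr c * (q i powr (r - 1) * T powr c) * T powr (v - c)"
        by (intro mult_right_mono) auto
      also have "\<dots> = A powr c * (q i powr (r - 1) * (T powr c * T powr (v - c)))"
          by (simp only: mult.assoc)
      also have "T powr c * T powr (v - c) = T powr v" by (simp add: powr_add[symmetric])
      finally show ?thesis .
    qed
    have A1: "lnorm a (D i) g \<le> C * (q i powr ((r - 1) / a) * T)"
      and B1: "lnorm b (D i) g \<le> B * (q i powr ((r - 1) / b) * T)"
      using B(2) C(2) i f unfolding T_def g_def by blast+
    have "(\<Sum>\<theta>\<in>D i. g \<theta> powr v) \<le> (\<Sum>\<theta>\<in>D i. g \<theta> powr a * T powr (v - a) + g \<theta> powr b *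
        T powr (v - b))"
    proof (intro sum_mono)
      fix \<theta> assume \<theta>: "\<theta> \<in> D i"
      show "g \<theta> powr v \<le> g \<theta> powr a * T powr (v - a) + g \<theta> powr b * T powr (v - b)"
      proof (cases "g \<theta> \<le> T")
        case True
        have "g \<theta> powr v = g \<theta> powr a * g \<theta> powr (v - a)" by (simp add: powr_add[symmetric])
        also have "\<dots> \<le> g \<theta> powr a * T powr (v - a)"
          using True ab g0[OF \<theta>] by (intro mult_left_mono powr_mono2) auto
        finally show ?thesis by (smt (verit) mult_nonneg_nonneg powr_ge_zero)
      next
        case False
        have "T \<noteq> 0"
        proof
          assume "T = 0"
          then have "g \<theta> \<le> 0" using lnorm_ge[of a "D i" \<theta> g] A1 g0[OF \<theta>] \<theta> ab finite_D[OF i] by simp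
          then show False using False \<open>T = 0\<close> by simp
        qed
        have "g \<theta> powr v = g \<theta> powr b * g \<theta> powr (v - b)" by (simp add: powr_add[symmetric])
        also have "\<dots> \<le> g \<theta> powr b * T powr (v - b)"
          using False ab T0 \<open>T \<noteq> 0\<close> by (intro mult_left_mono powr_mono2') auto
        finally show ?thesis by (smt (verit) mult_nonneg_nonneg powr_ge_zero)
      qed
    qed
    also have "\<dots> = (\<Sum>\<theta>\<in>D i. g \<theta> powr a) * T powr (v - a) + (\<Sum>\<theta>\<in>D i. g \<theta> powr b) * T powr (v - b)"
      by (simp add: sum.distrib sum_distrib_right)
    also have "\<dots> \<le> C powr a * (q i powr (r - 1) * T powr v) + B powr b * (q i powr (r - 1) *
        T powr v)"
      using A1 B1 ab B(1) C(1) by (intro add_mono bound) auto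
    also have "\<dots> = (C powr a + B powr b) * (q i powr ((r - 1) / v) * T) powr v"
      using T0 q ab by (simp add: powr_mult powr_powr distrib_right mult.assoc)
    finally show "(\<Sum>\<theta>\<in>D i. M i f \<theta> powr v) \<le> (C powr a + B powr b) * (q i powr ((r - 1) / v) *
        lnorm u (H i) f) powr v"
      unfolding T_def g_def .
  qed (use ab in auto)
qed

definition crit :: "real \<Rightarrow> real \<Rightarrow> real" where
  "crit \<alpha> \<beta> = max (max ((r - 1) * \<beta>) (1 - \<alpha>)) (max (r * \<beta> - \<alpha>) (1 + r * \<beta> - (r + 1) * \<alpha>))"

lemma crit_cases:
  assumes "0 < \<alpha>" "0 < \<beta>"
  shows "\<alpha> \<le> \<beta> \<Longrightarrow> \<alpha> \<le> 1 / r \<Longrightarrow> crit \<alpha> \<beta> = 1 - \<alpha> + r * (\<beta> - \<alpha>)"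
    "\<alpha> \<le> \<beta> \<Longrightarrow> 1 / r \<le> \<alpha> \<Longrightarrow> crit \<alpha> \<beta> = (r - 1) * \<alpha> + r * (\<beta> - \<alpha>)"
    "\<beta> \<le> \<alpha> \<Longrightarrow> 1 - \<alpha> \<le> (r - 1) * \<beta> \<Longrightarrow> crit \<alpha> \<beta> = (r - 1) * \<beta>"
    "\<beta> \<le> \<alpha> \<Longrightarrow> (r - 1) * \<beta> \<le> 1 - \<alpha> \<Longrightarrow> crit \<alpha> \<beta> = 1 - \<alpha>"
proof -
  have r0: "0 < r" using r2 by simp
  have ab: "r * \<alpha> \<le> r * \<beta>" if "\<alpha> \<le> \<beta>" using that r0 by simp
  have ba: "r * \<beta> \<le> r * \<alpha>" if "\<beta> \<le> \<alpha>" using that r0 by simp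
  have le: "r * \<alpha> \<le> 1" if "\<alpha> \<le> 1 / r" using that r0 by (simp add: field_simps)
  have ge: "1 \<le> r * \<alpha>" if "1 / r \<le> \<alpha>" using that r0 by (simp add: field_simps)
  show "\<alpha> \<le> \<beta> \<Longrightarrow> \<alpha> \<le> 1 / r \<Longrightarrow> crit \<alpha> \<beta> = 1 - \<alpha> + r * (\<beta> - \<alpha>)"
    using ab le unfolding crit_def by (simp add: algebra_simps max_def)
  show "\<alpha> \<le> \<beta> \<Longrightarrow> 1 / r \<le> \<alpha> \<Longrightarrow> crit \<alpha> \<beta> = (r - 1) * \<alpha> + r * (\<beta> - \<alpha>)"
    using ab ge unfolding crit_def by (simp add: algebra_simps max_def)
  show "\<beta> \<le> \<alpha> \<Longrightarrow> 1 - \<alpha> \<le> (r - 1) * \<beta> \<Longrightarrow> crit \<alpha> \<beta> = (r - 1) * \<beta>"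
    using ba unfolding crit_def left_diff_distrib distrib_right mult_1_left by linarith
  show "\<beta> \<le> \<alpha> \<Longrightarrow> (r - 1) * \<beta> \<le> 1 - \<alpha> \<Longrightarrow> crit \<alpha> \<beta> = 1 - \<alpha>"
    using ba unfolding crit_def by (simp add: algebra_simps max_def)
qed

text \<open>Above the diagonal the bound at (\<alpha>, \<alpha>) is extended by Hoelder. Below it,
  monotonicity carries over a bound from (\<beta>, \<beta>), from the edge 1 - \<alpha> = (r - 1)
  \<beta>, or from a point with the same \<alpha> and larger \<beta>. The lines through (1/r, 1/r)
  have no such neighbour: \<alpha> = 1/r comes straight from the weak bound, \<beta> = 1/r from
  \<open>strong_type_between\<close>.\<close>

theorem strong_type_crit:
  assumes \<alpha>: "0 < \<alpha>" "\<alpha> \<le> 1" and \<beta>: "0 < \<beta>" "\<beta> \<le> 1" and ne: "(\<alpha>, \<beta>) \<noteq> (1 / r, 1 / r)"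
  shows "strong_type (1 / \<alpha>) (1 / \<beta>) (crit \<alpha> \<beta>)"
proof -
  have r0: "0 < r" using r2 by simp
  have inv_r: "1 / \<gamma> < r \<longleftrightarrow> 1 / r < \<gamma>" "r < 1 / \<gamma> \<longleftrightarrow> \<gamma> < 1 / r" if "0 < \<gamma>" for \<gamma>
    using that r0 by (auto simp: field_simps)
  have high: "strong_type (1 / \<gamma>) (1 / \<gamma>) (1 - \<gamma>)" if "0 < \<gamma>" "\<gamma> < 1 / r" for \<gamma>
    using strong_type_diag_high[of "1 / \<gamma>"] inv_r(2)[of \<gamma>] that by simp
  have low: "strong_type (1 / \<gamma>) (1 / \<gamma>) ((r - 1) * \<gamma>)" if "1 / r < \<gamma>" "\<gamma> \<le> 1" for \<gamma>
  proof -
    have "0 < \<gamma>" using that r0 by (meson less_trans zero_less_divide_1_iff)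
    then show ?thesis using strong_type_diag_low[of "1 / \<gamma>"] inv_r(1)[of \<gamma>] that by simp
  qed
  have edge: "strong_type (1 / (1 - (r - 1) * \<gamma>)) (1 / \<gamma>) ((r - 1) * \<gamma>)" if "0 < \<gamma>" "\<gamma> < 1 / r"
      for \<gamma>
  proof -
    have "1 / (1 - (r - 1) * \<gamma>) = (1 / \<gamma>) / (1 / \<gamma> - r + 1)"
      using that by (simp add: field_simps)
    then show ?thesis using strong_type_edge[of "1 / \<gamma>"] inv_r(2)[of \<gamma>] that by simp
  qed
  have edge_low: "strong_type (1 / \<alpha>) (1 / \<gamma>) ((r - 1) * \<gamma>)"
    if "0 < \<gamma>" "\<gamma> < 1 / r" "1 - \<alpha> \<le> (r - 1) * \<gamma>" for \<gamma>
  proof (rule strong_type_input[OF edge[OF that(1,2)]])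
    have "r * \<gamma> < 1" using that r0 by (simp add: field_simps)
    then have "0 < 1 - (r - 1) * \<gamma>" using that by (simp add: algebra_simps)
    then show "1 / \<alpha> \<le> 1 / (1 - (r - 1) * \<gamma>)" using that \<alpha>
        by (intro divide_left_mono mult_pos_pos) auto
  qed (use \<alpha> in auto)
  consider "\<alpha> \<le> \<beta>" "\<alpha> < 1 / r" | "\<alpha> \<le> \<beta>" "1 / r < \<alpha>" | "\<alpha> < \<beta>" "\<alpha> = 1 / r"
    | "\<beta> < \<alpha>" "1 / r < \<beta>" | "\<beta> < \<alpha>" "\<beta> = 1 / r" | "\<beta> < \<alpha>" "\<beta> < 1 / r" "1 - \<alpha> \<le> (r - 1) * \<beta>"
    | "\<beta> < \<alpha>" "\<beta> < 1 / r" "(r - 1) * \<beta> < 1 - \<alpha>"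
    using ne by (cases \<alpha> \<beta> rule: linorder_cases; cases \<alpha> "1 / r" rule: linorder_cases;
      cases \<beta> "1 / r" rule: linorder_cases; cases "1 - \<alpha> \<le> (r - 1) * \<beta>") auto
  then show ?thesis
  proof cases
    case 1
    then show ?thesis
      using strong_type_holder[OF high[OF \<alpha>(1)], of "1 / \<beta>"] \<alpha> \<beta> crit_cases(1)[OF \<alpha>(1) \<beta>(1)]
      by (simp add: frac_le)
  next
    case 2
    then show ?thesis
      using strong_type_holder[OF low[of \<alpha>], of "1 / \<beta>"] \<alpha> \<beta> crit_cases(2)[OF \<alpha>(1) \<beta>(1)]
      by (simp add: frac_le)
  next
    case 3
    have "strong_type r (1 / \<beta>) (r / (1 / \<beta>) - 1 / r)"
      using 3 \<beta> inv_r(1)[of \<beta>] by (intro strong_type_r_low) auto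
    moreover have "crit \<alpha> \<beta> = r * \<beta> - 1 / r"
    proof -
      have "crit \<alpha> \<beta> = (r - 1) * \<alpha> + r * (\<beta> - \<alpha>)" using 3 crit_cases(2)[OF \<alpha>(1) \<beta>(1)] by simp
      also have "\<dots> = r * \<beta> - \<alpha>" by (simp add: algebra_simps)
      finally show ?thesis using 3 by simp
    qed
    ultimately show ?thesis using 3 by simp
  next
    case 4
    have "strong_type (1 / \<alpha>) (1 / \<beta>) ((r - 1) * \<beta>)"
      using 4 \<alpha> \<beta> by (intro strong_type_input[OF low]) (auto simp: frac_le)
    moreover have "1 - \<alpha> \<le> (r - 1) * \<beta>"
    proof -
      have "1 < r * \<beta>" using 4 r0 by (simp add: field_simps)
      then show ?thesis using 4 by (simp add: algebra_simps)
    qed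
    ultimately show ?thesis using 4 crit_cases(3)[OF \<alpha>(1) \<beta>(1)] by simp
  next
    case 5
    have ra: "1 < r * \<alpha>" using 5 r0 by (simp add: field_simps)
    \<comment> \<open>The point (\<alpha>, \<gamma>) lies on the edge. For \<alpha> = 1 the edge
      would give \<gamma> = 0, an infinite exponent, so a positive value below 1/r is used.\<close>
    define \<gamma> where "\<gamma> = (if \<alpha> = 1 then 1 / (2 * r) else (1 - \<alpha>) / (r - 1))"
    have \<gamma>: "0 < \<gamma>" "\<gamma> < 1 / r" "1 - \<alpha> \<le> (r - 1) * \<gamma>"
      using r2 \<alpha> ra by (auto simp: \<gamma>_def field_simps)
    have "strong_type (1 / \<alpha>) r ((r - 1) / r)"
    proof (rule strong_type_between)
      show "strong_type (1 / \<alpha>) (1 / \<alpha>) ((r - 1) / (1 / \<alpha>))" using low[of \<alpha>] 5 \<alpha> by simp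
      show "strong_type (1 / \<alpha>) (1 / \<gamma>) ((r - 1) / (1 / \<gamma>))" using edge_low[OF \<gamma>] by simp
    qed (use 5 \<alpha> \<gamma> inv_r[of \<alpha>] inv_r[of \<gamma>] in auto)
    moreover have "crit \<alpha> \<beta> = (r - 1) / r"
    proof -
      have "(r - 1) * (1 / r) = 1 - 1 / r" using r0 by (simp add: field_simps)
      then have "1 - \<alpha> \<le> (r - 1) * \<beta>" using 5 by simp
      then have "crit \<alpha> \<beta> = (r - 1) * \<beta>" using 5 crit_cases(3)[OF \<alpha>(1) \<beta>(1)] by simp
      then show ?thesis using 5 by simp
    qed
    ultimately show ?thesis using 5 by simp
  next
    case 6
    then show ?thesis using edge_low[OF \<beta>(1)] crit_cases(3)[OF \<alpha>(1) \<beta>(1)] by simp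
  next
    case 7
    have crit: "crit \<alpha> \<beta> = 1 - \<alpha>" using 7 crit_cases(4)[OF \<alpha>(1) \<beta>(1)] by simp
    consider "\<alpha> < 1 / r" | "\<alpha> = 1 / r" | "1 / r < \<alpha>" by linarith
    then show ?thesis
    proof cases
      case 1
      then show ?thesis unfolding crit using 7 \<alpha> \<beta>
        by (intro strong_type_output[OF high]) (auto simp: frac_le)
    next
      case 2
      then show ?thesis unfolding crit using 7 \<beta> strong_type_r_high[of "1 / \<beta>"] inv_r(2)[of \<beta>]
          by simp
    next
      case 3
      \<comment> \<open>The point of the edge with the same \<alpha>; it lies above (\<alpha>,
        \<beta>), and the loss 1 - \<alpha> is the same at both.\<close>
      define \<gamma> where "\<gamma> = (1 - \<alpha>) / (r - 1)"
      have ra: "1 < r * \<alpha>" using 3 r0 by (simp add: field_simps)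
      have "0 < (r - 1) * \<beta>" using \<beta> r2 by simp
      then have \<gamma>: "0 < \<gamma>" "\<gamma> < 1 / r" "(r - 1) * \<gamma> = 1 - \<alpha>" "\<beta> \<le> \<gamma>"
        using r2 \<alpha> ra 7 by (auto simp: \<gamma>_def field_simps)
      then have "strong_type (1 / \<alpha>) (1 / \<gamma>) (1 - \<alpha>)" using edge_low[of \<gamma>] by simp
      from strong_type_output[OF this, of "1 / \<beta>"] show ?thesis
        unfolding crit using \<gamma> \<beta> by (simp add: frac_le)
    qed
  qed
qed

end

section \<open>Bounds for the refined maximal operator\<close>

context heis_field begin

abbreviation "\<D> \<equiv> refined_dirs R n"

definition dirs_at :: "'a heis \<Rightarrow> ('a hvec \<times> 'a) set set" where
  "dirs_at x = (\<lambda>w. dir x w) ` (V0)"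

lemma q_ge_2: "2 \<le> q"
proof -
  have "card {\<zero>, \<one>} \<le> q" using fin by (intro card_mono) auto
  then show ?thesis by simp
qed

lemma finite_V: "finite V" using fin by (auto simp: V_space_def intro!: finite_PiE)

lemma finite_H: "finite H" using fin finite_V by (simp add: H_eq)

lemma card_V: "card V = q ^ (2 * n)"
  by (simp add: V_space_def card_cartesian_product card_PiE mult_2 power_add)

lemma card_H: "card H = q ^ (2 * n + 1)"
  by (simp add: H_eq card_cartesian_product card_V)

lemma finite_dirs: "finite \<D>"
proof -
  have "\<D> = (\<lambda>(w, c). proj_pt R n w c) ` ((V0) \<times> carrier R)"
    by (auto simp: refined_dirs_def)
  then show ?thesis using finite_V fin by simp
qed

lemma scale_eqD:
  assumes w: "w \<in> V0" and st: "s \<in> carrier R" "t \<in> carrier R"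
    and eq: "vscale R n s w = vscale R n t w"
  shows "s = t"
proof -
  obtain i where i: "i < 2 * n" "vcoord n i w \<noteq> \<zero>" using nonzero_coord[OF w] by blast
  have "s \<otimes> vcoord n i w = t \<otimes> vcoord n i w"
    using arg_cong[OF eq, of "vcoord n i"] i by (simp add: vcoord_vscale)
  then show ?thesis using m_rcancel[of "vcoord n i w" s t] vcoord_closed[of i w] i w st by auto
qed

lemma vscale_nonzero:
  assumes w: "w \<in> V0" and s: "s \<in> carrier R - {\<zero>}"
  shows "vscale R n s w \<in> V0"
proof -
  obtain i where i: "i < 2 * n" "vcoord n i w \<noteq> \<zero>" using nonzero_coord[OF w] by blast
  have "vcoord n i (vscale R n s w) \<noteq> \<zero>"
    using i s w vcoord_closed[of i w] integral[of s "vcoord n i w"] by (auto simp: vcoord_vscale)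
  then have "vscale R n s w \<noteq> vzero R n" using i vcoord_vzero by metis
  then show ?thesis using w s vscale_closed' by auto
qed

lemma vscale_one: "w \<in> V \<Longrightarrow> vscale R n \<one> w = w"
  using vcoord_closed by (intro V_eqI vscale_closed') (auto simp: vcoord_vscale)

lemma sympl_vscale:
  assumes "z \<in> V" "w \<in> V" "s \<in> carrier R"
  shows "sympl R n z (vscale R n s w) = s \<otimes> sympl R n z w"
proof -
  note zc = V_space_coord[OF assms(1)] and wc = V_space_coord[OF assms(2)]
  have d: "dotp R n x (\<lambda>i\<in>{..<n}. s \<otimes> y i) = s \<otimes> dotp R n x y"
    if "\<And>i. i < n \<Longrightarrow> x i \<in> carrier R" "\<And>i. i < n \<Longrightarrow> y i \<in> carrier R" for x y
  proof -
    have "s \<otimes> dotp R n x y = (\<Oplus>i\<in>{..<n}. s \<otimes> (x i \<otimes> y i))"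
      unfolding dotp_def using that assms by (intro finsum_rdistr) auto
    also have "\<dots> = dotp R n x (\<lambda>i\<in>{..<n}. s \<otimes> y i)"
      unfolding dotp_def using that assms by (intro finsum_cong') (auto intro!: m_lcomm)
    finally show ?thesis by simp
  qed
  show ?thesis unfolding sympl_def
    using d[of "fst z" "snd w"] d[of "snd z" "fst w"] zc wc assms(3)
      dotp_closed[of "fst z" "snd w"] dotp_closed[of "snd z" "fst w"]
    by (simp add: vscale_def minus_eq r_distr r_minus)
qed

text \<open>\<open>W\<close> is a union of orbits of the nonzero scalars, which act freely where w
  is nonzero, so every class has q - 1 elements.\<close>

lemma card_classes:
  assumes W: "W \<subseteq> (V0) \<times> carrier R"
    and closed: "\<And>w c s. (w, c) \<in> W \<Longrightarrow> s \<in> carrier R - {\<zero>} \<Longrightarrow> (vscale R n s w, s \<otimes> c) \<in> W"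
  shows "(q - 1) * card ((\<lambda>(w, c). proj_pt R n w c) ` W) = card W"
proof -
  let ?C = "(\<lambda>(w, c). proj_pt R n w c) ` W"
  have finW: "finite W" using W finite_V fin by (meson finite_Diff finite_SigmaI finite_subset)
  have un: "\<Union> ?C = W"
  proof
    show "\<Union> ?C \<subseteq> W"
    proof
      fix y assume "y \<in> \<Union> ?C"
      then obtain wc where wc: "wc \<in> W" "y \<in> proj_pt R n (fst wc) (snd wc)"
        by (auto simp: case_prod_unfold)
      then obtain l where "l \<in> carrier R - {\<zero>}" "y = (vscale R n l (fst wc), l \<otimes> snd wc)"
        unfolding proj_pt_def by blast
      then show "y \<in> W" using closed[of "fst wc" "snd wc" l] wc by simp
    qed
    show "W \<subseteq> \<Union> ?C"
    proof
      fix wc assume wc: "wc \<in> W"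
      obtain w c where [simp]: "wc = (w, c)" by fastforce
      have "w \<in> V" "c \<in> carrier R" using wc W by auto
      then have "(w, c) = (vscale R n \<one> w, \<one> \<otimes> c)" by (simp only: vscale_one l_one)
      then have "(w, c) \<in> proj_pt R n w c" unfolding proj_pt_def by (intro image_eqI[of _ _ \<one>]) auto
      then show "wc \<in> \<Union> ?C" using wc by auto
    qed
  qed
  have mem: "\<exists>w c. (w, c) \<in> W \<and> A = proj_pt R n w c" if A: "A \<in> ?C" for A
  proof -
    obtain wc where "wc \<in> W" "A = (case wc of (w, c) \<Rightarrow> proj_pt R n w c)" using A by blast
    then show ?thesis by (intro exI[of _ "fst wc"] exI[of _ "snd wc"]) (simp add: case_prod_unfold)
  qed
  have card: "card A = q - 1" if A: "A \<in> ?C" for A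
  proof -
    obtain w c where wc: "(w, c) \<in> W" "A = proj_pt R n w c" using mem[OF A] by blast
    have "inj_on (\<lambda>l. (vscale R n l w, l \<otimes> c)) (carrier R - {\<zero>})"
    proof (rule inj_onI)
      fix s t assume st: "s \<in> carrier R - {\<zero>}" "t \<in> carrier R - {\<zero>}"
        "(vscale R n s w, s \<otimes> c) = (vscale R n t w, t \<otimes> c)"
      have "w \<in> V0" using wc W by blast
      then show "s = t" using scale_eqD[of w s t] st by simp
    qed
    then have "card A = card (carrier R - {\<zero>})" unfolding wc proj_pt_def by (rule card_image)
    then show ?thesis using fin by (simp add: card_Diff_singleton)
  qed
  have disj: "A \<inter> B = {}" if AB: "A \<in> ?C" "B \<in> ?C" "A \<noteq> B" for A B
  proof (rule ccontr)
    obtain w c where wc: "(w, c) \<in> W" "A = proj_pt R n w c" using mem[OF AB(1)] by blast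
    obtain w' c' where wc': "(w', c') \<in> W" "B = proj_pt R n w' c'" using mem[OF AB(2)] by blast
    assume "A \<inter> B \<noteq> {}"
    then obtain y where y: "y \<in> A" "y \<in> B" by blast
    obtain l where l1: "l \<in> carrier R - {\<zero>}" "y = (vscale R n l w, l \<otimes> c)"
      using y(1) unfolding wc proj_pt_def by blast
    obtain l' where l2: "l' \<in> carrier R - {\<zero>}" "y = (vscale R n l' w', l' \<otimes> c')"
      using y(2) unfolding wc' proj_pt_def by blast
    have l: "l \<in> carrier R" "l \<noteq> \<zero>" "l' \<in> carrier R" "l' \<noteq> \<zero>"
      and eq: "vscale R n l w = vscale R n l' w'" "l \<otimes> c = l' \<otimes> c'"
      using l1 l2 by simp_all
    have "A = proj_pt R n (vscale R n l w) (l \<otimes> c)"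
      unfolding wc using wc W l by (intro proj_pt_rescale[symmetric, OF field_axioms]) auto
    also have "\<dots> = B"
      unfolding eq wc' using wc' W l by (intro proj_pt_rescale[OF field_axioms]) auto
    finally show False using AB(3) by simp
  qed
  show ?thesis
    using card_partition[of ?C "q - 1"] finW un card disj by simp
qed

lemma card_dirs: "(q - 1) * card \<D> = (q ^ (2 * n) - 1) * q"
proof -
  have "\<D> = (\<lambda>(w, c). proj_pt R n w c) ` ((V0) \<times> carrier R)"
    by (auto simp: refined_dirs_def)
  moreover have "(q - 1) * card ((\<lambda>(w, c). proj_pt R n w c) ` ((V0) \<times> carrier R))
      = card ((V0) \<times> carrier R)"
    by (rule card_classes) (use vscale_nonzero in auto)
  ultimately show ?thesis
    using card_V vzero_mem by (simp add: card_cartesian_product card_Diff_singleton)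
qed

text \<open>The directions at x are the classes of the graph of w \<mapsto> \<sigma>(z, w), z the
  spatial part of x: projectively a hyperplane, with as many points as V has classes.\<close>

lemma card_dirs_at:
  assumes x: "x \<in> H"
  shows "(q - 1) * card (dirs_at x) = q ^ (2 * n) - 1"
proof -
  let ?W = "(\<lambda>w. (w, sympl R n (fst x) w)) ` (V0)"
  have z: "fst x \<in> V" using x by (auto simp: H_eq)
  have "dirs_at x = (\<lambda>(w, c). proj_pt R n w c) ` ?W" by (auto simp: dirs_at_def)
  moreover have "(q - 1) * card ((\<lambda>(w, c). proj_pt R n w c) ` ?W) = card ?W"
  proof (rule card_classes)
    show "?W \<subseteq> (V0) \<times> carrier R" using sympl_closed'[OF z] by blast
    fix w c s assume wc: "(w, c) \<in> ?W" and s: "s \<in> carrier R - {\<zero>}"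
    then have w: "w \<in> V0" "c = sympl R n (fst x) w" by auto
    then have "(vscale R n s w, s \<otimes> c) = (vscale R n s w, sympl R n (fst x) (vscale R n s w))"
      using sympl_vscale[OF z, of w s] s by simp
    then show "(vscale R n s w, s \<otimes> c) \<in> ?W" using vscale_nonzero[OF w(1) s] by blast
  qed
  moreover have "card ?W = card (V0)" by (intro card_image inj_onI) auto
  ultimately show ?thesis using card_V vzero_mem by (simp add: card_Diff_singleton)
qed

section \<open>Horizontal lines and the maximal line sum\<close>

lemma hline_subset: "p \<in> H \<Longrightarrow> w \<in> V \<Longrightarrow> hline R n p w \<subseteq> H"
proof -
  assume p: "p \<in> H" and w: "w \<in> V"
  then have "(w, sympl R n (fst p) w) \<in> H" using sympl_closed'[of "fst p" w]
      by (simp add: H_eq mem_Times_iff)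
  then show ?thesis unfolding hline_eq using line_pt_closed[OF p] by blast
qed

lemma card_hline:
  assumes "p \<in> H" "w \<in> V0"
  shows "card (hline R n p w) = q"
  unfolding hline_eq using assms sympl_closed'[of "fst p" w]
  by (intro card_image inj_line_pt) (auto simp: H_eq)

lemma Mrd_attained:
  assumes "\<theta> \<in> \<D>"
  obtains p w where "p \<in> H" "w \<in> V0" "\<theta> = dir p w"
    "Mrd R n F \<theta> = (\<Sum>x\<in>hline R n p w. norm (F x))"
proof -
  let ?S = "{L \<in> hlines R n. Dir R n L = \<theta>}"
  have "finite ?S" using finite_hlines[OF fin] by simp
  moreover have "?S \<noteq> {}" using hlines_with_Dir_nonempty[OF field_axioms assms] .
  ultimately have "Mrd R n F \<theta> \<in> (\<lambda>L. \<Sum>p\<in>L. norm (F p)) ` ?S"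
    unfolding Mrd_def by (intro Max_in) auto
  then obtain L where L: "L \<in> hlines R n" "Dir R n L = \<theta>" "Mrd R n F \<theta> = (\<Sum>p\<in>L. norm (F p))" by auto
  then obtain p w where pw: "L = hline R n p w" "p \<in> H" "w \<in> V0" by (auto simp: hlines_def)
  then show thesis using that[of p w] L Dir_hline[OF field_axioms pw(2,3)] by simp
qed

lemma Mrd_ge:
  assumes "p \<in> H" "w \<in> V0"
  shows "(\<Sum>x\<in>hline R n p w. norm (F x)) \<le> Mrd R n F (dir p w)"
proof -
  let ?S = "{L \<in> hlines R n. Dir R n L = dir p w}"
  have "hline R n p w \<in> ?S"
    using assms Dir_hline[OF field_axioms assms] unfolding hlines_def by blast
  moreover have "finite ?S" using finite_hlines[OF fin] by simp
  ultimately show ?thesis unfolding Mrd_def by (intro Max_ge) blast+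
qed

lemma dir_in_dirs:
  assumes "p \<in> H" "w \<in> V0"
  shows "dir p w \<in> \<D>"
proof -
  have "sympl R n (fst p) w \<in> carrier R"
    using assms sympl_closed'[of "fst p" w] by (simp add: H_eq mem_Times_iff)
  then show ?thesis unfolding refined_dirs_def using assms(2) by blast
qed

lemma hline_dirs_at:
  assumes p: "p \<in> H" and w: "w \<in> V0" and x: "x \<in> hline R n p w"
  shows "dir p w \<in> dirs_at x"
proof -
  obtain s where s: "s \<in> carrier R" "fst x = vadd R n (fst p) (vscale R n s w)"
    using x by (auto simp: hline_def)
  have "sympl R n (fst x) w = sympl R n (fst p) w"
    unfolding s using sympl_shift[of "fst p" w s] p w s by (auto simp: H_eq)
  then show ?thesis using w by (auto simp: dirs_at_def intro!: image_eqI[of _ _ w])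
qed

lemma powr_nat: "real q powr (2 * real n) = real q ^ (2 * n)"
  using q_ge_2 powr_realpow[of "real q" "2 * n"] by simp

lemma powr_nat_minus_1: "0 < n \<Longrightarrow> real q powr (2 * real n - 1) = real q ^ (2 * n - 1)"
  using q_ge_2 powr_realpow[of "real q" "2 * n - 1"] by (simp add: of_nat_diff)

lemma card_dirs_bounds:
  assumes n: "0 < n"
  shows "real (card \<D>) \<le> 2 * real q powr (2 * real n)" "real q powr (2 * real n) \<le> real (card \<D>)"
proof -
  have q: "2 \<le> q" by (rule q_ge_2)
  have "(q - 1) * card \<D> \<le> (q - 1) * (2 * q ^ (2 * n))"
  proof -
    have "q \<le> 2 * (q - 1)" using q by simp
    then have "q ^ (2 * n) * q \<le> q ^ (2 * n) * (2 * (q - 1))" by (rule mult_left_mono) simp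
    moreover have "(q ^ (2 * n) - 1) * q \<le> q ^ (2 * n) * q" by (intro mult_right_mono) auto
    ultimately have "(q ^ (2 * n) - 1) * q \<le> q ^ (2 * n) * (2 * (q - 1))"
        by (rule order_trans[rotated])
    then show ?thesis unfolding card_dirs by (simp only: mult_ac)
  qed
  then have "card \<D> \<le> 2 * q ^ (2 * n)" using q by simp
  then have "real (card \<D>) \<le> real (2 * q ^ (2 * n))" by (simp only: of_nat_le_iff)
  then show "real (card \<D>) \<le> 2 * real q powr (2 * real n)"
    unfolding powr_nat by simp
  have "q ^ 1 \<le> q ^ (2 * n)" using q n by (intro power_increasing) auto
  then have "(q - 1) * q ^ (2 * n) \<le> (q - 1) * card \<D>"
    unfolding card_dirs using diff_le_mono2[of q "q ^ (2 * n)" "q ^ (2 * n) * q"]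
    by (simp add: diff_mult_distrib mult.commute[of _ "q ^ (2 * n)"] diff_mult_distrib2)
  then have "q ^ (2 * n) \<le> card \<D>" using q by simp
  then have "real (q ^ (2 * n)) \<le> real (card \<D>)" by (simp only: of_nat_le_iff)
  then show "real q powr (2 * real n) \<le> real (card \<D>)"
    unfolding powr_nat by simp
qed

lemma card_dirs_at_bounds:
  assumes n: "0 < n" and x: "x \<in> H"
  shows "real (card (dirs_at x)) \<le> 2 * real q powr (2 * real n - 1)"
    "real q powr (2 * real n - 1) \<le> real (card (dirs_at x))"
proof -
  have q: "2 \<le> q" by (rule q_ge_2)
  have e: "q ^ (2 * n) = q * q ^ (2 * n - 1)" using n by (simp flip: power_Suc)
  have "q \<le> 2 * (q - 1)" using q by simp
  then have "q * q ^ (2 * n - 1) \<le> 2 * (q - 1) * q ^ (2 * n - 1)" by (rule mult_right_mono) simp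
  then have "q * q ^ (2 * n - 1) - 1 \<le> 2 * (q - 1) * q ^ (2 * n - 1)"
      by (meson diff_le_self order_trans)
  then have "(q - 1) * card (dirs_at x) \<le> (q - 1) * (2 * q ^ (2 * n - 1))"
    unfolding card_dirs_at[OF x] e by (simp only: mult_ac)
  then have "card (dirs_at x) \<le> 2 * q ^ (2 * n - 1)" using q by simp
  then have "real (card (dirs_at x)) \<le> real (2 * q ^ (2 * n - 1))" by (simp only: of_nat_le_iff)
  then show "real (card (dirs_at x)) \<le> 2 * real q powr (2 * real n - 1)"
    unfolding powr_nat_minus_1[OF n] by simp
  have "1 \<le> q ^ (2 * n - 1)" using q by simp
  then have "(q - 1) * q ^ (2 * n - 1) \<le> (q - 1) * card (dirs_at x)"
    unfolding card_dirs_at[OF x] e by (simp add: diff_mult_distrib)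
  then have "q ^ (2 * n - 1) \<le> card (dirs_at x)" using q by simp
  then have "real (q ^ (2 * n - 1)) \<le> real (card (dirs_at x))" by (simp only: of_nat_le_iff)
  then show "real q powr (2 * real n - 1) \<le> real (card (dirs_at x))"
    unfolding powr_nat_minus_1[OF n] by simp
qed

text \<open>The multiplicity bound is applied to f scaled and rounded down to integers. Its factor q
  on the left, set against the q^(2n) from the scaling, leaves q^(2n - 1).\<close>

lemma weak_type_bound:
  fixes f :: "'a heis \<Rightarrow> real"
  assumes n: "0 < n" and f: "\<And>x. 0 \<le> f x" and l: "0 < l"
  shows "card {\<theta> \<in> \<D>. l \<le> Mrd R n (\<lambda>x. complex_of_real (f x)) \<theta>} * l powr (2 * real n) \<le>
    (2 * real n + 3) powr (2 * real n) * real q powr (2 * real n - 1) * (\<Sum>x\<in>H. f x powr (2 * real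
        n))"
proof -
  define \<Theta> where "\<Theta> = {\<theta> \<in> \<D>. l \<le> Mrd R n (\<lambda>x. complex_of_real (f x)) \<theta>}"
  have q: "0 < real q" using q_ge_2 by simp
  have "\<forall>\<theta>\<in>\<Theta>. \<exists>pw. fst pw \<in> H \<and> snd pw \<in> V0 \<and>
      \<theta> = dir (fst pw) (snd pw) \<and> l \<le> sum f (hline R n (fst pw) (snd pw))"
  proof
    fix \<theta> assume \<theta>: "\<theta> \<in> \<Theta>"
    then have "\<theta> \<in> \<D>" by (simp add: \<Theta>_def)
    obtain p w where "p \<in> H" "w \<in> V0" "\<theta> = dir p w"
      "Mrd R n (\<lambda>x. complex_of_real (f x)) \<theta> = (\<Sum>x\<in>hline R n p w. norm (complex_of_real (f x)))"
      by (rule Mrd_attained[OF \<open>\<theta> \<in> \<D>\<close>])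
    then show "\<exists>pw. fst pw \<in> H \<and> snd pw \<in> V0 \<and>
      \<theta> = dir (fst pw) (snd pw) \<and> l \<le> sum f (hline R n (fst pw) (snd pw))"
      using \<theta> f by (intro exI[of _ "(p, w)"]) (simp add: \<Theta>_def)
  qed
  from bchoice[OF this] obtain pw where pw: "\<forall>\<theta>\<in>\<Theta>. fst (pw \<theta>) \<in> H \<and> snd (pw \<theta>) \<in> V0 \<and>
      \<theta> = dir (fst (pw \<theta>)) (snd (pw \<theta>)) \<and>
      l \<le> sum f (hline R n (fst (pw \<theta>)) (snd (pw \<theta>)))" by (rule exE)
  \<comment> \<open>Rounding loses less than 1 per point, so at most q per line. Scaling to a line
    sum of (2n + 3) q leaves (2n + 2) q, strictly above the required (2n + 1) q.\<close>
  define m where "m = (2 * real n + 3) * real q / l"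
  have m: "0 < m" using q l by (simp add: m_def)
  define g where "g x = nat \<lfloor>m * f x\<rfloor>" for x
  have g: "m * f x - 1 \<le> real (g x)" "real (g x) \<le> m * f x" for x
    using m f[of x] by (auto simp: g_def)
  have "card \<Theta> * q \<le> (\<Sum>x\<in>H. g x ^ (2 * n))"
  proof (rule kakeya_multiplicity_bound)
    show "finite \<Theta>" using finite_dirs by (simp add: \<Theta>_def)
    fix \<theta> assume \<theta>: "\<theta> \<in> \<Theta>"
    let ?L = "hline R n (fst (pw \<theta>)) (snd (pw \<theta>))"
    show "fst (pw \<theta>) \<in> H" "snd (pw \<theta>) \<in> V0"
      "\<theta> = dir (fst (pw \<theta>)) (snd (pw \<theta>))"
      using pw \<theta> by blast+
    then have "card ?L = q" by (intro card_hline)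
    then have "m * sum f ?L - real q = (\<Sum>x\<in>?L. m * f x - 1)"
      by (simp add: sum_subtractf sum_distrib_left)
    also have "\<dots> \<le> (\<Sum>x\<in>?L. real (g x))" by (intro sum_mono g)
    finally have "m * sum f ?L - real q \<le> real (sum g ?L)" by simp
    moreover have "m * l \<le> m * sum f ?L" using pw \<theta> m by (intro mult_left_mono) auto
    moreover have "m * l = (2 * real n + 3) * real q" using l by (simp add: m_def)
    ultimately have "(2 * real n + 2) * real q \<le> real (sum g ?L)" by (simp add: algebra_simps)
    moreover have "(2 * real n + 1) * real q < (2 * real n + 2) * real q" using q by simp
    ultimately have "real ((2 * n + 1) * q) < real (sum g ?L)" by (simp add: algebra_simps)
    then show "(2 * n + 1) * q < sum g ?L" by (simp only: of_nat_less_iff)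
  qed
  then have "real (card \<Theta> * q) \<le> real (\<Sum>x\<in>H. g x ^ (2 * n))" by (simp only: of_nat_le_iff)
  also have "\<dots> = (\<Sum>x\<in>H. real (g x) ^ (2 * n))" by simp
  also have "\<dots> \<le> (\<Sum>x\<in>H. (m * f x) ^ (2 * n))" using g by (intro sum_mono power_mono) auto
  also have "\<dots> = m ^ (2 * n) * (\<Sum>x\<in>H. f x ^ (2 * n))"
    by (simp add: power_mult_distrib sum_distrib_left)
  finally have "real (card \<Theta>) * real q * (l ^ (2 * n) / real q) \<le>
      m ^ (2 * n) * (\<Sum>x\<in>H. f x ^ (2 * n)) * (l ^ (2 * n) / real q)"
    using q l by (intro mult_right_mono) auto
  also have "\<dots> = (m * l) ^ (2 * n) / real q * (\<Sum>x\<in>H. f x ^ (2 * n))"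
      by (simp add: power_mult_distrib)
  also have "(m * l) ^ (2 * n) / real q = (2 * real n + 3) ^ (2 * n) * real q ^ (2 * n - 1)"
  proof -
    have "m * l = (2 * real n + 3) * real q" using l by (simp add: m_def)
    moreover have "real q ^ (2 * n) = real q * real q ^ (2 * n - 1)" using n
        by (simp flip: power_Suc)
    ultimately show ?thesis using q by (simp add: power_mult_distrib)
  qed
  finally have main: "real (card \<Theta>) * l ^ (2 * n) \<le>
     (2 * real n + 3) ^ (2 * n) * real q ^ (2 * n - 1) * (\<Sum>x\<in>H. f x ^ (2 * n))" using q by simp
  have e: "y powr (2 * real n) = y ^ (2 * n)" if "0 \<le> y" for y
  proof (cases "y = 0")
    case False
    then show ?thesis using that powr_realpow[of y "2 * n"] by simp
  qed (use n in simp)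
  show ?thesis using main l f unfolding \<Theta>_def powr_nat_minus_1[OF n] by (simp add: e)
qed

theorem weak_type_maximal_Mrd:
  assumes n: "0 < n"
  shows "weak_type_maximal (2 * real n) ((2 * real n + 3) powr (2 * real n)) (real q) \<D> H
     (\<lambda>f. Mrd R n (\<lambda>x. complex_of_real (f x)))"
proof
  let ?M = "\<lambda>f. Mrd R n (\<lambda>x. complex_of_real (f x))"
  have q: "0 < real q" using q_ge_2 by simp
  show "2 \<le> 2 * real n" using n by simp
  show "1 \<le> (2 * real n + 3) powr (2 * real n)" by (intro ge_one_powr_ge_zero) auto
  show "1 < real q" using q_ge_2 by simp
  show "finite \<D>" "finite H" by (rule finite_dirs finite_H)+
  show "real (card \<D>) \<le> 2 * real q powr (2 * real n)" by (rule card_dirs_bounds[OF n])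
  {
    fix f :: "'a heis \<Rightarrow> real" and \<theta> assume f: "\<And>x. 0 \<le> f x" and \<theta>: "\<theta> \<in> \<D>"
    have ge: "sum f (hline R n p w) \<le> ?M f (dir p w)"
      if "p \<in> H" "w \<in> V0" "\<And>x. 0 \<le> f x" for f p w
      using Mrd_ge[OF that(1,2), of "\<lambda>x. complex_of_real (f x)"] that(3) by simp
    obtain p w where pw: "p \<in> H" "w \<in> V0" "\<theta> = dir p w"
      and eq': "?M f \<theta> = (\<Sum>x\<in>hline R n p w. norm (complex_of_real (f x)))"
      by (rule Mrd_attained[OF \<theta>])
    let ?L = "hline R n p w"
    have eq: "?M f \<theta> = sum f ?L" using eq' f by simp
    have L: "?L \<subseteq> H" "finite ?L" "card ?L = q"
      using hline_subset[of p w] card_hline[OF pw(1,2)] pw(1,2) finite_H finite_subset by blast+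
    show "0 \<le> ?M f \<theta>" unfolding eq using f by (intro sum_nonneg) auto
    show "?M f \<theta> \<le> ?M f1 \<theta> + ?M f2 \<theta>"
      if "\<And>x. 0 \<le> f1 x" "\<And>x. 0 \<le> f2 x" "\<And>x. f x \<le> f1 x + f2 x" for f1 f2
    proof -
      have "?M f \<theta> \<le> sum f1 ?L + sum f2 ?L"
        unfolding eq sum.distrib[symmetric] using that by (intro sum_mono) auto
      then show ?thesis using ge[OF pw(1,2), of f1] ge[OF pw(1,2), of f2] that pw(3) by simp
    qed
    show "?M f \<theta> \<le> sum f H" unfolding eq using f L finite_H by (intro sum_mono2) auto
    show "?M f \<theta> \<le> real q * B" if "\<And>x. x \<in> H \<Longrightarrow> f x \<le> B" for B
      unfolding eq using sum_bounded_above[of ?L f B] L that by auto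
    \<comment> \<open>Hoelder on the q points of the line that attains the maximum.\<close>
    show "?M f \<theta> \<le> 2 * real q powr (1 - 1 / u) * lnorm u H f" if u: "1 \<le> u" for u
    proof -
      have "(\<Sum>x\<in>?L. f x powr 1) \<le> 2 * (real q powr (1 / 1 - 1 / u) * lnorm u ?L f) powr 1"
        using u L f q by (intro lnorm_powr_mean) auto
      then have "?M f \<theta> \<le> 2 * real q powr (1 - 1 / u) * lnorm u ?L f"
        unfolding eq using f lnorm_nonneg[of u ?L f] by simp
      also have "lnorm u ?L f \<le> lnorm u H f"
        unfolding lnorm_def using L finite_H u by (intro powr_mono2 sum_mono2 sum_nonneg) auto
      finally show ?thesis by (simp add: mult_left_mono)
    qed
  }
  fix f :: "'a heis \<Rightarrow> real" assume f: "\<And>x. 0 \<le> f x"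
  show "real (card {\<theta> \<in> \<D>. l \<le> ?M f \<theta>}) * l powr (2 * real n) \<le>
    (2 * real n + 3) powr (2 * real n) * real q powr (2 * real n - 1) * (\<Sum>x\<in>H. f x powr (2 * real
        n))"
    if "0 < l" for l by (rule weak_type_bound[OF n f that])
  have "\<forall>\<theta>\<in>\<D>. \<exists>L. L \<subseteq> H \<and> ?M f \<theta> = sum f L \<and> (\<forall>x\<in>L. \<theta> \<in> dirs_at x)"
  proof
    fix \<theta> assume \<theta>: "\<theta> \<in> \<D>"
    obtain p w where pw: "p \<in> H" "w \<in> V0" "\<theta> = dir p w"
      and eq': "?M f \<theta> = (\<Sum>x\<in>hline R n p w. norm (complex_of_real (f x)))"
      by (rule Mrd_attained[OF \<theta>])
    then show "\<exists>L. L \<subseteq> H \<and> ?M f \<theta> = sum f L \<and> (\<forall>x\<in>L. \<theta> \<in> dirs_at x)"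
      using hline_dirs_at[OF pw(1,2)] hline_subset[of p w] f
      by (intro exI[of _ "hline R n p w"]) auto
  qed
  from bchoice[OF this] obtain L where
    L: "\<forall>\<theta>\<in>\<D>. L \<theta> \<subseteq> H \<and> ?M f \<theta> = sum f (L \<theta>) \<and> (\<forall>x\<in>L \<theta>. \<theta> \<in> dirs_at x)" by (rule exE)
  \<comment> \<open>Double counting: with one maximizing set \<open>L \<theta>\<close> per
    direction, a point x belongs to at most as many of them as there are directions through
    x.\<close>
  have "(\<Sum>\<theta>\<in>\<D>. ?M f \<theta>) = (\<Sum>\<theta>\<in>\<D>. \<Sum>x\<in>H. if x \<in> L \<theta> then f x else 0)"
  proof (rule sum.cong[OF refl])
    fix \<theta> assume "\<theta> \<in> \<D>"
    then have "?M f \<theta> = sum f (H \<inter> L \<theta>)" using L by (simp add: Int_absorb1)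
    then show "?M f \<theta> = (\<Sum>x\<in>H. if x \<in> L \<theta> then f x else 0)"
      using finite_H by (simp add: sum.inter_restrict)
  qed
  also have "\<dots> = (\<Sum>x\<in>H. f x * card {\<theta> \<in> \<D>. x \<in> L \<theta>})"
    using finite_dirs by (subst sum.swap) (simp add: sum.If_cases Int_def mult.commute)
  also have "\<dots> \<le> (\<Sum>x\<in>H. f x * (2 * real q powr (2 * real n - 1)))"
  proof (intro sum_mono mult_left_mono f)
    fix x assume x: "x \<in> H"
    have "card {\<theta> \<in> \<D>. x \<in> L \<theta>} \<le> card (dirs_at x)"
      using L finite_V by (intro card_mono) (auto simp: dirs_at_def)
    then show "real (card {\<theta> \<in> \<D>. x \<in> L \<theta>}) \<le> 2 * real q powr (2 * real n - 1)"
      using card_dirs_at_bounds(1)[OF n x] by linarith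
  qed
  also have "\<dots> = 2 * real q powr (2 * real n - 1) * sum f H"
    by (simp add: sum_distrib_left sum_distrib_right mult_ac)
  finally show "(\<Sum>\<theta>\<in>\<D>. ?M f \<theta>) \<le> 2 * real q powr (2 * real n - 1) * sum f H" .
qed

end

section \<open>Sharpness of the exponents\<close>

text \<open>Indexed by the reciprocal exponent, with 0 for the maximum, so that all exponents are
  real numbers in [0, 1].\<close>

definition rnorm :: "real \<Rightarrow> 'x set \<Rightarrow> ('x \<Rightarrow> real) \<Rightarrow> real" where
  "rnorm \<alpha> A f = (if \<alpha> = 0 then Max (f ` A) else lnorm (1 / \<alpha>) A f)"

lemma lp_norm_eq_rnorm:
  assumes "0 \<le> \<alpha>"
  shows "lp_norm (1 / ennreal \<alpha>) A F = rnorm \<alpha> A (\<lambda>x. norm (F x))"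
proof (cases "\<alpha> = 0")
  case True
  then show ?thesis by (simp add: lp_norm_def rnorm_def)
next
  case False
  then have "1 / ennreal \<alpha> = ennreal (1 / \<alpha>)"
    using assms divide_ennreal[of 1 \<alpha>] by simp
  then show ?thesis using False assms by (simp add: lp_norm_def rnorm_def lnorm_def)
qed

lemma rnorm_lower:
  assumes "finite A" "E \<subseteq> A" "E \<noteq> {}" "0 \<le> \<beta>" "0 \<le> c"
    and c: "\<And>x. x \<in> E \<Longrightarrow> c \<le> g x" and g: "\<And>x. x \<in> A \<Longrightarrow> 0 \<le> g x"
  shows "real (card E) powr \<beta> * c \<le> rnorm \<beta> A g"
proof (cases "\<beta> = 0")
  case True
  obtain x where x: "x \<in> E" using assms(3) by blast
  have "c \<le> g x" using c[OF x] .
  also have "\<dots> \<le> Max (g ` A)" using x assms by (intro Max_ge) auto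
  finally show ?thesis using True assms finite_subset[of E A] by (simp add: rnorm_def)
next
  case False
  then have b: "0 < \<beta>" using assms by simp
  have "real (card E) * c powr (1 / \<beta>) = (\<Sum>x\<in>E. c powr (1 / \<beta>))" by simp
  also have "\<dots> \<le> (\<Sum>x\<in>E. g x powr (1 / \<beta>))"
    using c b assms by (intro sum_mono powr_mono2) auto
  also have "\<dots> \<le> (\<Sum>x\<in>A. g x powr (1 / \<beta>))" using assms by (intro sum_mono2) auto
  finally have "(real (card E) * c powr (1 / \<beta>)) powr \<beta> \<le> (\<Sum>x\<in>A. g x powr (1 / \<beta>)) powr \<beta>"
    using b by (intro powr_mono2) auto
  then show ?thesis using b assms by (simp add: rnorm_def lnorm_def powr_mult powr_powr)
qed

lemma rnorm_indicator:
  assumes "finite A" "S \<subseteq> A" "S \<noteq> {}" "0 \<le> \<alpha>"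
  shows "rnorm \<alpha> A (\<lambda>x. norm (if x \<in> S then 1 else 0 :: complex)) = real (card S) powr \<alpha>"
proof (cases "\<alpha> = 0")
  case True
  have "0 < card S" using assms finite_subset card_gt_0_iff by blast
  moreover have "Max ((\<lambda>x. norm (if x \<in> S then 1 else 0 :: complex)) ` A) = 1"
  proof (rule Max_eqI)
    obtain x where "x \<in> S" using assms(3) by blast
    then show "1 \<in> (\<lambda>x. norm (if x \<in> S then 1 else 0 :: complex)) ` A"
      using assms(2) by (intro image_eqI[of _ _ x]) auto
    fix y assume "y \<in> (\<lambda>x. norm (if x \<in> S then 1 else 0 :: complex)) ` A"
    then obtain x where "y = norm (if x \<in> S then 1 else 0 :: complex)" by blast
    then show "y \<le> 1" by (cases "x \<in> S") auto
  qed (use assms in auto)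
  ultimately show ?thesis using True by (simp add: rnorm_def)
next
  case False
  have "(\<Sum>x\<in>A. norm (if x \<in> S then 1 else 0 :: complex) powr (1 / \<alpha>)) =
      (\<Sum>x\<in>A. if x \<in> S then 1 else 0)"
    by (intro sum.cong) auto
  also have "\<dots> = real (card S)"
    using assms by (simp add: sum.If_cases Int_absorb1)
  finally show ?thesis using False by (simp add: rnorm_def lnorm_def)
qed

context heis_field begin

lemma Mrd_nonneg:
  assumes "\<theta> \<in> \<D>" shows "0 \<le> Mrd R n F \<theta>"
proof -
  obtain p w where "Mrd R n F \<theta> = (\<Sum>x\<in>hline R n p w. norm (F x))"
    by (rule Mrd_attained[OF assms])
  then show ?thesis by (simp add: sum_nonneg)
qed

lemma mem_hline:
  assumes "p \<in> H" "w \<in> V"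
  shows "p \<in> hline R n p w"
proof -
  have z: "fst p \<in> V" "snd p \<in> carrier R" using assms by (auto simp: H_eq)
  have "vadd R n (fst p) (vscale R n \<zero> w) = fst p"
    using z assms vcoord_closed
    by (intro V_eqI vadd_closed vscale_closed') (auto simp: vcoord_vadd vcoord_vscale)
  moreover have "snd p \<oplus> \<zero> \<otimes> sympl R n (fst p) w = snd p"
    using z assms sympl_closed' by simp
  ultimately have "p = (\<lambda>s. (vadd R n (fst p) (vscale R n s w), snd p \<oplus> s \<otimes> sympl R n (fst p) w)) \<zero>"
    by simp
  then show ?thesis unfolding hline_def by (rule image_eqI) simp
qed

lemma Mrd_indicator_ge_1:
  assumes "p \<in> S" "p \<in> H" "w \<in> V0"
  shows "1 \<le> Mrd R n (\<lambda>x. if x \<in> S then 1 else 0) (dir p w)"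
proof -
  have fin_L: "finite (hline R n p w)"
    using hline_subset[of p w] assms finite_H finite_subset by blast
  have "(\<Sum>x\<in>{p}. norm (if x \<in> S then 1 else 0 :: complex)) \<le>
      (\<Sum>x\<in>hline R n p w. norm (if x \<in> S then 1 else 0 :: complex))"
    using fin_L mem_hline[OF assms(2)] assms by (intro sum_mono2) auto
  then show ?thesis using Mrd_ge[OF assms(2,3), of "\<lambda>x. if x \<in> S then 1 else 0"] assms(1) by simp
qed

lemma Mrd_indicator_line:
  assumes "p \<in> H" "w \<in> V0" "hline R n p w \<subseteq> S"
  shows "real q \<le> Mrd R n (\<lambda>x. if x \<in> S then 1 else 0) (dir p w)"
proof -
  have "(\<Sum>x\<in>hline R n p w. norm (if x \<in> S then 1 else 0 :: complex)) = (\<Sum>x\<in>hline R n p w. 1)"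
    using assms(3) by (intro sum.cong) auto
  then show ?thesis
    using Mrd_ge[OF assms(1,2), of "\<lambda>x. if x \<in> S then 1 else 0"] card_hline[OF assms(1,2)] by simp
qed

text \<open>The points \<open>(s e\<^sub>0, 0)\<close> lie on lines in all the directions \<open>[w:c]\<close> with \<open>\<sigma>(e\<^sub>0, w) \<noteq> 0\<close>.\<close>

definition axis_pt :: "'a \<Rightarrow> 'a heis" where
  "axis_pt s = (((\<lambda>i\<in>{..<n}. if i = 0 then s else \<zero>), (\<lambda>i\<in>{..<n}. \<zero>)), \<zero>)"

lemma axis_pt_closed: "s \<in> carrier R \<Longrightarrow> axis_pt s \<in> H"
  by (auto simp: axis_pt_def H_eq V_space_def)

lemma sympl_axis_pt:
  assumes n: "0 < n" and s: "s \<in> carrier R" and w: "w \<in> V"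
  shows "sympl R n (fst (axis_pt s)) w = s \<otimes> snd w 0"
proof -
  note wc = V_space_coord[OF w]
  have "dotp R n (\<lambda>i\<in>{..<n}. if i = 0 then s else \<zero>) (snd w) =
      (\<Oplus>i\<in>{..<n}. if 0 = i then s \<otimes> snd w i else \<zero>)"
    unfolding dotp_def using wc s by (intro finsum_cong') auto
  also have "\<dots> = s \<otimes> snd w 0" using wc s n by (subst finsum_singleton) auto
  finally have 1: "dotp R n (\<lambda>i\<in>{..<n}. if i = 0 then s else \<zero>) (snd w) = s \<otimes> snd w 0" .
  have "dotp R n (\<lambda>i\<in>{..<n}. \<zero>) (fst w) = (\<Oplus>i\<in>{..<n}. \<zero>)"
    unfolding dotp_def using wc by (intro finsum_cong') auto
  then have 2: "dotp R n (\<lambda>i\<in>{..<n}. \<zero>) (fst w) = \<zero>" by simp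
  show ?thesis using wc s n by (simp add: sympl_def axis_pt_def 1 2 minus_eq)
qed

text \<open>If \<open>snd w 0\<close> is nonzero, then s \<mapsto> s \<open>snd w 0\<close> is onto,
  so every central slope c is met at the axis point s = c / \<open>snd w 0\<close>. There are (q -
  1) q^(2n) pairs (w, c) of this kind, in classes of size q - 1.\<close>

lemma axis_dirs:
  assumes n: "0 < n"
  obtains E where "E \<subseteq> \<D>" "card E = q ^ (2 * n)"
    "\<forall>\<theta>\<in>E. \<exists>s\<in>carrier R. \<exists>w\<in>V0. \<theta> = dir (axis_pt s) w"
proof
  define B where "B = (\<Pi>\<^sub>E i\<in>{..<n}. if i = 0 then carrier R - {\<zero>} else carrier R)"
  define W where "W = (({..<n} \<rightarrow>\<^sub>E carrier R) \<times> B) \<times> carrier R"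
  let ?E = "(\<lambda>(w, c). proj_pt R n w c) ` W"
  have B_eq: "y \<in> B \<longleftrightarrow> y \<in> {..<n} \<rightarrow>\<^sub>E carrier R \<and> y 0 \<noteq> \<zero>" for y
  proof -
    have "(\<forall>i\<in>{..<n}. y i \<in> (if i = 0 then carrier R - {\<zero>} else carrier R)) \<longleftrightarrow>
        (\<forall>i\<in>{..<n}. y i \<in> carrier R) \<and> y 0 \<noteq> \<zero>" (is "?l \<longleftrightarrow> ?r")
    proof
      assume l: ?l
      have "y i \<in> carrier R" if "i \<in> {..<n}" for i using bspec[OF l that] by (cases "i = 0") auto
      moreover have "y 0 \<noteq> \<zero>" using bspec[OF l, of 0] n by simp
      ultimately show ?r by blast
    qed simp
    then show ?thesis unfolding B_def PiE_iff by blast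
  qed
  have W_eq: "(w, c) \<in> W \<longleftrightarrow> w \<in> V \<and> snd w 0 \<noteq> \<zero> \<and> c \<in> carrier R" for w c
    by (auto simp: W_def V_space_def B_eq mem_Times_iff)
  have W_sub: "W \<subseteq> (V0) \<times> carrier R"
  proof
    fix x assume "x \<in> W"
    then have "fst x \<in> V" "snd (fst x) 0 \<noteq> \<zero>" "snd x \<in> carrier R" using W_eq[of "fst x" "snd x"]
        by auto
    moreover have "snd (vzero R n) 0 = \<zero>" using n by (simp add: vzero_def)
    ultimately show "x \<in> (V0) \<times> carrier R" by (auto simp: mem_Times_iff)
  qed
  obtain k where k: "n = Suc k" using n by (cases n) auto
  have "card B = (q - 1) * q ^ k"
    unfolding B_def k using fin by (simp add: card_PiE prod.lessThan_Suc_shift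
        card_Diff_singleton del: prod.lessThan_Suc)
  then have "card W = q ^ n * ((q - 1) * q ^ k) * q"
    by (simp add: W_def card_cartesian_product card_PiE)
  also have "\<dots> = (q - 1) * q ^ (2 * n)" by (simp add: k mult_2 power_add)
  finally have card_W: "card W = (q - 1) * q ^ (2 * n)" .
  have "(q - 1) * card ?E = card W"
  proof (rule card_classes[OF W_sub])
    fix w c s assume wc: "(w, c) \<in> W" and s: "s \<in> carrier R - {\<zero>}"
    have "snd w 0 \<in> carrier R" using wc W_eq V_space_coord n by blast
    then have "s \<otimes> snd w 0 \<noteq> \<zero>" using wc W_eq s integral[of s "snd w 0"] by auto
    then have "snd (vscale R n s w) 0 \<noteq> \<zero>" using n by (simp add: vscale_def)
    then show "(vscale R n s w, s \<otimes> c) \<in> W" using wc s vscale_closed' unfolding W_eq by auto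
  qed
  then show "card ?E = q ^ (2 * n)" using card_W q_ge_2 by simp
  have "w \<in> V0 \<and> c \<in> carrier R" if "(w, c) \<in> W" for w c using that W_sub by blast
  then show "?E \<subseteq> \<D>" unfolding refined_dirs_def by fast
  show "\<forall>\<theta>\<in>?E. \<exists>s\<in>carrier R. \<exists>w\<in>V0. \<theta> = dir (axis_pt s) w"
  proof
    fix \<theta> assume "\<theta> \<in> ?E"
    then obtain x where x: "x \<in> W" "\<theta> = (case x of (w, c) \<Rightarrow> proj_pt R n w c)" by blast
    define w c where "w = fst x" and "c = snd x"
    have wc: "(w, c) \<in> W" "\<theta> = proj_pt R n w c" using x
        by (simp_all add: w_def c_def case_prod_unfold)
    then have w: "w \<in> V" "snd w 0 \<noteq> \<zero>" "c \<in> carrier R" "w \<in> V0" using W_eq W_sub by blast+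
    have w0: "snd w 0 \<in> carrier R" using w(1) V_space_coord n by blast
    then have u: "inv (snd w 0) \<in> carrier R" "inv (snd w 0) \<otimes> snd w 0 = \<one>"
      using w(2) field_Units by auto
    have "c \<otimes> inv (snd w 0) \<otimes> snd w 0 = c" using u w w0 by (simp add: m_assoc)
    then have "sympl R n (fst (axis_pt (c \<otimes> inv (snd w 0)))) w = c"
      using sympl_axis_pt[OF n _ w(1), of "c \<otimes> inv (snd w 0)"] u w(3) by simp
    then show "\<exists>s\<in>carrier R. \<exists>w\<in>V0. \<theta> = dir (axis_pt s) w"
      using wc(2) w(3,4) u(1) by (metis m_closed)
  qed
qed

lemma lower_bounds:
  assumes n: "0 < n" and \<alpha>: "0 \<le> \<alpha>" and \<beta>: "0 \<le> \<beta>"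
    and est: "\<And>F. rnorm \<beta> \<D> (Mrd R n F) \<le> K * rnorm \<alpha> H (\<lambda>x. norm (F x))"
  shows "real q powr ((2 * real n - 1) * \<beta>) \<le> K" "real q powr (1 - \<alpha>) \<le> K"
    "real q powr (2 * real n * \<beta> - \<alpha>) \<le> K"
        "real q powr (1 + 2 * real n * \<beta> - (2 * real n + 1) * \<alpha>) \<le> K"
proof -
  have q: "0 < real q" using q_ge_2 by simp
  have div: "x * real q powr (- e) \<le> K" if "x \<le> K * real q powr e" for x e
  proof -
    have "x * real q powr (- e) \<le> K * real q powr e * real q powr (- e)"
      using that by (rule mult_right_mono) simp
    also have "\<dots> = K * real q powr (e + - e)" unfolding powr_add by (simp only: mult.assoc)
    finally show ?thesis using q by simp
  qed
  \<comment> \<open>The general test: the indicator of S against a set E of directions on which the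
    maximal function is at least c.\<close>
  have ind: "real (card E) powr \<beta> * c \<le> K * real (card S) powr \<alpha>"
    if "E \<subseteq> \<D>" "E \<noteq> {}" "0 \<le> c" "S \<subseteq> H" "S \<noteq> {}"
      "\<And>\<theta>. \<theta> \<in> E \<Longrightarrow> c \<le> Mrd R n (\<lambda>x. if x \<in> S then 1 else 0) \<theta>" for E c S
  proof -
    have "real (card E) powr \<beta> * c \<le> rnorm \<beta> \<D> (Mrd R n (\<lambda>x. if x \<in> S then 1 else 0))"
      using that \<beta> finite_dirs Mrd_nonneg by (intro rnorm_lower) auto
    also have "\<dots> \<le> K * rnorm \<alpha> H (\<lambda>x. norm (if x \<in> S then 1 else 0 :: complex))" by (rule est)
    finally show ?thesis using rnorm_indicator[OF finite_H that(4,5) \<alpha>] by simp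
  qed
  have "1 < card V" unfolding card_V using q_ge_2 n by (intro one_less_power) auto
  then have "card (V0) \<noteq> 0" using vzero_mem by (simp add: card_Diff_singleton)
  then obtain w where w: "w \<in> V0" by (metis card.empty ex_in_conv)
  define p where "p = (vzero R n, \<zero>)"
  have p: "p \<in> H" using vzero_mem by (simp add: p_def H_eq)
  define \<theta> where "\<theta> = dir p w"
  have \<theta>: "\<theta> \<in> dirs_at p" "\<theta> \<in> \<D>" using w dir_in_dirs[OF p w] by (auto simp: \<theta>_def dirs_at_def)
  \<comment> \<open>One point and all directions through it give (r - 1) \<beta>.\<close>
  have "real (card (dirs_at p)) powr \<beta> * 1 \<le> K * real (card {p}) powr \<alpha>"
  proof (rule ind)
    show "dirs_at p \<subseteq> \<D>" using dir_in_dirs[OF p] by (auto simp: dirs_at_def)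
    fix \<theta> assume "\<theta> \<in> dirs_at p"
    then obtain w where "w \<in> V0" "\<theta> = dir p w"
      unfolding dirs_at_def by blast
    then show "1 \<le> Mrd R n (\<lambda>x. if x \<in> {p} then 1 else 0) \<theta>"
      using Mrd_indicator_ge_1[of p "{p}" w] p by simp
  qed (use \<theta> p in auto)
  then have "real (card (dirs_at p)) powr \<beta> \<le> K" by simp
  moreover have "(real q powr (2 * real n - 1)) powr \<beta> \<le> real (card (dirs_at p)) powr \<beta>"
    using card_dirs_at_bounds(2)[OF n p] \<beta> by (intro powr_mono2) auto
  ultimately show 1: "real q powr ((2 * real n - 1) * \<beta>) \<le> K" by (simp add: powr_powr)
  then have K: "0 \<le> K" by (meson order_trans powr_ge_zero)
  \<comment> \<open>One line and its own direction give 1 - \<alpha>.\<close>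
  have "real (card {\<theta>}) powr \<beta> * real q \<le> K * real (card (hline R n p w)) powr \<alpha>"
  proof (rule ind)
    have "w \<in> V" using w by simp
    then show "hline R n p w \<subseteq> H" "hline R n p w \<noteq> {}" using hline_subset[OF p] mem_hline[OF p]
        by blast+
  qed (use \<theta> Mrd_indicator_line[OF p w order_refl] in \<open>auto simp: \<theta>_def\<close>)
  then have "real q * real q powr (- \<alpha>) \<le> K" using card_hline[OF p w] by (intro div) simp
  then show "real q powr (1 - \<alpha>) \<le> K"
    using q by (simp add: powr_diff powr_minus divide_inverse)
  obtain E where E: "E \<subseteq> \<D>" "card E = q ^ (2 * n)"
    "\<forall>\<theta>\<in>E. \<exists>s\<in>carrier R. \<exists>w\<in>V0. \<theta> = dir (axis_pt s) w"
    by (rule axis_dirs[OF n])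
  let ?S = "axis_pt ` carrier R"
  \<comment> \<open>At most q axis points serve q^r directions, which gives r \<beta> -
    \<alpha>.\<close>
  have "real (card E) powr \<beta> * 1 \<le> K * real (card ?S) powr \<alpha>"
  proof (rule ind[OF E(1)])
    have "card E \<noteq> 0" using E(2) q_ge_2 by simp
    then show "E \<noteq> {}" by auto
    show "?S \<subseteq> H" using axis_pt_closed by blast
    fix \<theta> assume "\<theta> \<in> E"
    then obtain s w where "s \<in> carrier R" "w \<in> V0"
      "\<theta> = dir (axis_pt s) w" using E(3) by blast
    then show "1 \<le> Mrd R n (\<lambda>x. if x \<in> ?S then 1 else 0) \<theta>"
      using Mrd_indicator_ge_1[of "axis_pt s" ?S w] axis_pt_closed by blast
  qed auto
  moreover have "real (card ?S) powr \<alpha> \<le> real q powr \<alpha>"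
    using \<alpha> card_image_le[OF fin, of axis_pt] by (intro powr_mono2) auto
  then have "K * real (card ?S) powr \<alpha> \<le> K * real q powr \<alpha>" using K by (rule mult_left_mono)
  ultimately have "real (card E) powr \<beta> \<le> K * real q powr \<alpha>" by linarith
  moreover have "real (card E) = real q powr (2 * real n)" unfolding E(2) powr_nat by simp
  ultimately have "real q powr (2 * real n * \<beta>) * real q powr (- \<alpha>) \<le> K"
    by (intro div) (simp add: powr_powr)
  then show "real q powr (2 * real n * \<beta> - \<alpha>) \<le> K"
    using q by (simp add: powr_diff powr_minus divide_inverse)
  \<comment> \<open>The whole group, where every line is full, gives 1 + r \<beta> - (r + 1)
    \<alpha>.\<close>
  have "real (card \<D>) powr \<beta> * real q \<le> K * real (card H) powr \<alpha>"
  proof (rule ind)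
    fix \<theta> assume "\<theta> \<in> \<D>"
    then obtain p w where "p \<in> H" "w \<in> V0" "\<theta> = dir p w"
      by (rule Mrd_attained)
    then show "real q \<le> Mrd R n (\<lambda>x. if x \<in> H then 1 else 0) \<theta>"
      using Mrd_indicator_line[of p w H] hline_subset[of p w] by simp
  qed (use \<theta> p in auto)
  moreover have "(real q powr (2 * real n)) powr \<beta> * real q \<le> real (card \<D>) powr \<beta> * real q"
    using card_dirs_bounds(2)[OF n] \<beta> by (intro mult_right_mono powr_mono2) auto
  moreover have "real (card H) = real q powr (2 * real n + 1)"
    unfolding card_H using q powr_realpow[of "real q" "2 * n + 1"] by (simp add: add.commute)
  ultimately have "real q powr (2 * real n * \<beta>) * real q \<le> K * real q powr ((2 * real n + 1) * \<alpha>)"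
    by (simp add: powr_powr)
  then have "real q powr (2 * real n * \<beta>) * real q * real q powr (- ((2 * real n + 1) * \<alpha>)) \<le> K"
      by (rule div)
  then have "real q powr 1 * real q powr (2 * real n * \<beta>) * real q powr (- ((2 * real n + 1) *
      \<alpha>)) \<le> K"
    using q by (simp add: mult.commute)
  then show "real q powr (1 + 2 * real n * \<beta> - (2 * real n + 1) * \<alpha>) \<le> K"
    unfolding powr_add[symmetric] by simp
qed

end

section \<open>The optimal exponent\<close>

lemma rnorm_nonneg:
  assumes "finite A" "A \<noteq> {}" "\<And>x. x \<in> A \<Longrightarrow> 0 \<le> f x"
  shows "0 \<le> rnorm \<alpha> A f"
proof (cases "\<alpha> = 0")
  case True
  obtain x where x: "x \<in> A" using assms(2) by blast
  have "0 \<le> f x" using assms(3)[OF x] .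
  also have "\<dots> \<le> Max (f ` A)" using x assms(1) by (intro Max_ge) auto
  finally show ?thesis using True by (simp add: rnorm_def)
qed (simp add: rnorm_def lnorm_nonneg)

lemma rnorm_cong: "(\<And>x. x \<in> A \<Longrightarrow> f x = g x) \<Longrightarrow> rnorm \<alpha> A f = rnorm \<alpha> A g"
  unfolding rnorm_def lnorm_def by (simp cong: image_cong_simp sum.cong)

lemma rnorm_0_le:
  assumes "finite A" "A \<noteq> {}" "\<And>x. x \<in> A \<Longrightarrow> f x \<le> B"
  shows "rnorm 0 A f \<le> B"
  using assms by (simp add: rnorm_def)

lemma le_rnorm_0: "finite A \<Longrightarrow> x \<in> A \<Longrightarrow> f x \<le> rnorm 0 A f"
  by (simp add: rnorm_def)

text \<open>Passes from extended exponents to the unit square; the infinite exponent corresponds to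
  0.\<close>

lemma ennreal_reciprocal:
  fixes u :: ennreal
  assumes "1 \<le> u"
  shows "enn2real (1 / u) \<in> {0..1}" "u = 1 / ennreal (enn2real (1 / u))"
proof -
  have "enn2real (1 / u) \<in> {0..1} \<and> u = 1 / ennreal (enn2real (1 / u))"
  proof (cases u)
    case (real x)
    then have x: "1 \<le> x" using assms by simp
    have "1 / u = ennreal (1 / x)" using x real divide_ennreal[of 1 x] by simp
    moreover have "1 / ennreal (1 / x) = ennreal x" using x divide_ennreal[of 1 "1 / x"] by simp
    ultimately show ?thesis using x real by simp
  qed simp
  then show "enn2real (1 / u) \<in> {0..1}" "u = 1 / ennreal (enn2real (1 / u))" by blast+
qed

lemma of_nat_ennreal_reciprocal: "0 < m \<Longrightarrow> (of_nat m :: ennreal) = 1 / ennreal (1 / real m)"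
  using divide_ennreal[of 1 "1 / real m"] by (simp add: ennreal_of_nat_eq_real_of_nat)

lemma Phi_eq_max: "Phi n \<alpha> \<beta> = max (max ((2 * real n - 1) * \<beta>) (1 - \<alpha>))
    (max (2 * real n * \<beta> - \<alpha>) (1 + 2 * real n * \<beta> - (2 * real n + 1) * \<alpha>))"
  by (simp add: Phi_def Let_def max.assoc)

lemma Phi_nonneg: "\<alpha> \<le> 1 \<Longrightarrow> 0 \<le> Phi n \<alpha> \<beta>" by (simp add: Phi_eq_max)

section \<open>Uniform estimates over all finite fields of odd order\<close>

locale rd_problem =
  fixes n :: nat
  assumes n: "0 < n"
begin

abbreviation "r \<equiv> 2 * real n"

text \<open>One index set instead of nested quantifiers over q and over fields with q elements; q is
  recovered as the cardinality.\<close>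

definition rings :: "int ring set" where
  "rings = {R. field R \<and> finite (carrier R) \<and> odd (card (carrier R)) \<and> primepow (card (carrier R))}"

lemma rd_estimate_iff: "rd_estimate n u v K \<longleftrightarrow> (\<forall>R\<in>rings. \<forall>F.
    lp_norm v (refined_dirs R n) (Mrd R n F) \<le> K (card (carrier R)) * lp_norm u (carrier (Heis R
        n)) F)"
  unfolding rd_estimate_def rings_def by blast

lemma heis: "R \<in> rings \<Longrightarrow> heis_field R"
  by (simp add: rings_def heis_field_def heis_field_axioms_def)

lemma card_ge_2: "R \<in> rings \<Longrightarrow> 2 \<le> card (carrier R)"
  by (rule heis_field.q_ge_2[OF heis])

lemma finite_dirs: "R \<in> rings \<Longrightarrow> finite (refined_dirs R n)"
  by (rule heis_field.finite_dirs[OF heis])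

lemma finite_Heis: "R \<in> rings \<Longrightarrow> finite (carrier (Heis R n))"
  by (rule heis_field.finite_H[OF heis])

lemma dirs_nonempty: "R \<in> rings \<Longrightarrow> refined_dirs R n \<noteq> {}"
  using heis_field.card_dirs_bounds(2)[OF heis n, of R] card_ge_2[of R] by auto

lemma Heis_nonempty: "R \<in> rings \<Longrightarrow> carrier (Heis R n) \<noteq> {}"
  using heis_field.card_H[OF heis, of R n] card_ge_2[of R] by auto

lemma Mrd_nonneg: "R \<in> rings \<Longrightarrow> \<theta> \<in> refined_dirs R n \<Longrightarrow> 0 \<le> Mrd R n F \<theta>"
  by (rule heis_field.Mrd_nonneg[OF heis])

sublocale family: maximal_family r "(r + 3) powr r" rings "\<lambda>R. real (card (carrier R))"
  "\<lambda>R. refined_dirs R n" "\<lambda>R. carrier (Heis R n)" "\<lambda>R f. Mrd R n (\<lambda>x. complex_of_real (f x))"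
  using n by (intro maximal_family.intro heis_field.weak_type_maximal_Mrd heis) simp_all

text \<open>Only the absolute values of F enter, which reduces the estimates to nonnegative
  functions.\<close>

lemma Mrd_norm: "Mrd R n F = Mrd R n (\<lambda>x. complex_of_real (norm (F x)))"
  by (simp add: Mrd_def fun_eq_iff)

lemma rd_estimate_rnorm:
  assumes "0 \<le> \<alpha>" "0 \<le> \<beta>"
  shows "rd_estimate n (1 / ennreal \<alpha>) (1 / ennreal \<beta>) K \<longleftrightarrow> (\<forall>R\<in>rings. \<forall>F.
    rnorm \<beta> (refined_dirs R n) (Mrd R n F) \<le> K (card (carrier R)) * rnorm \<alpha> (carrier (Heis R n))
        (\<lambda>x. norm (F x)))"
proof -
  have "lp_norm (1 / ennreal \<beta>) (refined_dirs R n) (Mrd R n F) =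
      rnorm \<beta> (refined_dirs R n) (Mrd R n F)"
    if "R \<in> rings" for R F
    unfolding lp_norm_eq_rnorm[OF assms(2)] using Mrd_nonneg[OF that] by (intro rnorm_cong) simp
  then show ?thesis unfolding rd_estimate_iff lp_norm_eq_rnorm[OF assms(1)] by simp
qed

lemma upper_interior:
  assumes \<alpha>: "0 < \<alpha>" "\<alpha> \<le> 1" and \<beta>: "0 < \<beta>" "\<beta> \<le> 1" and ne: "(\<alpha>, \<beta>) \<noteq> (1 / r, 1 / r)"
  shows "\<exists>C. rd_estimate n (1 / ennreal \<alpha>) (1 / ennreal \<beta>) (\<lambda>q. C * real q powr Phi n \<alpha> \<beta>)"
proof -
  have crit: "family.crit \<alpha> \<beta> = Phi n \<alpha> \<beta>" by (simp add: family.crit_def Phi_eq_max)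
  obtain C where C: "0 \<le> C" "\<forall>R\<in>rings. \<forall>f. (\<forall>x. 0 \<le> f x) \<longrightarrow>
     lnorm (1 / \<beta>) (refined_dirs R n) (Mrd R n (\<lambda>x. complex_of_real (f x))) \<le>
       C * (real (card (carrier R)) powr Phi n \<alpha> \<beta> * lnorm (1 / \<alpha>) (carrier (Heis R n)) f)"
    by (rule family.strong_typeE[OF family.strong_type_crit[OF \<alpha> \<beta> ne, unfolded crit]])
  have "rnorm \<beta> (refined_dirs R n) (Mrd R n F) \<le>
      C * real (card (carrier R)) powr Phi n \<alpha> \<beta> * rnorm \<alpha> (carrier (Heis R n)) (\<lambda>x. norm (F x))"
    if "R \<in> rings" for R F
    using bspec[OF C(2) that, THEN spec, of "\<lambda>x. norm (F x)"] \<alpha> \<beta>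
    by (simp add: rnorm_def Mrd_norm[symmetric] mult.assoc)
  then show ?thesis using \<alpha> \<beta> by (intro exI[of _ C]) (simp add: rd_estimate_rnorm)
qed

lemma upper_beta_0:
  assumes \<alpha>: "0 \<le> \<alpha>" "\<alpha> \<le> 1"
  shows "rd_estimate n (1 / ennreal \<alpha>) (1 / ennreal 0) (\<lambda>q. 2 * real q powr Phi n \<alpha> 0)"
proof -
  have "r * \<alpha> \<ge> 0" using \<alpha> by simp
  then have Phi: "Phi n \<alpha> 0 = 1 - \<alpha>"
    using \<alpha> unfolding Phi_eq_max mult_zero_right distrib_right mult_1_left by linarith
  have "rnorm 0 (refined_dirs R n) (Mrd R n F) \<le>
      2 * real (card (carrier R)) powr (1 - \<alpha>) * rnorm \<alpha> (carrier (Heis R n)) (\<lambda>x. norm (F x))"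
    if R: "R \<in> rings" for R F
  proof (rule rnorm_0_le[OF finite_dirs[OF R] dirs_nonempty[OF R]])
    fix \<theta> assume \<theta>: "\<theta> \<in> refined_dirs R n"
    let ?H = "carrier (Heis R n)" and ?f = "\<lambda>x. norm (F x)" and ?q = "real (card (carrier R))"
    note member = family.member[OF R]
    show "Mrd R n F \<theta> \<le> 2 * ?q powr (1 - \<alpha>) * rnorm \<alpha> ?H ?f"
    proof (cases "\<alpha> = 0")
      case True
      have "Mrd R n F \<theta> \<le> ?q * rnorm 0 ?H ?f"
        unfolding Mrd_norm[of R F]
        using le_rnorm_0[OF finite_Heis[OF R], of _ ?f]
        by (intro weak_type_maximal.M_le_sup[OF member _ _ \<theta>]) simp_all
      moreover have "0 \<le> ?q * rnorm 0 ?H ?f"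
        using rnorm_nonneg[OF finite_Heis[OF R] Heis_nonempty[OF R], of ?f 0] by simp
      ultimately show ?thesis using True by simp
    next
      case False
      have "Mrd R n F \<theta> \<le> 2 * ?q powr (1 - 1 / (1 / \<alpha>)) * lnorm (1 / \<alpha>) ?H ?f"
        unfolding Mrd_norm[of R F]
        by (rule weak_type_maximal.M_le_lnorm[OF member _ _ \<theta>]) (use \<alpha> False in simp_all)
      then show ?thesis using False by (simp add: rnorm_def)
    qed
  qed
  then show ?thesis unfolding rd_estimate_rnorm[OF \<alpha>(1) order_refl] Phi by blast
qed

text \<open>A line sum is at most q times the maximum of |F|, and there are at most 2 q^r
  directions.\<close>

lemma upper_alpha_0:
  assumes \<beta>: "0 < \<beta>" "\<beta> \<le> 1"
  shows "rd_estimate n (1 / ennreal 0) (1 / ennreal \<beta>) (\<lambda>q. 2 powr \<beta> * real q powr Phi n 0 \<beta>)"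
proof -
  have "0 \<le> r * \<beta>" using \<beta> by simp
  then have Phi: "Phi n 0 \<beta> = 1 + r * \<beta>"
    using \<beta> unfolding Phi_eq_max mult_zero_right left_diff_distrib mult_1_left by linarith
  have "rnorm \<beta> (refined_dirs R n) (Mrd R n F) \<le>
      2 powr \<beta> * real (card (carrier R)) powr (1 + r * \<beta>) * rnorm 0 (carrier (Heis R n)) (\<lambda>x.
          norm (F x))"
    if R: "R \<in> rings" for R F
  proof -
    let ?H = "carrier (Heis R n)" and ?D = "refined_dirs R n" and ?f = "\<lambda>x. norm (F x)"
      and ?q = "real (card (carrier R))"
    note member = family.member[OF R]
    define B where "B = ?q * rnorm 0 ?H ?f"
    have B: "0 \<le> B"
      using rnorm_nonneg[OF finite_Heis[OF R] Heis_nonempty[OF R], of ?f 0] by (simp add: B_def)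
    have q: "0 < ?q" using card_ge_2[OF R] by simp
    have le: "Mrd R n F \<theta> \<le> B" if "\<theta> \<in> ?D" for \<theta>
      unfolding Mrd_norm[of R F] B_def
      using le_rnorm_0[OF finite_Heis[OF R], of _ ?f]
      by (intro weak_type_maximal.M_le_sup[OF member _ _ that]) simp_all
    have "(\<Sum>\<theta>\<in>?D. Mrd R n F \<theta> powr (1 / \<beta>)) \<le> (\<Sum>\<theta>\<in>?D. B powr (1 / \<beta>))"
      using le Mrd_nonneg[OF R] \<beta> by (intro sum_mono powr_mono2) auto
    also have "\<dots> \<le> (2 * ?q powr r) * B powr (1 / \<beta>)"
      using heis_field.card_dirs_bounds(1)[OF heis[OF R] n] by (simp add: mult_right_mono)
    finally have "lnorm (1 / \<beta>) ?D (Mrd R n F) \<le> (2 * ?q powr r) powr (1 / (1 / \<beta>)) * B"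
      using \<beta> B by (intro lnorm_le) auto
    also have "\<dots> = 2 powr \<beta> * ?q powr (1 + r * \<beta>) * rnorm 0 ?H ?f"
      using q \<beta> by (simp add: B_def powr_mult powr_powr powr_add)
    finally show ?thesis using \<beta> by (simp add: rnorm_def)
  qed
  then show ?thesis unfolding rd_estimate_rnorm[OF order_refl less_imp_le[OF \<beta>(1)]] Phi by blast
qed

lemma upper:
  assumes "0 \<le> \<alpha>" "\<alpha> \<le> 1" "0 \<le> \<beta>" "\<beta> \<le> 1" "(\<alpha>, \<beta>) \<noteq> (1 / r, 1 / r)"
  shows "\<exists>C. rd_estimate n (1 / ennreal \<alpha>) (1 / ennreal \<beta>) (\<lambda>q. C * real q powr Phi n \<alpha> \<beta>)"
proof -
  consider "\<beta> = 0" | "\<alpha> = 0" "0 < \<beta>" | "0 < \<alpha>" "0 < \<beta>" using assms by linarith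
  then show ?thesis
  proof cases
    case 1 then show ?thesis using upper_beta_0[of \<alpha>] assms by blast
  next
    case 2 then show ?thesis using upper_alpha_0[of \<beta>] assms by blast
  next
    case 3 then show ?thesis using upper_interior[of \<alpha> \<beta>] assms by blast
  qed
qed

lemma upper_critical:
  obtains C where "0 \<le> C" "rd_estimate n (1 / ennreal (1 / r)) (1 / ennreal (1 / r))
    (\<lambda>q. C * real q powr ((r - 1) / r) * (1 + ln (real q)) powr (1 / r))"
proof
  define A where "A = 2 powr r * (2 * geo r + 4 * (r + 3) powr r)"
  have r0: "0 < r" using n by simp
  have A: "0 \<le> A" unfolding A_def using geo_pos[OF r0] by simp
  show "0 \<le> A powr (1 / r)" by simp
  have "rnorm (1 / r) (refined_dirs R n) (Mrd R n F) \<le>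
      A powr (1 / r) * real (card (carrier R)) powr ((r - 1) / r) * (1 + ln (real (card (carrier
          R)))) powr (1 / r)
       * rnorm (1 / r) (carrier (Heis R n)) (\<lambda>x. norm (F x))"
    if R: "R \<in> rings" for R F
  proof -
    let ?H = "carrier (Heis R n)" and ?D = "refined_dirs R n" and ?f = "\<lambda>x. norm (F x)"
      and ?q = "real (card (carrier R))"
    have lnq: "0 \<le> ln ?q" using card_ge_2[OF R] by simp
    have "(\<Sum>\<theta>\<in>?D. Mrd R n F \<theta> powr r) \<le>
        A * (1 + ln ?q) * (?q powr (1 - 1 / r) * lnorm r ?H ?f) powr r"
      unfolding Mrd_norm[of R F] A_def
      by (rule weak_type_maximal.estimate_critical[OF family.member[OF R]]) simp
    then have "lnorm r ?D (Mrd R n F) \<le> (A * (1 + ln ?q)) powr (1 / r) * (?q powr (1 - 1 / r) *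
        lnorm r ?H ?f)"
      using r0 A lnq lnorm_nonneg[of r ?H ?f] by (intro lnorm_le) auto
    moreover have "1 - 1 / r = (r - 1) / r" using r0 by (simp add: field_simps)
    ultimately show ?thesis
      using r0 A lnq by (simp add: rnorm_def powr_mult mult_ac)
  qed
  then show "rd_estimate n (1 / ennreal (1 / r)) (1 / ennreal (1 / r))
    (\<lambda>q. A powr (1 / r) * real q powr ((r - 1) / r) * (1 + ln (real q)) powr (1 / r))"
    using r0 by (simp add: rd_estimate_rnorm)
qed

text \<open>Prime fields have integers as elements and unbounded orders, which is enough to test
  sharpness.\<close>

lemma residue_ring_rings:
  assumes p: "prime p" "odd p"
  shows "residue_ring (int p) \<in> rings" "card (carrier (residue_ring (int p))) = p"
proof -
  interpret residues_prime p "residue_ring (int p)"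
    using p by (simp add: residues_prime_def)
  have "carrier (residue_ring (int p)) = {0..int p - 1}" by (simp add: residue_ring_def)
  then show c: "card (carrier (residue_ring (int p))) = p" by simp
  have "primepow p" using p by (simp add: primepow_prime)
  then show "residue_ring (int p) \<in> rings"
    using c p is_field unfolding rings_def by simp
qed

lemma lower:
  assumes \<alpha>: "0 \<le> \<alpha>" and \<beta>: "0 \<le> \<beta>"
    and est: "rd_estimate n (1 / ennreal \<alpha>) (1 / ennreal \<beta>) (\<lambda>q. C * real q powr a)"
  shows "Phi n \<alpha> \<beta> \<le> a"
proof (rule ccontr)
  assume "\<not> ?thesis"
  then have d: "0 < Phi n \<alpha> \<beta> - a" by simp
  let ?d = "Phi n \<alpha> \<beta> - a"
  \<comment> \<open>For p beyond |C|^(1/d) the power p^d exceeds C, against the bound p^d \<le> C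
    obtained below. The 2 under the maximum makes p odd.\<close>
  obtain p where p: "prime p" "max 2 (nat \<lceil>\<bar>C\<bar> powr (1 / ?d)\<rceil>) < p" using bigger_prime by blast
  have "odd p" using p primes_dvd_imp_eq[of 2 p] by auto
  note R = residue_ring_rings[OF p(1) this]
  have p0: "0 < real p" using p by simp
  have bounds: "real p powr e \<le> C * real p powr a"
    if "e \<in> {(r - 1) * \<beta>, 1 - \<alpha>, r * \<beta> - \<alpha>, 1 + r * \<beta> - (r + 1) * \<alpha>}" for e
  proof -
    have "\<And>F. rnorm \<beta> (refined_dirs (residue_ring (int p)) n) (Mrd (residue_ring (int p)) n F) \<le>
      C * real p powr a * rnorm \<alpha> (carrier (Heis (residue_ring (int p)) n)) (\<lambda>x. norm (F x))"
      using est R unfolding rd_estimate_rnorm[OF \<alpha> \<beta>] by force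
    from heis_field.lower_bounds[OF heis[OF R(1)] n \<alpha> \<beta> this] show ?thesis
      using that unfolding R(2) by auto
  qed
  have "Phi n \<alpha> \<beta> \<in> {(r - 1) * \<beta>, 1 - \<alpha>, r * \<beta> - \<alpha>, 1 + r * \<beta> - (r + 1) * \<alpha>}"
    unfolding Phi_def Let_def by (rule Max_in) auto
  from bounds[OF this] have "real p powr Phi n \<alpha> \<beta> * real p powr (- a) \<le>
      C * real p powr a * real p powr (- a)"
    by (rule mult_right_mono) simp
  also have "\<dots> = C * real p powr (a + - a)" unfolding powr_add by (simp only: mult.assoc)
  finally have le: "real p powr ?d \<le> C"
    unfolding powr_add[symmetric] using p0 by simp
  have "\<bar>C\<bar> powr (1 / ?d) < real p" using p(2) by linarith
  then have "(\<bar>C\<bar> powr (1 / ?d)) powr ?d < real p powr ?d" using d by (intro powr_less_mono2) auto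
  then show False using le d by (simp add: powr_powr)
qed

text \<open>Away from the critical point the exponent \<open>Phi\<close> is itself admissible. At
  the critical point every larger exponent is, since a power of the logarithm is absorbed by any
  positive power of q, and the infimum is still \<open>Phi\<close>.\<close>

lemma A_rd_eq:
  assumes "0 \<le> \<alpha>" "\<alpha> \<le> 1" "0 \<le> \<beta>" "\<beta> \<le> 1"
  shows "A_rd n (1 / ennreal \<alpha>) (1 / ennreal \<beta>) = Phi n \<alpha> \<beta>"
    and "(\<alpha>, \<beta>) \<noteq> (1 / r, 1 / r) \<Longrightarrow>
      A_rd n (1 / ennreal \<alpha>) (1 / ennreal \<beta>) \<in> admissible_exps n (1 / ennreal \<alpha>) (1 / ennreal \<beta>)"
proof -
  let ?S = "admissible_exps n (1 / ennreal \<alpha>) (1 / ennreal \<beta>)"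
  have ge: "Phi n \<alpha> \<beta> \<le> a" if "a \<in> ?S" for a
    using that lower[OF assms(1,3)] by (auto simp: admissible_exps_def)
  have mem: "Phi n \<alpha> \<beta> \<in> ?S" if "(\<alpha>, \<beta>) \<noteq> (1 / r, 1 / r)"
    using upper[OF assms that] Phi_nonneg[OF assms(2)] by (simp add: admissible_exps_def)
  have eps: "Phi n \<alpha> \<beta> + \<epsilon> \<in> ?S" if \<epsilon>: "0 < \<epsilon>" and crit: "\<alpha> = 1 / r" "\<beta> = 1 / r" for \<epsilon>
  proof -
    obtain C where C: "0 \<le> C" "rd_estimate n (1 / ennreal \<alpha>) (1 / ennreal \<beta>)
      (\<lambda>q. C * real q powr ((r - 1) / r) * (1 + ln (real q)) powr (1 / r))"
      unfolding crit by (rule upper_critical)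
    have r0: "0 < r" using n by simp
    have Phi: "Phi n \<alpha> \<beta> = (r - 1) / r" using r0 n by (simp add: Phi_eq_max crit field_simps)
    \<comment> \<open>From 1 + ln q \<le> (1 + 1/s) q^s, the root of order r costs q^(s/r), which is
      q^\<epsilon> for this s.\<close>
    define s where "s = \<epsilon> * r"
    have s: "0 < s" using \<epsilon> r0 by (simp add: s_def)
    define C' where "C' = C * (1 + 1 / s) powr (1 / r)"
    have "C * real q powr ((r - 1) / r) * (1 + ln (real q)) powr (1 / r) \<le>
        C' * real q powr (Phi n \<alpha> \<beta> + \<epsilon>)"
      if q: "2 \<le> q" for q :: nat
    proof -
      have "1 + ln (real q) \<le> real q powr s + real q powr s / s"
        using q s by (intro add_mono ln_powr_bound ge_one_powr_ge_zero) auto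
      also have "\<dots> = (1 + 1 / s) * real q powr s" by (simp add: algebra_simps)
      finally have "(1 + ln (real q)) powr (1 / r) \<le> ((1 + 1 / s) * real q powr s) powr (1 / r)"
        using q r0 by (intro powr_mono2) auto
      also have "\<dots> = (1 + 1 / s) powr (1 / r) * real q powr \<epsilon>"
        using s r0 n by (simp add: powr_mult powr_powr s_def)
      finally have "C * real q powr ((r - 1) / r) * (1 + ln (real q)) powr (1 / r) \<le>
         C * real q powr ((r - 1) / r) * ((1 + 1 / s) powr (1 / r) * real q powr \<epsilon>)"
        using C(1) by (intro mult_left_mono) auto
      then show ?thesis by (simp add: C'_def Phi powr_add mult_ac)
    qed
    then have "C * real (card (carrier R)) powr ((r - 1) / r) * (1 +
        ln (real (card (carrier R)))) powr (1 / r) *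
        rnorm \<alpha> (carrier (Heis R n)) (\<lambda>x. norm (F x)) \<le>
      C' * real (card (carrier R)) powr (Phi n \<alpha> \<beta> + \<epsilon>) * rnorm \<alpha> (carrier (Heis R n)) (\<lambda>x. norm
          (F x))"
      if R: "R \<in> rings" for R and F :: "int heis \<Rightarrow> complex"
      using card_ge_2[OF R] rnorm_nonneg[OF finite_Heis[OF R] Heis_nonempty[OF R], of
          "\<lambda>x. norm (F x)" \<alpha>]
      by (intro mult_right_mono) auto
    then have "rd_estimate n (1 / ennreal \<alpha>) (1 / ennreal \<beta>) (\<lambda>q. C' * real q powr (Phi n \<alpha> \<beta> + \<epsilon>))"
      using C(2) unfolding rd_estimate_rnorm[OF assms(1,3)] by (meson order_trans)
    then show ?thesis using Phi_nonneg[OF assms(2), of n \<beta>] \<epsilon> by (auto simp: admissible_exps_def)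
  qed
  have bdd: "bdd_below ?S" using ge by (rule bdd_belowI)
  have eps': "Phi n \<alpha> \<beta> + \<epsilon> \<in> ?S \<or> Phi n \<alpha> \<beta> \<in> ?S" if "0 < \<epsilon>" for \<epsilon>
    using eps[OF that] mem by blast
  have "A_rd n (1 / ennreal \<alpha>) (1 / ennreal \<beta>) \<le> Phi n \<alpha> \<beta> + \<epsilon>" if "0 < \<epsilon>" for \<epsilon>
    unfolding A_rd_def using eps'[OF that] cInf_lower[OF _ bdd] that
        by (meson add_increasing2 less_imp_le order_trans order_refl)
  then have "A_rd n (1 / ennreal \<alpha>) (1 / ennreal \<beta>) \<le> Phi n \<alpha> \<beta>" by (rule field_le_epsilon)
  moreover have "Phi n \<alpha> \<beta> \<le> A_rd n (1 / ennreal \<alpha>) (1 / ennreal \<beta>)"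
    unfolding A_rd_def using eps'[of 1] ge by (intro cInf_greatest) auto
  ultimately show eq: "A_rd n (1 / ennreal \<alpha>) (1 / ennreal \<beta>) = Phi n \<alpha> \<beta>" by simp
  show "(\<alpha>, \<beta>) \<noteq> (1 / r, 1 / r) \<Longrightarrow> A_rd n (1 / ennreal \<alpha>) (1 / ennreal \<beta>) \<in> ?S"
    unfolding eq by (rule mem)
qed

end

theorem theorem1p6:
  fixes n :: nat
  assumes "n \<ge> 2"
  shows
    "(\<forall>\<alpha>\<in>{0..1}. \<forall>\<beta>\<in>{0..1}. A_rd_tilde n \<alpha> \<beta> = Phi n \<alpha> \<beta>)
   \<and> (\<forall>u\<ge>1. \<forall>v\<ge>1. A_rd n u v =
        Max {(2 * real n - 1) * enn2real (1 / v),
             1 - enn2real (1 / u),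
             2 * real n * enn2real (1 / v) - enn2real (1 / u),
             1 + 2 * real n * enn2real (1 / v) - (2 * real n + 1) * enn2real (1 / u)})
   \<and> (\<forall>\<alpha>\<in>{0..1}. \<forall>\<beta>\<in>{0..1}. (\<alpha>, \<beta>) \<noteq> (1 / (2 * real n), 1 / (2 * real n)) \<longrightarrow>
        (\<exists>C. rd_estimate n (1 / ennreal \<alpha>) (1 / ennreal \<beta>) (\<lambda>q. C * real q powr Phi n \<alpha> \<beta>)))
   \<and> (\<exists>C. rd_estimate n (of_nat (2 * n)) (of_nat (2 * n))
        (\<lambda>q. C * real q powr ((2 * real n - 1) / (2 * real n))
               * (1 + ln (real q)) powr (1 / (2 * real n))))
   \<and> (\<forall>\<alpha>\<in>{0..1}. \<forall>\<beta>\<in>{0..1}. \<forall>a < Phi n \<alpha> \<beta>.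
        \<not> (\<exists>C. rd_estimate n (1 / ennreal \<alpha>) (1 / ennreal \<beta>) (\<lambda>q. C * real q powr a)))
   \<and> (\<forall>u\<ge>1. \<forall>v\<ge>1. (u, v) \<noteq> (of_nat (2 * n), of_nat (2 * n)) \<longrightarrow>
        A_rd n u v \<in> admissible_exps n u v)"
proof -
  interpret rd_problem n using assms by unfold_locales simp
  have crit: "(of_nat (2 * n) :: ennreal) = 1 / ennreal (1 / (2 * real n))"
    using of_nat_ennreal_reciprocal[of "2 * n"] n by simp
  show ?thesis
  proof (intro conjI ballI allI impI)
    show "A_rd_tilde n \<alpha> \<beta> = Phi n \<alpha> \<beta>" if "\<alpha> \<in> {0..1}" "\<beta> \<in> {0..1}" for \<alpha> \<beta>
      using A_rd_eq(1)[of \<alpha> \<beta>] that by (simp add: A_rd_tilde_def)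
    show "A_rd n u v = Max {(2 * real n - 1) * enn2real (1 / v), 1 - enn2real (1 / u),
             2 * real n * enn2real (1 / v) - enn2real (1 / u),
             1 + 2 * real n * enn2real (1 / v) - (2 * real n + 1) * enn2real (1 / u)}"
      if "1 \<le> u" "1 \<le> v" for u v
    proof -
      note u = ennreal_reciprocal[OF that(1)] and v = ennreal_reciprocal[OF that(2)]
      have "A_rd n u v = A_rd n (1 / ennreal (enn2real (1 / u))) (1 / ennreal (enn2real (1 / v)))"
        using u(2) v(2) by simp
      also have "\<dots> = Phi n (enn2real (1 / u)) (enn2real (1 / v))"
        using u(1) v(1) by (intro A_rd_eq(1)) auto
      finally show ?thesis by (simp only: Phi_def Let_def)
    qed
    show "\<exists>C. rd_estimate n (1 / ennreal \<alpha>) (1 / ennreal \<beta>) (\<lambda>q. C * real q powr Phi n \<alpha> \<beta>)"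
      if "\<alpha> \<in> {0..1}" "\<beta> \<in> {0..1}" "(\<alpha>, \<beta>) \<noteq> (1 / (2 * real n), 1 / (2 * real n))" for \<alpha> \<beta>
      using upper[of \<alpha> \<beta>] that by simp
    show "\<exists>C. rd_estimate n (of_nat (2 * n)) (of_nat (2 * n))
        (\<lambda>q. C * real q powr ((2 * real n - 1) / (2 * real n)) * (1 + ln (real q)) powr (1 / (2 *
            real n)))"
      unfolding crit by (rule upper_critical) blast
    show "\<not> (\<exists>C. rd_estimate n (1 / ennreal \<alpha>) (1 / ennreal \<beta>) (\<lambda>q. C * real q powr a))"
      if "\<alpha> \<in> {0..1}" "\<beta> \<in> {0..1}" "a < Phi n \<alpha> \<beta>" for \<alpha> \<beta> a
      using lower[of \<alpha> \<beta> _ a] that by fastforce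
    show "A_rd n u v \<in> admissible_exps n u v"
      if "1 \<le> u" "1 \<le> v" "(u, v) \<noteq> (of_nat (2 * n), of_nat (2 * n))" for u v
    proof -
      define \<alpha> \<beta> where "\<alpha> = enn2real (1 / u)" and "\<beta> = enn2real (1 / v)"
      have uv: "u = 1 / ennreal \<alpha>" "v = 1 / ennreal \<beta>" "\<alpha> \<in> {0..1}" "\<beta> \<in> {0..1}"
        using ennreal_reciprocal[OF that(1)] ennreal_reciprocal[OF that(2)]
            by (simp_all add: \<alpha>_def \<beta>_def)
      have "(\<alpha>, \<beta>) \<noteq> (1 / r, 1 / r)" using that(3) crit uv(1,2) by auto
      then show ?thesis using A_rd_eq(2)[of \<alpha> \<beta>] uv by simp
    qed
  qed
qed

end
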